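(* Let $F\colon M\to N$ and $F'\colon M'\to N'$ be smooth maps and let $\Phi=(\phi,\psi)\colon F\to F'$ be a morphism of arrows, i.e. smooth maps $\phi\colon M\to M'$, $\psi\colon N\to N'$ with $F'\circ\phi=\psi\circ F$. Then: (i) $\Phi^*(\alpha,\beta):=(\psi^*\alpha,\phi^*\beta)$ defines a morphism of cochain complexes $\Phi^*\colon\Omega^\bullet(F')\to\Omega^\bullet(F)$, i.e. $\Phi^*d_{F'}=d_F\Phi^*$, and descends to $H^\bullet(\Omega(F'))\to H^\bullet(\Omega(F))$; (ii) $\Phi_*(S,T):=(\psi_*S,\phi_*T)$ defines a morphism of chain complexes $C_\bullet(F)\to C_\bullet(F')$, i.e. $\Phi_*\partial_F=\partial_{F'}\Phi_*$; (iii) $\langle\Phi^*\Psi,c\rangle=\langle\Psi,\Phi_*c\rangle$ for all $\Psi\in\Omega^k(F')$ and $c\in C_k(F)$; (iv) consequently, for $d_{F'}$-closed $\Psi$, $P_{\Phi^*\Psi}\subseteq P_\Psi$; in particular, if $\Psi$ is relatively integral then so is $\Phi^*\Psi$; (v) $\Phi^*$ carries relative prequantizations to relative prequantizations: if $\Psi\in\Omega^2(F')$ is closed and $(L,\nabla,s)$ is a relative prequantization of $(F',\Psi)$, then $(\psi^*L,\psi^*\nabla,\phi^*s)$ is a relative prequantization of $(F,\Phi^*\Psi)$; (vi) suppose $\Phi$ is equivariant for an action of a Lie group $G$ on both arrows, $\Psi\in\Omega^{n+1}(F')$ is closed and preserved by the action, and $(f_k)_{1\le k\le n}$ is a relative homotopy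 moment map for $(F',\Psi)$; then $(\Phi^*\circ f_k)_{1\le k\le n}$ is a relative homotopy moment map for $(F,\Phi^*\Psi)$, provided the fundamental vector fields correspond, i.e. for every $x\in\mathfrak g$, $v_x^M$ is $\phi$-related to $v_x^{M'}$ and $v_x^N$ is $\psi$-related to $v_x^{N'}$.
   Context: For smooth $F\colon M\to N$: $\Omega^k(F)=\Omega^k(N)\oplus\Omega^{k-1}(M)$, $d_F(\alpha,\beta)=(d\alpha,F^*\alpha-d\beta)$. With $C_k(P)$ the smooth singular integral $k$-chains on $P$: $C_k(F)=C_k(N)\oplus C_{k-1}(M)$, $\partial_F(S,T)=(\partial S-F_*T,-\partial T)$, $Z_k(F)=\ker\partial_F$, and $\langle(\alpha,\beta),(S,T)\rangle=\int_S\alpha-\int_T\beta$. For closed $\varpi\in\Omega^k(F)$, $P_\varpi=\{\langle\varpi,c\rangle:c\in Z_k(F)\}\subseteq\mathbb R$; $\varpi$ is relatively integral if $P_\varpi\subseteq\mathbb Z$. Relative prequantization of $(F,\varpi)$, $\varpi=(\omega,\eta)\in\Omega^2(F)$ closed: a triple $(L,\nabla,s)$ where $(L,\nabla)$ is a Hermitian line bundle with unitary connection on $N$ with curvature $-2\pi i\,\omega$ (convention: if locally $\nabla=d-2\pi i\,a$ then the curvature is $-2\pi i\,da$), and $s$ is a unit-norm section of $F^*L\to M$ with $(F^*\nabla)s=-2\pi i\,\eta\otimes s$. In (v), $F^*\psi^*L$ is identified with $\phi^*F'^*L$. An action of $G$ on the arrow $F$ is an action of $G$ on $M$ and on $N$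 for which $F$ is equivariant. Fundamental vector fields: $v_x|_p=\frac{d}{dt}\big|_0\exp(-tx)\cdot p$; write $v_x=(v_x^N,v_x^M)$. An $F$-pair is $v=(v_N,v_M)$ with $v_N\in\mathfrak X(N)$, $v_M\in\mathfrak X(M)$ and $dF\circ v_M=v_N\circ F$; $\iota_v(\alpha,\beta)=(\iota_{v_N}\alpha,-\iota_{v_M}\beta)$ and $\iota(v_1\wedge\dots\wedge v_k)=\iota_{v_k}\cdots\iota_{v_1}$. Put $\varsigma(k)=-(-1)^{k(k+1)/2}$. For a $d_F$-closed $\varpi\in\Omega^{n+1}(F)$ preserved by $G$, a relative homotopy moment map is a family of linear maps $f_k\colon\Lambda^k\mathfrak g\to\Omega^{n-k}(F)$, $1\le k\le n$ (with $f_0=f_{n+1}=0$), such that for $1\le k\le n+1$ and all $x_1,\dots,x_k\in\mathfrak g$ $$\sum_{i<j}(-1)^{i+j+1}f_{k-1}([x_i,x_j],x_1,\dots,\widehat{x_i},\dots,\widehat{x_j},\dots,x_k)=d_Ff_k(x_1,\dots,x_k)+\varsigma(k)\,\iota(v_{x_1}\wedge\dots\wedge v_{x_k})\varpi .$$ *)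

theory Defs
  imports "HOL-Homology.Simplices" "HOL-Analysis.Analysis" "HOL-Library.Function_Algebras"
begin

(* Conventions.
   A manifold is given by a smooth atlas.  Its underlying set is an open subset of a Hausdorff,
   second countable type, so that the empty manifold is included.  The model space is a
   finite-dimensional real_normed_vector type (the class euclidean_space would exclude manifolds
   of dimension 0).  Sums of forms, of relative forms and of chains are the pointwise ones
   (Function_Algebras and the instances for pairs). *)

section \<open>Smooth manifolds and smooth maps\<close>

primrec Ck_on :: "nat \<Rightarrow> 'a::real_normed_vector set \<Rightarrow> ('a \<Rightarrow> 'b::real_normed_vector) \<Rightarrow> bool" where
  "Ck_on 0 S f \<longleftrightarrow> continuous_on S f"
| "Ck_on (Suc n) S f \<longleftrightarrow> (\<forall>x\<in>S. f differentiable (at x)) \<and>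
     (\<forall>u. Ck_on n S (\<lambda>x. frechet_derivative f (at x) u))"

(* Only used for open S. *)
definition smooth_on :: "'a::real_normed_vector set \<Rightarrow> ('a \<Rightarrow> 'b::real_normed_vector) \<Rightarrow> bool" where
  "smooth_on S f \<longleftrightarrow> (\<forall>n. Ck_on n S f)"

(* (domain, coordinate map) *)
type_synonym ('m, 'a) chart = "'m set \<times> ('m \<Rightarrow> 'a)"
type_synonym ('m, 'a) atlas = "('m, 'a) chart set"

definition chart_inv :: "('m, 'a) chart \<Rightarrow> 'a \<Rightarrow> 'm" where
  "chart_inv c = inv_into (fst c) (snd c)"

definition mcarrier :: "('m, 'a) atlas \<Rightarrow> 'm set" where
  "mcarrier A = (\<Union>c\<in>A. fst c)"

definition smooth_manifold ::
  "('m::{t2_space, second_countable_topology}, 'a::real_normed_vector) atlas \<Rightarrow> bool" where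
  "smooth_manifold A \<longleftrightarrow>
     (\<exists>B::'a set. finite B \<and> span B = UNIV) \<and>
     (\<forall>c\<in>A. open (fst c) \<and> open (snd c ` fst c) \<and>
        homeomorphism (fst c) (snd c ` fst c) (snd c) (chart_inv c)) \<and>
     (\<forall>c\<in>A. \<forall>d\<in>A. smooth_on (snd c ` (fst c \<inter> fst d)) (snd d \<circ> chart_inv c))"

(* Some chart around p.  Everything below that uses it is independent of the choice. *)
definition chart_at :: "('m, 'a) atlas \<Rightarrow> 'm \<Rightarrow> ('m, 'a) chart" where
  "chart_at A p = (SOME c. c \<in> A \<and> p \<in> fst c)"

definition smooth_map ::
  "('m::topological_space, 'a::real_normed_vector) atlas \<Rightarrow>
   ('n::topological_space, 'b::real_normed_vector) atlas \<Rightarrow> ('m \<Rightarrow> 'n) \<Rightarrow> bool" where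
  "smooth_map A B f \<longleftrightarrow> continuous_on (mcarrier A) f \<and> f ` mcarrier A \<subseteq> mcarrier B \<and>
     (\<forall>c\<in>A. \<forall>d\<in>B. smooth_on (snd c ` (fst c \<inter> f -` fst d)) (snd d \<circ> f \<circ> chart_inv c))"

definition smooth_fun_on ::
  "('m, 'a::real_normed_vector) atlas \<Rightarrow> 'm set \<Rightarrow> ('m \<Rightarrow> 'v::real_normed_vector) \<Rightarrow> bool" where
  "smooth_fun_on A U f \<longleftrightarrow> (\<forall>c\<in>A. smooth_on (snd c ` (fst c \<inter> U)) (f \<circ> chart_inv c))"

definition prod_atlas :: "('m, 'a) atlas \<Rightarrow> ('n, 'b) atlas \<Rightarrow> ('m \<times> 'n, 'a \<times> 'b) atlas" where
  "prod_atlas A B = {(fst c \<times> fst d, map_prod (snd c) (snd d)) | c d. c \<in> A \<and> d \<in> B}"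

definition real_atlas :: "(real, real) atlas" where
  "real_atlas = {(UNIV, id)}"

section \<open>Tangent vectors and vector fields\<close>

(* A tangent vector at p is the family of its components in all charts of the atlas around p,
   transforming by the derivatives of the transition maps (and 0 at all other charts). *)
type_synonym ('m, 'a) tvec = "('m, 'a) chart \<Rightarrow> 'a"

definition tangent_space :: "('m, 'a::real_normed_vector) atlas \<Rightarrow> 'm \<Rightarrow> ('m, 'a) tvec set" where
  "tangent_space A p = {v.
     (\<forall>c\<in>A. \<forall>d\<in>A. p \<in> fst c \<inter> fst d \<longrightarrow>
        v d = frechet_derivative (snd d \<circ> chart_inv c) (at (snd c p)) (v c)) \<and>
     (\<forall>c. \<not> (c \<in> A \<and> p \<in> fst c) \<longrightarrow> v c = 0)}"

definition tv_lin :: "real \<Rightarrow> ('m, 'a::real_vector) tvec \<Rightarrow> real \<Rightarrow> ('m, 'a) tvec \<Rightarrow> ('m, 'a) tvec" where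
  "tv_lin r v s w = (\<lambda>c. r *\<^sub>R v c + s *\<^sub>R w c)"

(* The tangent vector at p with components u in the chart c. *)
definition coord_tvec ::
  "('m, 'a::real_normed_vector) atlas \<Rightarrow> ('m, 'a) chart \<Rightarrow> 'm \<Rightarrow> 'a \<Rightarrow> ('m, 'a) tvec" where
  "coord_tvec A c p u = (\<lambda>d. if d \<in> A \<and> p \<in> fst d
     then frechet_derivative (snd d \<circ> chart_inv c) (at (snd c p)) u else 0)"

(* The differential of f at p. *)
definition tmap ::
  "('m, 'a::real_normed_vector) atlas \<Rightarrow> ('n, 'b::real_normed_vector) atlas \<Rightarrow> ('m \<Rightarrow> 'n) \<Rightarrow>
   'm \<Rightarrow> ('m, 'a) tvec \<Rightarrow> ('n, 'b) tvec" where
  "tmap A B f p v = (\<lambda>d. if d \<in> B \<and> f p \<in> fst d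
     then let c = chart_at A p in
       frechet_derivative (snd d \<circ> f \<circ> chart_inv c) (at (snd c p)) (v c)
     else 0)"

(* df_p(v) for a vector-valued function f. *)
definition fun_deriv ::
  "('m, 'a::real_normed_vector) atlas \<Rightarrow> ('m \<Rightarrow> 'v::real_normed_vector) \<Rightarrow> 'm \<Rightarrow> ('m, 'a) tvec \<Rightarrow> 'v" where
  "fun_deriv A f p v = (let c = chart_at A p in
     frechet_derivative (f \<circ> chart_inv c) (at (snd c p)) (v c))"

(* The velocity of a curve that is differentiable at t (0 otherwise, so that it is always a tangent
   vector). *)
definition velocity ::
  "('m::topological_space, 'a::real_normed_vector) atlas \<Rightarrow> (real \<Rightarrow> 'm) \<Rightarrow> real \<Rightarrow> ('m, 'a) tvec" where
  "velocity A \<gamma> t = (\<lambda>d. if d \<in> A \<and> \<gamma> t \<in> fst d \<and> isCont \<gamma> t \<and> (snd d \<circ> \<gamma>) differentiable (at t)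
     then vector_derivative (snd d \<circ> \<gamma>) (at t) else 0)"

(* [X,Y] = DY(X) - DX(Y) in every chart. *)
definition lie_bracket ::
  "('m, 'a::real_normed_vector) atlas \<Rightarrow> ('m \<Rightarrow> ('m, 'a) tvec) \<Rightarrow> ('m \<Rightarrow> ('m, 'a) tvec) \<Rightarrow>
   'm \<Rightarrow> ('m, 'a) tvec" where
  "lie_bracket A X Y p = (\<lambda>d. if d \<in> A \<and> p \<in> fst d
     then frechet_derivative (\<lambda>x. Y (chart_inv d x) d) (at (snd d p)) (X p d)
        - frechet_derivative (\<lambda>x. X (chart_inv d x) d) (at (snd d p)) (Y p d)
     else 0)"

section \<open>Differential forms\<close>

(* A k-form evaluates on lists of k tangent vectors.  Forms are made extensional (value 0 on all
   other arguments), so that equality of forms is equality of functions. *)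
type_synonym ('m, 'a, 'v) form = "'m \<Rightarrow> ('m, 'a) tvec list \<Rightarrow> 'v"

definition alt_multilinear ::
  "('m, 'a::real_vector) tvec set \<Rightarrow> nat \<Rightarrow> (('m, 'a) tvec list \<Rightarrow> 'v::real_vector) \<Rightarrow> bool" where
  "alt_multilinear V k g \<longleftrightarrow>
     (\<forall>vs i. length vs = k \<and> set vs \<subseteq> V \<and> i < k \<longrightarrow> (\<forall>u\<in>V. \<forall>w\<in>V. \<forall>r s.
        g (vs[i := tv_lin r u s w]) = r *\<^sub>R g (vs[i := u]) + s *\<^sub>R g (vs[i := w]))) \<and>
     (\<forall>vs. length vs = k \<and> set vs \<subseteq> V \<and> \<not> distinct vs \<longrightarrow> g vs = 0)"

(* The local representative of a form in the chart c. *)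
definition coord_rep ::
  "('m, 'a::real_normed_vector) atlas \<Rightarrow> ('m, 'a) chart \<Rightarrow> ('m, 'a, 'v) form \<Rightarrow> 'a \<Rightarrow> 'a list \<Rightarrow> 'v" where
  "coord_rep A c \<alpha> x us = \<alpha> (chart_inv c x) (map (coord_tvec A c (chart_inv c x)) us)"

definition diff_forms ::
  "('m, 'a::real_normed_vector) atlas \<Rightarrow> nat \<Rightarrow> ('m, 'a, 'v::real_normed_vector) form set" where
  "diff_forms A k = {\<alpha>.
     (\<forall>p vs. \<not> (p \<in> mcarrier A \<and> length vs = k \<and> set vs \<subseteq> tangent_space A p) \<longrightarrow> \<alpha> p vs = 0) \<and>
     (\<forall>p\<in>mcarrier A. alt_multilinear (tangent_space A p) k (\<alpha> p)) \<and>
     (\<forall>c\<in>A. \<forall>us. length us = k \<longrightarrow> smooth_on (snd c ` fst c) (\<lambda>x. coord_rep A c \<alpha> x us))}"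

definition remove_nth :: "nat \<Rightarrow> 'x list \<Rightarrow> 'x list" where
  "remove_nth i xs = take i xs @ drop (Suc i) xs"

(* In a chart: (d\<alpha>)_x(u_0,...,u_k) = \<Sum>_i (-1)^i (D\<alpha>_x u_i)(u_0,..,u_(i-1),u_(i+1),..,u_k). *)
definition ext_d ::
  "('m, 'a::real_normed_vector) atlas \<Rightarrow> ('m, 'a, 'v::real_normed_vector) form \<Rightarrow> ('m, 'a, 'v) form" where
  "ext_d A \<alpha> p vs =
     (if p \<in> mcarrier A \<and> set vs \<subseteq> tangent_space A p
      then let c = chart_at A p in
        (\<Sum>i<length vs. (-1) ^ i *\<^sub>R
           frechet_derivative (\<lambda>x. coord_rep A c \<alpha> x (map (\<lambda>v. v c) (remove_nth i vs)))
             (at (snd c p)) ((vs ! i) c))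
      else 0)"

definition pullback ::
  "('m, 'a::real_normed_vector) atlas \<Rightarrow> ('n, 'b::real_normed_vector) atlas \<Rightarrow> ('m \<Rightarrow> 'n) \<Rightarrow>
   ('n, 'b, 'v::zero) form \<Rightarrow> ('m, 'a, 'v) form" where
  "pullback A B f \<alpha> p vs =
     (if p \<in> mcarrier A \<and> set vs \<subseteq> tangent_space A p then \<alpha> (f p) (map (tmap A B f p) vs) else 0)"

definition contraction ::
  "('m, 'a::real_normed_vector) atlas \<Rightarrow> ('m \<Rightarrow> ('m, 'a) tvec) \<Rightarrow>
   ('m, 'a, 'v::zero) form \<Rightarrow> ('m, 'a, 'v) form" where
  "contraction A X \<alpha> p vs =
     (if p \<in> mcarrier A \<and> set vs \<subseteq> tangent_space A p then \<alpha> p (X p # vs) else 0)"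

section \<open>Smooth singular chains and integration\<close>

(* C^n with respect to the coordinates 0,...,p of R^(p+1), through iterated partial derivatives;
   W is open in the product topology on nat => real. *)
primrec Ck_partial ::
  "nat \<Rightarrow> nat \<Rightarrow> (nat \<Rightarrow> real) set \<Rightarrow> ((nat \<Rightarrow> real) \<Rightarrow> 'b::real_normed_vector) \<Rightarrow> bool" where
  "Ck_partial p 0 W f \<longleftrightarrow> continuous_on W f"
| "Ck_partial p (Suc n) W f \<longleftrightarrow> continuous_on W f \<and>
     (\<forall>i\<le>p. \<exists>g. (\<forall>x\<in>W. ((\<lambda>s. f (x(i := s))) has_vector_derivative g x) (at (x i))) \<and>
        Ck_partial p n W g)"

(* A simplex is smooth if it extends to a smooth map on a neighbourhood of the standard simplex. *)
definition smooth_simplex ::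
  "nat \<Rightarrow> ('m::topological_space, 'a::real_normed_vector) atlas \<Rightarrow> ((nat \<Rightarrow> real) \<Rightarrow> 'm) \<Rightarrow> bool" where
  "smooth_simplex p A \<sigma> \<longleftrightarrow> singular_simplex p (top_of_set (mcarrier A)) \<sigma> \<and>
     (\<exists>W g. open W \<and> standard_simplex p \<subseteq> W \<and> (\<forall>x\<in>standard_simplex p. g x = \<sigma> x) \<and>
        continuous_on W g \<and> g ` W \<subseteq> mcarrier A \<and>
        (\<forall>c\<in>A. \<forall>n. Ck_partial p n (W \<inter> g -` fst c) (snd c \<circ> g)))"

definition smooth_chains ::
  "('m::topological_space, 'a::real_normed_vector) atlas \<Rightarrow> nat \<Rightarrow> 'm chain set" where
  "smooth_chains A k = {S. \<forall>\<sigma>\<in>Poly_Mapping.keys S. smooth_simplex k A \<sigma>}"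

(* Coordinates t_0,...,t_(p-1) on the standard p-simplex; t_j is the barycentric coordinate of the
   vertex e_(j+1), so that e_1 - e_0,...,e_p - e_0 is positively oriented. *)
definition simplex_param :: "nat \<Rightarrow> (nat \<Rightarrow> real) \<Rightarrow> nat \<Rightarrow> real" where
  "simplex_param p t = (\<lambda>i. if i = 0 then 1 - (\<Sum>j<p. t j) else if i \<le> p then t (i - 1) else 0)"

(* The integral of the pull-back of \<alpha> over the interior of the simplex (whose boundary is a null
   set); for p = 0 the measure is a unit point mass. *)
definition simplex_integral ::
  "('m::topological_space, 'a::real_normed_vector) atlas \<Rightarrow> nat \<Rightarrow> ('m, 'a, real) form \<Rightarrow> ((nat \<Rightarrow> real) \<Rightarrow> 'm) \<Rightarrow> real" where
  "simplex_integral A p \<alpha> \<sigma> =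
     (LINT t:{t. (\<forall>j<p. 0 < t j) \<and> (\<Sum>j<p. t j) < 1}|(PiM {..<p} (\<lambda>_. lborel)).
        \<alpha> (\<sigma> (simplex_param p t))
          (map (\<lambda>j. velocity A (\<lambda>s. \<sigma> (simplex_param p (t(j := s)))) (t j)) [0..<p]))"

definition chain_integral ::
  "('m::topological_space, 'a::real_normed_vector) atlas \<Rightarrow> nat \<Rightarrow> ('m, 'a, real) form \<Rightarrow> 'm chain \<Rightarrow> real" where
  "chain_integral A p \<alpha> S =
     (\<Sum>\<sigma>\<in>Poly_Mapping.keys S. of_int (Poly_Mapping.lookup S \<sigma>) * simplex_integral A p \<alpha> \<sigma>)"

section \<open>Arrows and the relative complexes\<close>

record ('m, 'a, 'n, 'b) arrow =
  src :: "('m, 'a) atlas"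
  tgt :: "('n, 'b) atlas"
  amap :: "'m \<Rightarrow> 'n"

definition smooth_arrow ::
  "('m::{t2_space, second_countable_topology}, 'a::real_normed_vector,
    'n::{t2_space, second_countable_topology}, 'b::real_normed_vector) arrow \<Rightarrow> bool" where
  "smooth_arrow F \<longleftrightarrow> smooth_manifold (src F) \<and> smooth_manifold (tgt F) \<and>
     smooth_map (src F) (tgt F) (amap F)"

definition arrow_morphism ::
  "('m::topological_space, 'a::real_normed_vector, 'n::topological_space, 'b::real_normed_vector) arrow \<Rightarrow>
   ('m'::topological_space, 'a'::real_normed_vector, 'n'::topological_space, 'b'::real_normed_vector) arrow \<Rightarrow>
   ('m \<Rightarrow> 'm') \<Rightarrow> ('n \<Rightarrow> 'n') \<Rightarrow> bool" where
  "arrow_morphism F F' \<phi> \<psi> \<longleftrightarrow> smooth_map (src F) (src F') \<phi> \<and> smooth_map (tgt F) (tgt F') \<psi> \<and>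
     (\<forall>p\<in>mcarrier (src F). amap F' (\<phi> p) = \<psi> (amap F p))"

type_synonym ('m, 'a, 'n, 'b) rel_form = "('n, 'b, real) form \<times> ('m, 'a, real) form"

definition rel_forms ::
  "('m, 'a::real_normed_vector, 'n, 'b::real_normed_vector) arrow \<Rightarrow> nat \<Rightarrow> ('m, 'a, 'n, 'b) rel_form set" where
  "rel_forms F k = {(\<alpha>, \<beta>). \<alpha> \<in> diff_forms (tgt F) k \<and>
     (if k = 0 then \<beta> = 0 else \<beta> \<in> diff_forms (src F) (k - 1))}"

definition rel_d ::
  "('m, 'a::real_normed_vector, 'n, 'b::real_normed_vector) arrow \<Rightarrow>
   ('m, 'a, 'n, 'b) rel_form \<Rightarrow> ('m, 'a, 'n, 'b) rel_form" where
  "rel_d F \<Psi> = (ext_d (tgt F) (fst \<Psi>),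
     pullback (src F) (tgt F) (amap F) (fst \<Psi>) - ext_d (src F) (snd \<Psi>))"

definition rel_lin ::
  "real \<Rightarrow> ('m, 'a, 'n, 'b) rel_form \<Rightarrow> real \<Rightarrow> ('m, 'a, 'n, 'b) rel_form \<Rightarrow> ('m, 'a, 'n, 'b) rel_form" where
  "rel_lin r \<Psi> s \<Theta> = ((\<lambda>p vs. r * fst \<Psi> p vs + s * fst \<Theta> p vs), (\<lambda>p vs. r * snd \<Psi> p vs + s * snd \<Theta> p vs))"

abbreviation rel_scale :: "real \<Rightarrow> ('m, 'a, 'n, 'b) rel_form \<Rightarrow> ('m, 'a, 'n, 'b) rel_form" where
  "rel_scale r \<Psi> \<equiv> rel_lin r \<Psi> 0 0"

definition rel_closed ::
  "('m, 'a::real_normed_vector, 'n, 'b::real_normed_vector) arrow \<Rightarrow> nat \<Rightarrow> ('m, 'a, 'n, 'b) rel_form set" where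
  "rel_closed F k = {\<Psi> \<in> rel_forms F k. rel_d F \<Psi> = 0}"

definition rel_exact ::
  "('m, 'a::real_normed_vector, 'n, 'b::real_normed_vector) arrow \<Rightarrow> nat \<Rightarrow> ('m, 'a, 'n, 'b) rel_form set" where
  "rel_exact F k = (if k = 0 then {0} else rel_d F ` rel_forms F (k - 1))"

definition rel_class ::
  "('m, 'a::real_normed_vector, 'n, 'b::real_normed_vector) arrow \<Rightarrow> nat \<Rightarrow>
   ('m, 'a, 'n, 'b) rel_form \<Rightarrow> ('m, 'a, 'n, 'b) rel_form set" where
  "rel_class F k \<Psi> = {\<Theta> \<in> rel_closed F k. \<Theta> - \<Psi> \<in> rel_exact F k}"

definition rel_cohomology ::
  "('m, 'a::real_normed_vector, 'n, 'b::real_normed_vector) arrow \<Rightarrow> nat \<Rightarrow> ('m, 'a, 'n, 'b) rel_form set set" where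
  "rel_cohomology F k = rel_class F k ` rel_closed F k"

(* The linear structure of the quotient space: r[\<Psi>] + s[\<Theta>] = [r\<Psi> + s\<Theta>]. *)
definition class_lin ::
  "('m, 'a::real_normed_vector, 'n, 'b::real_normed_vector) arrow \<Rightarrow> nat \<Rightarrow>
   real \<Rightarrow> ('m, 'a, 'n, 'b) rel_form set \<Rightarrow> real \<Rightarrow> ('m, 'a, 'n, 'b) rel_form set \<Rightarrow>
   ('m, 'a, 'n, 'b) rel_form set" where
  "class_lin F k r X s Y = (\<Union>\<Psi>\<in>X. \<Union>\<Theta>\<in>Y. rel_class F k (rel_lin r \<Psi> s \<Theta>))"

type_synonym ('m, 'n) rel_chain = "'n chain \<times> 'm chain"

(* Degree -1 chains (k = 0) are 0. *)
definition rel_chains ::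
  "('m::topological_space, 'a::real_normed_vector, 'n::topological_space, 'b::real_normed_vector) arrow \<Rightarrow>
   nat \<Rightarrow> ('m, 'n) rel_chain set" where
  "rel_chains F k = {(S, T). S \<in> smooth_chains (tgt F) k \<and>
     (if k = 0 then T = 0 else T \<in> smooth_chains (src F) (k - 1))}"

definition rel_boundary ::
  "('m, 'a, 'n, 'b) arrow \<Rightarrow> nat \<Rightarrow> ('m, 'n) rel_chain \<Rightarrow> ('m, 'n) rel_chain" where
  "rel_boundary F k c = (chain_boundary k (fst c) - chain_map (k - 1) (amap F) (snd c),
     - chain_boundary (k - 1) (snd c))"

definition rel_cycles ::
  "('m::topological_space, 'a::real_normed_vector, 'n::topological_space, 'b::real_normed_vector) arrow \<Rightarrow>
   nat \<Rightarrow> ('m, 'n) rel_chain set" where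
  "rel_cycles F k = {c \<in> rel_chains F k. rel_boundary F k c = 0}"

definition rel_pairing ::
  "('m::topological_space, 'a::real_normed_vector, 'n::topological_space, 'b::real_normed_vector) arrow \<Rightarrow> nat \<Rightarrow>
   ('m, 'a, 'n, 'b) rel_form \<Rightarrow> ('m, 'n) rel_chain \<Rightarrow> real" where
  "rel_pairing F k \<Psi> c =
     chain_integral (tgt F) k (fst \<Psi>) (fst c) - chain_integral (src F) (k - 1) (snd \<Psi>) (snd c)"

definition rel_periods ::
  "('m::topological_space, 'a::real_normed_vector, 'n::topological_space, 'b::real_normed_vector) arrow \<Rightarrow>
   nat \<Rightarrow> ('m, 'a, 'n, 'b) rel_form \<Rightarrow> real set" where
  "rel_periods F k \<Psi> = rel_pairing F k \<Psi> ` rel_cycles F k"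

definition relatively_integral ::
  "('m::topological_space, 'a::real_normed_vector, 'n::topological_space, 'b::real_normed_vector) arrow \<Rightarrow>
   nat \<Rightarrow> ('m, 'a, 'n, 'b) rel_form \<Rightarrow> bool" where
  "relatively_integral F k \<Psi> \<longleftrightarrow> rel_periods F k \<Psi> \<subseteq> \<int>"

definition rel_pullback ::
  "('m, 'a::real_normed_vector, 'n, 'b::real_normed_vector) arrow \<Rightarrow>
   ('m', 'a'::real_normed_vector, 'n', 'b'::real_normed_vector) arrow \<Rightarrow>
   ('m \<Rightarrow> 'm') \<Rightarrow> ('n \<Rightarrow> 'n') \<Rightarrow> ('m', 'a', 'n', 'b') rel_form \<Rightarrow> ('m, 'a, 'n, 'b) rel_form" where
  "rel_pullback F F' \<phi> \<psi> \<Psi> =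
     (pullback (tgt F) (tgt F') \<psi> (fst \<Psi>), pullback (src F) (src F') \<phi> (snd \<Psi>))"

definition rel_push ::
  "nat \<Rightarrow> ('m \<Rightarrow> 'm') \<Rightarrow> ('n \<Rightarrow> 'n') \<Rightarrow> ('m, 'n) rel_chain \<Rightarrow> ('m', 'n') rel_chain" where
  "rel_push k \<phi> \<psi> c = (chain_map k \<psi> (fst c), chain_map (k - 1) \<phi> (snd c))"

section \<open>Hermitian line bundles with connection\<close>

(* The smooth structure is given by the local trivialisations (U, \<tau>), where \<tau> maps the part of the
   total space over U to the complex numbers, fibrewise as a linear isomorphism. *)
record ('n, 'l) line_bundle =
  total :: "'l set"
  proj :: "'l \<Rightarrow> 'n"
  ladd :: "'l \<Rightarrow> 'l \<Rightarrow> 'l"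
  lscale :: "complex \<Rightarrow> 'l \<Rightarrow> 'l"
  herm :: "'l \<Rightarrow> 'l \<Rightarrow> complex"
  trivs :: "('n set \<times> ('l \<Rightarrow> complex)) set"

definition fiber :: "('n, 'l) line_bundle \<Rightarrow> 'n \<Rightarrow> 'l set" where
  "fiber L p = {l \<in> total L. proj L l = p}"

(* The local frame corresponding to the constant 1 in a local trivialisation \<tau>. *)
definition frame :: "('n, 'l) line_bundle \<Rightarrow> ('l \<Rightarrow> complex) \<Rightarrow> 'n \<Rightarrow> 'l" where
  "frame L \<tau> p = inv_into (fiber L p) \<tau> 1"

(* The complex vector space axioms of the fibres follow from the linear trivialisations. *)
definition hermitian_line_bundle ::
  "('n::topological_space, 'b::real_normed_vector) atlas \<Rightarrow> ('n, 'l) line_bundle \<Rightarrow> bool" where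
  "hermitian_line_bundle B L \<longleftrightarrow>
     proj L ` total L \<subseteq> mcarrier B \<and>
     (\<forall>p\<in>mcarrier B. \<forall>l\<in>fiber L p. \<forall>l'\<in>fiber L p. \<forall>z.
        ladd L l l' \<in> fiber L p \<and> lscale L z l \<in> fiber L p) \<and>
     (\<Union>(U, \<tau>)\<in>trivs L. U) = mcarrier B \<and>
     (\<forall>(U, \<tau>)\<in>trivs L. open U \<and>
        (\<forall>p\<in>U. bij_betw \<tau> (fiber L p) UNIV \<and>
           (\<forall>l\<in>fiber L p. \<forall>l'\<in>fiber L p. \<forall>z. \<tau> (ladd L l l') = \<tau> l + \<tau> l' \<and> \<tau> (lscale L z l) = z * \<tau> l))) \<and>
     (\<forall>(U, \<tau>)\<in>trivs L. \<forall>(V, \<tau>')\<in>trivs L. smooth_fun_on B (U \<inter> V) (\<lambda>p. \<tau>' (frame L \<tau> p))) \<and>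
     (\<forall>p\<in>mcarrier B. \<forall>l\<in>fiber L p. \<forall>l'\<in>fiber L p. \<forall>l''\<in>fiber L p. \<forall>z.
        herm L (ladd L l l') l'' = herm L l l'' + herm L l' l'' \<and>
        herm L (lscale L z l) l' = z * herm L l l' \<and>
        herm L l' l = cnj (herm L l l') \<and>
        (l \<noteq> lscale L 0 l \<longrightarrow> 0 < Re (herm L l l))) \<and>
     (\<forall>(U, \<tau>)\<in>trivs L. smooth_fun_on B U (\<lambda>p. herm L (frame L \<tau> p) (frame L \<tau> p)))"

definition smooth_section ::
  "('n, 'b::real_normed_vector) atlas \<Rightarrow> ('n, 'l) line_bundle \<Rightarrow> 'n set \<Rightarrow> ('n \<Rightarrow> 'l) \<Rightarrow> bool" where
  "smooth_section B L U s \<longleftrightarrow> (\<forall>p\<in>U. s p \<in> fiber L p) \<and>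
     (\<forall>(V, \<tau>)\<in>trivs L. smooth_fun_on B (U \<inter> V) (\<tau> \<circ> s))"

(* nab s p v is the covariant derivative at p in direction v of a section s defined near p
   (the values of s elsewhere are irrelevant). *)
type_synonym ('n, 'b, 'l) conn = "('n \<Rightarrow> 'l) \<Rightarrow> 'n \<Rightarrow> ('n, 'b) tvec \<Rightarrow> 'l"

definition connection ::
  "('n::topological_space, 'b::real_normed_vector) atlas \<Rightarrow> ('n, 'l) line_bundle \<Rightarrow> ('n, 'b, 'l) conn \<Rightarrow> bool" where
  "connection B L nab \<longleftrightarrow>
     (\<forall>U s t f. open U \<and> U \<subseteq> mcarrier B \<and> smooth_section B L U s \<and> smooth_section B L U t \<and>
        smooth_fun_on B U f \<longrightarrow>
       (\<forall>p\<in>U. \<forall>v\<in>tangent_space B p. \<forall>w\<in>tangent_space B p.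
          nab s p v \<in> fiber L p \<and>
          (\<forall>a b. nab s p (tv_lin a v b w) =
             ladd L (lscale L (of_real a) (nab s p v)) (lscale L (of_real b) (nab s p w))) \<and>
          nab (\<lambda>q. ladd L (s q) (t q)) p v = ladd L (nab s p v) (nab t p v) \<and>
          nab (\<lambda>q. lscale L (f q) (s q)) p v =
            ladd L (lscale L (fun_deriv B f p v) (s p)) (lscale L (f p) (nab s p v)) \<and>
          ((\<forall>q\<in>U. s q = t q) \<longrightarrow> nab s p v = nab t p v)) \<and>
       (\<forall>c\<in>B. \<forall>u. smooth_section B L (U \<inter> fst c) (\<lambda>q. nab s q (coord_tvec B c q u))))"

definition unitary_connection ::
  "('n::topological_space, 'b::real_normed_vector) atlas \<Rightarrow> ('n, 'l) line_bundle \<Rightarrow> ('n, 'b, 'l) conn \<Rightarrow> bool" where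
  "unitary_connection B L nab \<longleftrightarrow> connection B L nab \<and>
     (\<forall>U s t. open U \<and> U \<subseteq> mcarrier B \<and> smooth_section B L U s \<and> smooth_section B L U t \<longrightarrow>
       (\<forall>p\<in>U. \<forall>v\<in>tangent_space B p.
          fun_deriv B (\<lambda>q. herm L (s q) (t q)) p v = herm L (nab s p v) (t p) + herm L (s p) (nab t p v)))"

(* If nab e = \<theta> \<otimes> e for a local frame e, then the curvature is d\<theta>; thus nab = d - 2\<pi>i a has
   curvature -2\<pi>i da. *)
definition has_curvature ::
  "('n::topological_space, 'b::real_normed_vector) atlas \<Rightarrow> ('n, 'l) line_bundle \<Rightarrow> ('n, 'b, 'l) conn \<Rightarrow>
   ('n, 'b, complex) form \<Rightarrow> bool" where
  "has_curvature B L nab K \<longleftrightarrow>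
     (\<forall>U e \<theta>. open U \<and> U \<subseteq> mcarrier B \<and> smooth_section B L U e \<and> (\<forall>p\<in>U. e p \<noteq> lscale L 0 (e p)) \<and>
        (\<forall>p\<in>U. \<forall>v\<in>tangent_space B p. nab e p v = lscale L (\<theta> p [v]) (e p)) \<longrightarrow>
       (\<forall>p\<in>U. \<forall>v\<in>tangent_space B p. \<forall>w\<in>tangent_space B p. ext_d B \<theta> p [v, w] = K p [v, w]))"

definition pullback_bundle ::
  "('m, 'a) atlas \<Rightarrow> ('m \<Rightarrow> 'n) \<Rightarrow> ('n, 'l) line_bundle \<Rightarrow> ('m, 'm \<times> 'l) line_bundle" where
  "pullback_bundle A f L = \<lparr>
     total = {(p, l). p \<in> mcarrier A \<and> l \<in> total L \<and> proj L l = f p},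
     proj = fst,
     ladd = (\<lambda>x y. (fst x, ladd L (snd x) (snd y))),
     lscale = (\<lambda>z x. (fst x, lscale L z (snd x))),
     herm = (\<lambda>x y. herm L (snd x) (snd y)),
     trivs = {(mcarrier A \<inter> f -` U, \<tau> \<circ> snd) | U \<tau>. (U, \<tau>) \<in> trivs L}\<rparr>"

(* The connection determined by (f^*nab)_v (f^*t) = nab_(df(v)) t and the Leibniz rule: near p a
   section is g f^*e, with e the frame of some local trivialisation around f p. *)
definition pullback_conn ::
  "('m, 'a::real_normed_vector) atlas \<Rightarrow> ('n, 'b::real_normed_vector) atlas \<Rightarrow> ('m \<Rightarrow> 'n) \<Rightarrow>
   ('n, 'l) line_bundle \<Rightarrow> ('n, 'b, 'l) conn \<Rightarrow> ('m, 'a, 'm \<times> 'l) conn" where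
  "pullback_conn A B f L nab s p v =
     (let \<tau> = snd (SOME z. z \<in> trivs L \<and> f p \<in> fst z);
          e = frame L \<tau>;
          g = (\<lambda>q. \<tau> (snd (s q)))
      in (p, ladd L (lscale L (fun_deriv A g p v) (e (f p))) (lscale L (g p) (nab e (f p) (tmap A B f p v)))))"

definition pullback_section :: "('m \<Rightarrow> 'n) \<Rightarrow> ('n \<Rightarrow> 'l) \<Rightarrow> 'm \<Rightarrow> 'm \<times> 'l" where
  "pullback_section f s p = (p, s (f p))"

(* The identification of \<phi>^*F'^*L with F^*\<psi>^*L, for F' \<circ> \<phi> = \<psi> \<circ> F. *)
definition pullback_ident :: "('m, 'a, 'n, 'b) arrow \<Rightarrow> 'm \<times> ('m' \<times> 'l) \<Rightarrow> 'm \<times> ('n \<times> 'l)" where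
  "pullback_ident F = (\<lambda>(p, (q, l)). (p, (amap F p, l)))"

definition rel_prequantization ::
  "('m::{t2_space, second_countable_topology}, 'a::real_normed_vector,
    'n::{t2_space, second_countable_topology}, 'b::real_normed_vector) arrow \<Rightarrow>
   ('m, 'a, 'n, 'b) rel_form \<Rightarrow> ('n, 'l) line_bundle \<Rightarrow> ('n, 'b, 'l) conn \<Rightarrow> ('m \<Rightarrow> 'm \<times> 'l) \<Rightarrow> bool" where
  "rel_prequantization F \<Psi> L nab s \<longleftrightarrow>
     \<Psi> \<in> rel_closed F 2 \<and>
     hermitian_line_bundle (tgt F) L \<and>
     unitary_connection (tgt F) L nab \<and>
     has_curvature (tgt F) L nab (\<lambda>p vs. - 2 * pi * \<i> * of_real (fst \<Psi> p vs)) \<and>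
     (let FL = pullback_bundle (src F) (amap F) L;
          Fnab = pullback_conn (src F) (tgt F) (amap F) L nab
      in smooth_section (src F) FL (mcarrier (src F)) s \<and>
         (\<forall>p\<in>mcarrier (src F). herm FL (s p) (s p) = 1) \<and>
         (\<forall>p\<in>mcarrier (src F). \<forall>v\<in>tangent_space (src F) p.
            Fnab s p v = lscale FL (- 2 * pi * \<i> * of_real (snd \<Psi> p [v])) (s p)))"

section \<open>Lie group actions and relative homotopy moment maps\<close>

definition lie_group ::
  "('g::{t2_space, second_countable_topology}, 'h::real_normed_vector) atlas \<Rightarrow> 'g monoid \<Rightarrow> bool" where
  "lie_group A G \<longleftrightarrow> smooth_manifold A \<and> group G \<and> carrier G = mcarrier A \<and>
     smooth_map (prod_atlas A A) A (\<lambda>(g, h). g \<otimes>\<^bsub>G\<^esub> h) \<and>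
     smooth_map A A (\<lambda>g. inv\<^bsub>G\<^esub> g)"

definition lie_algebra :: "('g, 'h::real_normed_vector) atlas \<Rightarrow> 'g monoid \<Rightarrow> ('g, 'h) tvec set" where
  "lie_algebra A G = tangent_space A \<one>\<^bsub>G\<^esub>"

definition left_invariant_field ::
  "('g, 'h::real_normed_vector) atlas \<Rightarrow> 'g monoid \<Rightarrow> ('g, 'h) tvec \<Rightarrow> 'g \<Rightarrow> ('g, 'h) tvec" where
  "left_invariant_field A G x g = tmap A A (\<lambda>h. g \<otimes>\<^bsub>G\<^esub> h) \<one>\<^bsub>G\<^esub> x"

definition lie_algebra_bracket ::
  "('g, 'h::real_normed_vector) atlas \<Rightarrow> 'g monoid \<Rightarrow> ('g, 'h) tvec \<Rightarrow> ('g, 'h) tvec \<Rightarrow> ('g, 'h) tvec" where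
  "lie_algebra_bracket A G x y =
     lie_bracket A (left_invariant_field A G x) (left_invariant_field A G y) \<one>\<^bsub>G\<^esub>"

(* exp x = \<gamma>(1) for the one-parameter subgroup \<gamma> with \<gamma>'(0) = x. *)
definition lie_exp ::
  "('g::topological_space, 'h::real_normed_vector) atlas \<Rightarrow> 'g monoid \<Rightarrow> ('g, 'h) tvec \<Rightarrow> 'g" where
  "lie_exp A G x = (THE \<gamma>. smooth_map real_atlas A \<gamma> \<and>
     (\<forall>s t. \<gamma> (s + t) = \<gamma> s \<otimes>\<^bsub>G\<^esub> \<gamma> t) \<and> velocity A \<gamma> 0 = x) 1"

definition lie_action ::
  "('g::topological_space, 'h::real_normed_vector) atlas \<Rightarrow> 'g monoid \<Rightarrow>
   ('m::topological_space, 'a::real_normed_vector) atlas \<Rightarrow> ('g \<Rightarrow> 'm \<Rightarrow> 'm) \<Rightarrow> bool" where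
  "lie_action AG G A \<rho> \<longleftrightarrow> smooth_map (prod_atlas AG A) A (\<lambda>(g, p). \<rho> g p) \<and>
     (\<forall>p\<in>mcarrier A. \<rho> \<one>\<^bsub>G\<^esub> p = p) \<and>
     (\<forall>g\<in>carrier G. \<forall>h\<in>carrier G. \<forall>p\<in>mcarrier A. \<rho> (g \<otimes>\<^bsub>G\<^esub> h) p = \<rho> g (\<rho> h p))"

definition fundamental_field ::
  "('g::topological_space, 'h::real_normed_vector) atlas \<Rightarrow> 'g monoid \<Rightarrow>
   ('m::topological_space, 'a::real_normed_vector) atlas \<Rightarrow> ('g \<Rightarrow> 'm \<Rightarrow> 'm) \<Rightarrow> ('g, 'h) tvec \<Rightarrow> 'm \<Rightarrow> ('m, 'a) tvec" where
  "fundamental_field AG G A \<rho> x p = velocity A (\<lambda>t. \<rho> (lie_exp AG G (\<lambda>c. (- t) *\<^sub>R x c)) p) 0"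

definition arrow_action ::
  "('g::topological_space, 'h::real_normed_vector) atlas \<Rightarrow> 'g monoid \<Rightarrow>
   ('m::topological_space, 'a::real_normed_vector, 'n::topological_space, 'b::real_normed_vector) arrow \<Rightarrow>
   ('g \<Rightarrow> 'm \<Rightarrow> 'm) \<Rightarrow> ('g \<Rightarrow> 'n \<Rightarrow> 'n) \<Rightarrow> bool" where
  "arrow_action AG G F \<rho>M \<rho>N \<longleftrightarrow> lie_action AG G (src F) \<rho>M \<and> lie_action AG G (tgt F) \<rho>N \<and>
     (\<forall>g\<in>carrier G. \<forall>p\<in>mcarrier (src F). amap F (\<rho>M g p) = \<rho>N g (amap F p))"

definition rel_preserved ::
  "'g monoid \<Rightarrow> ('m, 'a::real_normed_vector, 'n, 'b::real_normed_vector) arrow \<Rightarrow>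
   ('g \<Rightarrow> 'm \<Rightarrow> 'm) \<Rightarrow> ('g \<Rightarrow> 'n \<Rightarrow> 'n) \<Rightarrow> ('m, 'a, 'n, 'b) rel_form \<Rightarrow> bool" where
  "rel_preserved G F \<rho>M \<rho>N \<Psi> \<longleftrightarrow> (\<forall>g\<in>carrier G. rel_pullback F F (\<rho>M g) (\<rho>N g) \<Psi> = \<Psi>)"

(* Contraction with the pair (vN, vM). *)
definition rel_contraction ::
  "('m, 'a::real_normed_vector, 'n, 'b::real_normed_vector) arrow \<Rightarrow>
   ('n \<Rightarrow> ('n, 'b) tvec) \<times> ('m \<Rightarrow> ('m, 'a) tvec) \<Rightarrow> ('m, 'a, 'n, 'b) rel_form \<Rightarrow> ('m, 'a, 'n, 'b) rel_form" where
  "rel_contraction F v \<Psi> = (contraction (tgt F) (fst v) (fst \<Psi>), - contraction (src F) (snd v) (snd \<Psi>))"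

definition fundamental_pair ::
  "('g::topological_space, 'h::real_normed_vector) atlas \<Rightarrow> 'g monoid \<Rightarrow>
   ('m::topological_space, 'a::real_normed_vector, 'n::topological_space, 'b::real_normed_vector) arrow \<Rightarrow>
   ('g \<Rightarrow> 'm \<Rightarrow> 'm) \<Rightarrow> ('g \<Rightarrow> 'n \<Rightarrow> 'n) \<Rightarrow> ('g, 'h) tvec \<Rightarrow>
   ('n \<Rightarrow> ('n, 'b) tvec) \<times> ('m \<Rightarrow> ('m, 'a) tvec)" where
  "fundamental_pair AG G F \<rho>M \<rho>N x =
     (fundamental_field AG G (tgt F) \<rho>N x, fundamental_field AG G (src F) \<rho>M x)"

definition varsigma :: "nat \<Rightarrow> real" where
  "varsigma k = - ((-1) ^ (k * (k + 1) div 2))"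

(* Linear maps on the k-th exterior power are alternating multilinear maps, evaluated on lists of
   length k.  Indices of lists start at 0, which does not affect the parity of i + j.  The fold is
   \<iota>(v_k) ... \<iota>(v_1). *)
definition rel_moment_map ::
  "('g::topological_space, 'h::real_normed_vector) atlas \<Rightarrow> 'g monoid \<Rightarrow>
   ('m::topological_space, 'a::real_normed_vector, 'n::topological_space, 'b::real_normed_vector) arrow \<Rightarrow>
   ('g \<Rightarrow> 'm \<Rightarrow> 'm) \<Rightarrow> ('g \<Rightarrow> 'n \<Rightarrow> 'n) \<Rightarrow> nat \<Rightarrow> ('m, 'a, 'n, 'b) rel_form \<Rightarrow>
   (nat \<Rightarrow> ('g, 'h) tvec list \<Rightarrow> ('m, 'a, 'n, 'b) rel_form) \<Rightarrow> bool" where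
  "rel_moment_map AG G F \<rho>M \<rho>N n \<Psi> f \<longleftrightarrow>
     \<Psi> \<in> rel_closed F (n + 1) \<and> rel_preserved G F \<rho>M \<rho>N \<Psi> \<and>
     (\<forall>k\<in>{1..n}.
        (\<forall>xs. length xs = k \<and> set xs \<subseteq> lie_algebra AG G \<longrightarrow> f k xs \<in> rel_forms F (n - k)) \<and>
        (\<forall>q vs. alt_multilinear (lie_algebra AG G) k (\<lambda>xs. fst (f k xs) q vs)) \<and>
        (\<forall>q vs. alt_multilinear (lie_algebra AG G) k (\<lambda>xs. snd (f k xs) q vs))) \<and>
     (let f0 = (\<lambda>k xs. if k \<in> {1..n} then f k xs else 0) in
      \<forall>k\<in>{1..n + 1}. \<forall>xs. length xs = k \<and> set xs \<subseteq> lie_algebra AG G \<longrightarrow>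
        (\<Sum>(i, j)\<in>{(i, j). i < j \<and> j < k}. rel_scale ((-1) ^ (i + j + 1))
           (f0 (k - 1) (lie_algebra_bracket AG G (xs ! i) (xs ! j) # remove_nth i (remove_nth j xs))))
        = rel_d F (f0 k xs) +
          rel_scale (varsigma k)
            (fold (\<lambda>x. rel_contraction F (fundamental_pair AG G F \<rho>M \<rho>N x)) xs \<Psi>))"

definition field_related ::
  "('m, 'a::real_normed_vector) atlas \<Rightarrow> ('n, 'b::real_normed_vector) atlas \<Rightarrow> ('m \<Rightarrow> 'n) \<Rightarrow>
   ('m \<Rightarrow> ('m, 'a) tvec) \<Rightarrow> ('n \<Rightarrow> ('n, 'b) tvec) \<Rightarrow> bool" where
  "field_related A B f X Y \<longleftrightarrow> (\<forall>p\<in>mcarrier A. tmap A B f p (X p) = Y (f p))"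

end

theory Submission
  imports Defs
begin

text \<open>
Each part of the theorem says that a construction is natural under one smooth map, here \<open>\<phi>\<close> or \<open>\<psi>\<close>.
The square \<open>F' \<circ> \<phi> = \<psi> \<circ> F\<close> is needed where a construction mixes the two components: it gives
\<open>\<phi>\<^sup>* F'\<^sup>* = F\<^sup>* \<psi>\<^sup>*\<close> on forms, its dual on chains, and \<open>dF' \<circ> d\<phi> = d\<psi> \<circ> dF\<close> on tangent vectors.

For forms, the main point is \<open>d f\<^sup>* = f\<^sup>* d\<close> (\<open>ext_d_pullback\<close>).  In coordinates the product rule for
\<open>\<omega> (F x) (DF u\<^sub>1, \<dots>, DF u\<^sub>k)\<close> produces the wanted terms and terms with \<open>D\<^sup>2F\<close>, and these cancel since
\<open>D\<^sup>2F\<close> is symmetric (\<open>second_derivative_symmetric\<close>) and \<open>\<omega>\<close> is alternating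
(\<open>alternating_symmetric_cancel\<close>).  The statement is local, for forms that are smooth near the image point
only, because it is applied to connection forms as well.  Varying directions are expanded in a basis throughout,
which reduces smoothness of composites to derivatives in fixed directions; the coordinates are continuous because
all norms on a finite-dimensional space are equivalent.

For chains, the integrand of a simplex pulls back pointwise: \<open>d\<psi>\<close> maps the velocity of a parameter curve of
\<open>\<sigma>\<close> to that of \<open>\<psi> \<circ> \<sigma>\<close> (\<open>smooth_simplex_velocity\<close>).  That these velocities exist follows from the
continuity of the partial derivatives of a smooth extension of \<open>\<sigma>\<close>.  The inclusion of periods is then formal,
since \<open>\<Phi>\<^sub>*\<close> is a chain map and maps cycles to cycles.

For line bundles, the pulled-back connection is \<open>dg + g f\<^sup>*\<alpha>\<close> on components \<open>g\<close> in every trivialisation, with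
\<open>\<alpha>\<close> the connection form downstairs (\<open>pullback_conn_in_triv\<close>).  From this formula follow the axioms of a
unitary connection, the equation for the section, and the curvature: the connection form of any local frame is
\<open>dg / g + f\<^sup>*\<alpha>\<close>, where \<open>dg / g\<close> is closed (\<open>pullback_curvature\<close>).

For moment maps, the equation for \<open>F\<close> is the pull-back of the equation for \<open>F'\<close>.  Contractions commute with
pull-back because the fundamental fields are related, provided that they are tangent at each point, and this
requires \<open>exp 0 = 1\<close> (\<open>lie_exp_zero\<close>): the constant curve is the only one-parameter subgroup with initial
velocity \<open>0\<close>.
\<close>

section \<open>Coordinates in finite-dimensional normed spaces\<close>

text \<open>The model spaces of manifolds are normed spaces with a finite spanning set, without a chosen
  basis or inner product. Boundedness of the coordinates is what lets them preserve
  differentiability.\<close>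

definition linear_coordinates :: "'a::real_normed_vector set \<Rightarrow> ('a \<Rightarrow> 'a \<Rightarrow> real) \<Rightarrow> bool" where
  "linear_coordinates B c \<longleftrightarrow>
     finite B \<and> (\<forall>b. bounded_linear (c b)) \<and> (\<forall>x. x = (\<Sum>b\<in>B. c b x *\<^sub>R b))"

text \<open>The equivalence of norms: on the compact unit sphere of the 1-norm of the coefficients, the
  norm of the linear combination is continuous and, by independence, positive.\<close>

lemma independent_coefficients_bounded:
  fixes B :: "'a::real_normed_vector set"
  assumes fin: "finite B" and ind: "independent B"
  shows "\<exists>m>0. \<forall>r. m * (\<Sum>b\<in>B. \<bar>r b\<bar>) \<le> norm (\<Sum>b\<in>B. r b *\<^sub>R b)"
proof (cases "B = {}")
  case True
  then show ?thesis by (auto intro: exI[of _ 1])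
next
  case False
  define Q where "Q = Pi\<^sub>E UNIV (\<lambda>b. if b \<in> B then {-1..1::real} else {0})"
  define K where "K = Q \<inter> {r. (\<Sum>b\<in>B. \<bar>r b\<bar>) \<in> {1}}"
  have "compactin (product_topology (\<lambda>i. euclidean) UNIV) Q"
    unfolding Q_def by (subst compactin_PiE) auto
  then have "compact Q"
    by (simp add: euclidean_product_topology)
  moreover have "closed {r :: 'a \<Rightarrow> real. (\<Sum>b\<in>B. \<bar>r b\<bar>) \<in> {1}}"
    unfolding vimage_def[symmetric]
    by (intro closed_vimage) (auto intro!: continuous_intros continuous_on_product_coordinates)
  ultimately have "compact K"
    unfolding K_def by (rule compact_Int_closed)
  obtain b0 where b0: "b0 \<in> B" using False by auto
  have "(\<lambda>b. if b = b0 then 1 else 0) \<in> K"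
    using b0 fin by (auto simp: K_def Q_def if_distrib cong: if_cong)
  then have "K \<noteq> {}" by auto
  have "continuous_on UNIV (\<lambda>r. norm (\<Sum>b\<in>B. r b *\<^sub>R b))"
    by (intro continuous_intros continuous_on_product_coordinates)
  then have "continuous_on K (\<lambda>r. norm (\<Sum>b\<in>B. r b *\<^sub>R b))"
    by (rule continuous_on_subset) simp
  from continuous_attains_inf[OF \<open>compact K\<close> \<open>K \<noteq> {}\<close> this] obtain r0 where
    r0: "r0 \<in> K" and min: "\<And>r. r \<in> K \<Longrightarrow> norm (\<Sum>b\<in>B. r0 b *\<^sub>R b) \<le> norm (\<Sum>b\<in>B. r b *\<^sub>R b)"
    by auto
  define m where "m = norm (\<Sum>b\<in>B. r0 b *\<^sub>R b)"
  have "m \<noteq> 0"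
  proof
    assume "m = 0"
    then have "(\<Sum>b\<in>B. r0 b *\<^sub>R b) = 0" by (simp add: m_def)
    then have "\<forall>b\<in>B. r0 b = 0"
      using ind fin by (auto simp: dependent_finite)
    with r0 show False by (simp add: K_def)
  qed
  then have "m > 0" by (simp add: m_def)
  moreover have "m * (\<Sum>b\<in>B. \<bar>r b\<bar>) \<le> norm (\<Sum>b\<in>B. r b *\<^sub>R b)" for r
  proof (cases "(\<Sum>b\<in>B. \<bar>r b\<bar>) = 0")
    case True
    then show ?thesis by simp
  next
    case False
    define S where "S = (\<Sum>b\<in>B. \<bar>r b\<bar>)"
    have S: "S > 0" using False by (simp add: S_def sum_nonneg less_le)
    define q where "q b = (if b \<in> B then r b / S else 0)" for b
    have "\<bar>r b\<bar> \<le> S" if "b \<in> B" for b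
      unfolding S_def using fin that by (intro member_le_sum) auto
    then have "\<bar>q b\<bar> \<le> 1" for b
      using S by (auto simp: q_def divide_le_eq)
    then have "-1 \<le> q b \<and> q b \<le> 1" for b
      by (metis abs_le_iff minus_le_iff)
    moreover have "q b = 0" if "b \<notin> B" for b
      using that by (simp add: q_def)
    ultimately have "q b \<in> (if b \<in> B then {-1..1} else {0})" for b
      by simp
    then have q1: "q \<in> Q"
      by (simp add: Q_def PiE_iff)
    have "(\<Sum>b\<in>B. \<bar>q b\<bar>) = (\<Sum>b\<in>B. \<bar>r b\<bar>) / S"
      using S by (simp add: q_def sum_divide_distrib)
    then have "q \<in> K"
      using q1 S False by (simp add: K_def S_def)
    then have "m \<le> norm (\<Sum>b\<in>B. q b *\<^sub>R b)"
      using min by (simp add: m_def)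
    also have "(\<Sum>b\<in>B. q b *\<^sub>R b) = (1 / S) *\<^sub>R (\<Sum>b\<in>B. r b *\<^sub>R b)"
      by (simp add: q_def scaleR_sum_right)
    finally show ?thesis
      using S by (simp add: S_def[symmetric] le_divide_eq)
  qed
  ultimately show ?thesis by blast
qed

lemma linear_coordinates_exist:
  assumes "\<exists>B::'a::real_normed_vector set. finite B \<and> span B = UNIV"
  obtains B :: "'a::real_normed_vector set" and c where "linear_coordinates B c"
proof -
  obtain B0 :: "'a set" where B0: "finite B0" "span B0 = UNIV" using assms by auto
  obtain B where B: "B \<subseteq> B0" "independent B" "B0 \<subseteq> span B"
    by (rule maximal_independent_subset)
  have fin: "finite B" using B B0 by (auto intro: finite_subset)
  have sp: "span B = UNIV"
    using B B0 by (metis span_mono span_span top.extremum_unique)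
  obtain m where m: "m > 0" "\<And>r. m * (\<Sum>b\<in>B. \<bar>r b\<bar>) \<le> norm (\<Sum>b\<in>B. r b *\<^sub>R b)"
    using independent_coefficients_bounded[OF fin B(2)] by blast
  define c where "c b x = (if b \<in> B then representation B x b else 0)" for b x
  have expand: "(\<Sum>b\<in>B. c b x *\<^sub>R b) = x" for x
    using sum_representation_eq[OF B(2), of x B] fin sp by (simp add: c_def)
  have "bounded_linear (c b)" for b
  proof (rule bounded_linear_intro[where K = "1 / m"])
    show "c b (x + y) = c b x + c b y" for x y
      using B(2) sp by (simp add: c_def representation_add)
    show "c b (r *\<^sub>R x) = r *\<^sub>R c b x" for r x
      using B(2) sp by (simp add: c_def representation_scale)
    show "norm (c b x) \<le> norm x * (1 / m)" for x
    proof -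
      have "norm (c b x) \<le> (\<Sum>b\<in>B. \<bar>c b x\<bar>)"
      proof (cases "b \<in> B")
        case True
        have "\<bar>c b x\<bar> \<le> (\<Sum>b\<in>B. \<bar>c b x\<bar>)"
          by (rule member_le_sum[OF True _ fin]) simp
        then show ?thesis by simp
      qed (simp add: c_def sum_nonneg)
      also have "\<dots> \<le> norm x * (1 / m)"
        using m(2)[of "\<lambda>b. c b x"] m(1) by (simp add: expand field_simps)
      finally show ?thesis .
    qed
  qed
  then have "linear_coordinates B c"
    using fin expand by (simp add: linear_coordinates_def)
  then show ?thesis by (rule that)
qed

section \<open>Functions of class C-k\<close>

lemma has_derivative_frechet:
  "f differentiable (at x) \<Longrightarrow> (f has_derivative frechet_derivative f (at x)) (at x)"
  by (simp add: frechet_derivative_works)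

lemma Ck_on_subset: "Ck_on n S f \<Longrightarrow> T \<subseteq> S \<Longrightarrow> Ck_on n T f"
  by (induction n arbitrary: f) (auto intro: continuous_on_subset)

lemma Ck_on_cong:
  assumes "open S" "\<And>x. x \<in> S \<Longrightarrow> f x = g x" "Ck_on n S f"
  shows "Ck_on n S g"
  using assms(2,3)
proof (induction n arbitrary: f g)
  case 0
  then show ?case by (simp cong: continuous_on_cong)
next
  case (Suc n)
  have d: "(g has_derivative frechet_derivative f (at x)) (at x)" if "x \<in> S" for x
    using Suc.prems that
    by (intro has_derivative_transform_within_open[OF has_derivative_frechet \<open>open S\<close> that]) auto
  have "frechet_derivative f (at x) u = frechet_derivative g (at x) u" if "x \<in> S" for x u
    using frechet_derivative_at[OF d[OF that]] by simp
  then have "Ck_on n S (\<lambda>x. frechet_derivative g (at x) u)" for u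
    using Suc.prems Suc.IH[of "\<lambda>x. frechet_derivative f (at x) u" "\<lambda>x. frechet_derivative g (at x) u"]
    by simp
  with d show ?case by (auto simp: differentiable_def)
qed

lemma Ck_on_SucI:
  assumes "open S" "\<And>x. x \<in> S \<Longrightarrow> (f has_derivative f' x) (at x)" "\<And>u. Ck_on n S (\<lambda>x. f' x u)"
  shows "Ck_on (Suc n) S f"
proof -
  have "f' x u = frechet_derivative f (at x) u" if "x \<in> S" for x u
    using frechet_derivative_at[OF assms(2)[OF that]] by simp
  then have "Ck_on n S (\<lambda>x. frechet_derivative f (at x) u)" for u
    using Ck_on_cong[OF assms(1) _ assms(3)[of u], of "\<lambda>x. frechet_derivative f (at x) u"] by simp
  then show ?thesis using assms(2) by (auto simp: differentiable_def)
qed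

lemma Ck_on_SucD:
  assumes "Ck_on (Suc n) S f"
  shows "x \<in> S \<Longrightarrow> (f has_derivative frechet_derivative f (at x)) (at x)"
    and "Ck_on n S (\<lambda>x. frechet_derivative f (at x) u)"
  using assms by (auto intro: has_derivative_frechet)

lemma Ck_on_Suc_imp: "Ck_on (Suc n) S f \<Longrightarrow> Ck_on n S f"
proof (induction n arbitrary: f)
  case 0
  then show ?case
    by (auto intro!: continuous_at_imp_continuous_on differentiable_imp_continuous_within)
next
  case (Suc n)
  then show ?case by (metis Ck_on.simps(2))
qed

lemma Ck_on_local:
  assumes "\<And>x. x \<in> S \<Longrightarrow> \<exists>T. open T \<and> x \<in> T \<and> Ck_on n T f"
  shows "Ck_on n S f"
  using assms
proof (induction n arbitrary: f)
  case 0
  have "isCont f x" if "x \<in> S" for x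
    using 0[OF that] by (auto simp: continuous_on_eq_continuous_at)
  then show ?case
    by (auto intro: continuous_at_imp_continuous_on)
next
  case (Suc n)
  then show ?case by (auto; metis)
qed

lemma Ck_on_const [simp]: "Ck_on n S (\<lambda>x. k)"
  by (induction n arbitrary: k) auto

lemma Ck_on_bounded_linear:
  assumes "bounded_linear L" "open S" "Ck_on n S f"
  shows "Ck_on n S (\<lambda>x. L (f x))"
  using assms(3)
proof (induction n arbitrary: f)
  case 0
  then show ?case
    using assms(1) by (simp add: bounded_linear.continuous_on)
next
  case (Suc n)
  show ?case
    by (rule Ck_on_SucI[OF \<open>open S\<close> bounded_linear.has_derivative[OF assms(1) Ck_on_SucD(1)[OF
        Suc.prems]]
          Suc.IH[OF Ck_on_SucD(2)[OF Suc.prems]]])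
qed

lemma Ck_on_add:
  assumes "open S" "Ck_on n S f" "Ck_on n S g"
  shows "Ck_on n S (\<lambda>x. f x + g x)"
  using assms(2,3)
proof (induction n arbitrary: f g)
  case 0
  then show ?case by (simp add: continuous_on_add)
next
  case (Suc n)
  show ?case
    by (rule Ck_on_SucI[OF \<open>open S\<close> has_derivative_add[OF Ck_on_SucD(1)[OF Suc.prems(1)]
            Ck_on_SucD(1)[OF Suc.prems(2)]] Suc.IH[OF Ck_on_SucD(2)[OF Suc.prems(1)]
            Ck_on_SucD(2)[OF Suc.prems(2)]]])
qed

lemma Ck_on_sum:
  assumes "open S" "\<And>i. i \<in> I \<Longrightarrow> Ck_on n S (f i)"
  shows "Ck_on n S (\<lambda>x. \<Sum>i\<in>I. f i x)"
  using assms(2) by (induction I rule: infinite_finite_induct) (auto intro: Ck_on_add[OF \<open>open S\<close>])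

lemma Ck_on_bilinear:
  assumes bil: "bounded_bilinear mul" and "open S" "Ck_on n S f" "Ck_on n S g"
  shows "Ck_on n S (\<lambda>x. mul (f x) (g x))"
  using assms(3,4)
proof (induction n arbitrary: f g)
  case 0
  then show ?case by (simp add: bounded_bilinear.continuous_on[OF bil])
next
  case (Suc n)
  have "Ck_on n S (\<lambda>x. mul (f x) (frechet_derivative g (at x) u)
      + mul (frechet_derivative f (at x) u) (g x))" for u
    by (rule Ck_on_add[OF \<open>open S\<close> Suc.IH[OF Ck_on_Suc_imp[OF Suc.prems(1)]
        Ck_on_SucD(2)[OF Suc.prems(2)]]
          Suc.IH[OF Ck_on_SucD(2)[OF Suc.prems(1)] Ck_on_Suc_imp[OF Suc.prems(2)]]])
  moreover have "((\<lambda>x. mul (f x) (g x)) has_derivative (\<lambda>u. mul (f x) (frechet_derivative g (at x) u)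
      + mul (frechet_derivative f (at x) u) (g x))) (at x)" if "x \<in> S" for x
    by (rule bounded_bilinear.FDERIV[OF bil Ck_on_SucD(1)[OF Suc.prems(1) that]
            Ck_on_SucD(1)[OF Suc.prems(2) that]])
  ultimately show ?case by (intro Ck_on_SucI[OF \<open>open S\<close>])
qed

lemmas Ck_on_scaleR = Ck_on_bilinear[OF bounded_bilinear_scaleR]
lemmas Ck_on_mult = Ck_on_bilinear[OF bounded_bilinear_mult]

lemma Ck_on_prod:
  fixes f :: "'i \<Rightarrow> 'a::real_normed_vector \<Rightarrow> real"
  assumes "open S" "\<And>i. i \<in> I \<Longrightarrow> Ck_on n S (f i)"
  shows "Ck_on n S (\<lambda>x. \<Prod>i\<in>I. f i x)"
  using assms(2) by (induction I rule: infinite_finite_induct) (auto intro: Ck_on_mult[OF \<open>open S\<close>])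

lemma linear_coordinates_expand:
  assumes "linear_coordinates B c" "linear L"
  shows "L x = (\<Sum>b\<in>B. c b x *\<^sub>R L b)"
proof -
  interpret linear L by fact
  have "L x = L (\<Sum>b\<in>B. c b x *\<^sub>R b)"
    using assms(1) by (metis linear_coordinates_def)
  then show ?thesis by (simp add: sum scaleR)
qed

text \<open>The chain rule only gives the derivative in direction \<open>u\<close> as \<open>Dg\<close> at \<open>f x\<close> in the varying
  direction \<open>Df u\<close>; expanding that direction in a basis reduces it to the directional derivatives
  of \<open>g\<close> in fixed directions, to which the induction hypothesis applies.\<close>

lemma Ck_on_compose:
  fixes f :: "'a::real_normed_vector \<Rightarrow> 'b::real_normed_vector" and B :: "'b set"
  assumes "linear_coordinates B c" "open S" "f ` S \<subseteq> T" "Ck_on n S f" "Ck_on n T g"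
  shows "Ck_on n S (\<lambda>x. g (f x))"
  using assms(4,5)
proof (induction n arbitrary: g)
  case 0
  then show ?case using assms(3) by (auto intro: continuous_on_compose2)
next
  case (Suc n)
  have fx: "f x \<in> T" if "x \<in> S" for x using that assms(3) by auto
  have d: "((\<lambda>x. g (f x)) has_derivative
      (\<lambda>u. frechet_derivative g (at (f x)) (frechet_derivative f (at x) u))) (at x)" if "x \<in> S" for x
    by (rule has_derivative_compose[OF Ck_on_SucD(1)[OF Suc.prems(1) that]
        Ck_on_SucD(1)[OF Suc.prems(2) fx[OF that]]])
  have eq: "frechet_derivative g (at (f x)) v = (\<Sum>b\<in>B. c b v *\<^sub>R frechet_derivative g (at (f x)) b)"
    if "x \<in> S" for x v
    by (rule linear_coordinates_expand[OF assms(1) has_derivative_linear[OF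
            Ck_on_SucD(1)[OF Suc.prems(2) fx[OF that]]]])
  have "Ck_on n S (\<lambda>x. \<Sum>b\<in>B. c b (frechet_derivative f (at x) u) *\<^sub>R frechet_derivative g (at (f x)) b)"
    for u
  proof (rule Ck_on_sum[OF \<open>open S\<close>], rule Ck_on_scaleR[OF \<open>open S\<close>])
    show "Ck_on n S (\<lambda>x. c b (frechet_derivative f (at x) u))" for b
      using assms(1)
      by (intro Ck_on_bounded_linear[OF _ \<open>open S\<close> Ck_on_SucD(2)[OF Suc.prems(1)], of "c b"])
         (simp add: linear_coordinates_def)
    show "Ck_on n S (\<lambda>x. frechet_derivative g (at (f x)) b)" for b
      by (rule Suc.IH[OF Ck_on_Suc_imp[OF Suc.prems(1)] Ck_on_SucD(2)[OF Suc.prems(2)]])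
  qed
  then have "Ck_on n S (\<lambda>x. frechet_derivative g (at (f x)) (frechet_derivative f (at x) u))" for u
    by (rule Ck_on_cong[OF \<open>open S\<close>, rotated]) (simp add: eq[symmetric])
  with d show ?case by (intro Ck_on_SucI[OF \<open>open S\<close>])
qed

lemma smooth_on_subset: "smooth_on S f \<Longrightarrow> T \<subseteq> S \<Longrightarrow> smooth_on T f"
  by (auto simp: smooth_on_def intro: Ck_on_subset)

lemma smooth_on_cong:
  "smooth_on S f \<Longrightarrow> open S \<Longrightarrow> (\<And>x. x \<in> S \<Longrightarrow> f x = g x) \<Longrightarrow> smooth_on S g"
  by (auto simp: smooth_on_def intro: Ck_on_cong)

lemma smooth_on_local:
  "(\<And>x. x \<in> S \<Longrightarrow> \<exists>T. open T \<and> x \<in> T \<and> smooth_on T f) \<Longrightarrow> smooth_on S f"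
  unfolding smooth_on_def by (meson Ck_on_local)

lemma smooth_on_const [simp]: "smooth_on S (\<lambda>x. k)"
  by (simp add: smooth_on_def)

lemma smooth_on_bounded_linear:
  "bounded_linear L \<Longrightarrow> open S \<Longrightarrow> smooth_on S f \<Longrightarrow> smooth_on S (\<lambda>x. L (f x))"
  by (auto simp: smooth_on_def intro: Ck_on_bounded_linear)

lemma smooth_on_add:
  "open S \<Longrightarrow> smooth_on S f \<Longrightarrow> smooth_on S g \<Longrightarrow> smooth_on S (\<lambda>x. f x + g x)"
  by (auto simp: smooth_on_def intro: Ck_on_add)

lemma smooth_on_sum:
  "open S \<Longrightarrow> (\<And>i. i \<in> I \<Longrightarrow> smooth_on S (f i)) \<Longrightarrow> smooth_on S (\<lambda>x. \<Sum>i\<in>I. f i x)"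
  by (auto simp: smooth_on_def intro: Ck_on_sum)

lemma smooth_on_bilinear:
  "bounded_bilinear mul \<Longrightarrow> open S \<Longrightarrow> smooth_on S f \<Longrightarrow> smooth_on S g \<Longrightarrow>
    smooth_on S (\<lambda>x. mul (f x) (g x))"
  by (auto simp: smooth_on_def intro: Ck_on_bilinear)

lemmas smooth_on_scaleR = smooth_on_bilinear[OF bounded_bilinear_scaleR]
lemmas smooth_on_mult = smooth_on_bilinear[OF bounded_bilinear_mult]

lemma smooth_on_prod:
  fixes f :: "'i \<Rightarrow> 'a::real_normed_vector \<Rightarrow> real"
  shows "open S \<Longrightarrow> (\<And>i. i \<in> I \<Longrightarrow> smooth_on S (f i)) \<Longrightarrow> smooth_on S (\<lambda>x. \<Prod>i\<in>I. f i x)"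
  by (auto simp: smooth_on_def intro: Ck_on_prod)

lemma smooth_on_compose:
  fixes f :: "'a::real_normed_vector \<Rightarrow> 'b::real_normed_vector" and B :: "'b set"
  assumes "linear_coordinates B c" "open S" "f ` S \<subseteq> T" "smooth_on S f" "smooth_on T g"
  shows "smooth_on S (\<lambda>x. g (f x))"
  unfolding smooth_on_def
proof
  show "Ck_on n S (\<lambda>x. g (f x))" for n
    by (rule Ck_on_compose[OF assms(1-3)]) (use assms(4,5) in \<open>auto simp: smooth_on_def\<close>)
qed

lemma smooth_on_derivative:
  "smooth_on S f \<Longrightarrow> smooth_on S (\<lambda>x. frechet_derivative f (at x) u)"
  unfolding smooth_on_def by (metis Ck_on.simps(2))

lemma smooth_on_imp_differentiable:
  assumes "smooth_on S f" "x \<in> S"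
  shows "f differentiable (at x)"
proof -
  have "Ck_on (Suc 0) S f" using assms(1) unfolding smooth_on_def by blast
  then show ?thesis using assms(2) by simp
qed

lemma smooth_on_has_derivative:
  "smooth_on S f \<Longrightarrow> x \<in> S \<Longrightarrow> (f has_derivative frechet_derivative f (at x)) (at x)"
  by (intro has_derivative_frechet smooth_on_imp_differentiable)

text \<open>The partial derivative in direction \<open>u\<close> is the derivative in the direction \<open>(0, u)\<close>, which
  does not vary with the point, so that the induction passes from \<open>f\<close> to its directional
  derivatives.\<close>

lemma Ck_on_slice:
  assumes "open T" "Pair a ` T \<subseteq> S" "Ck_on n S f"
  shows "Ck_on n T (\<lambda>x. f (a, x))"
  using assms(3)
proof (induction n arbitrary: f)
  case 0
  then show ?case
    using assms(2) by (auto intro!: continuous_on_compose2[of S f] continuous_intros)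
next
  case (Suc n)
  have "((\<lambda>x. f (a, x)) has_derivative (\<lambda>u. frechet_derivative f (at (a, x)) (0, u))) (at x)"
    if "x \<in> T" for x
    by (rule has_derivative_compose[OF _ Ck_on_SucD(1)[OF Suc.prems]])
       (use that assms(2) in \<open>auto intro!: derivative_eq_intros\<close>)
  then show ?case
    by (rule Ck_on_SucI[OF \<open>open T\<close> _ Suc.IH[OF Ck_on_SucD(2)[OF Suc.prems]]])
qed

lemma smooth_on_slice:
  "open T \<Longrightarrow> Pair a ` T \<subseteq> S \<Longrightarrow> smooth_on S f \<Longrightarrow> smooth_on T (\<lambda>x. f (a, x))"
  unfolding smooth_on_def by (blast intro: Ck_on_slice)

section \<open>Symmetry of second derivatives\<close>

text \<open>The second difference of \<open>f\<close> over the parallelogram spanned by \<open>s u\<close> and \<open>s v\<close>, divided by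
  \<open>s\<^sup>2\<close>, tends to the derivative in direction \<open>v\<close> of the derivative in direction \<open>u\<close>: apply the
  mean value inequality to the first difference in direction \<open>v\<close>, along the side \<open>s u\<close>. The second
  difference is symmetric in \<open>u\<close> and \<open>v\<close>.\<close>

lemma second_difference_estimate:
  fixes f :: "'a::real_normed_vector \<Rightarrow> 'b::real_normed_vector"
  assumes "open S" "x \<in> S" and f: "\<And>y. y \<in> S \<Longrightarrow> f differentiable (at y)"
    and w: "(\<lambda>y. frechet_derivative f (at y) u) differentiable (at x)" and "0 < e"
  shows "\<exists>d>0. \<forall>s. 0 < s \<and> s < d \<longrightarrow>
    norm (f (x + s *\<^sub>R u + s *\<^sub>R v) - f (x + s *\<^sub>R u) - f (x + s *\<^sub>R v) + f x
      - (s * s) *\<^sub>R frechet_derivative (\<lambda>y. frechet_derivative f (at y) u) (at x) v) \<le> e * (s * s)"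
proof -
  define w where "w y = frechet_derivative f (at y) u" for y
  define w' where "w' = frechet_derivative w (at x)"
  have "(w has_derivative w') (at x)"
    unfolding w'_def using assms(4) by (intro has_derivative_frechet) (simp add: w_def[abs_def])
  then have lin: "bounded_linear w'"
    and bd: "\<And>e. 0 < e \<Longrightarrow> \<exists>d>0. \<forall>y. norm (y - x) < d \<longrightarrow> norm (w y - w x - w' (y - x)) \<le> e * norm (y - x)"
    by (auto simp: has_derivative_at_alt)
  interpret w': bounded_linear w' by (fact lin)
  define n where "n = norm u + norm v"
  have n: "0 \<le> n" "norm u \<le> n" "norm v \<le> n" by (auto simp: n_def)
  define e' where "e' = e / (2 * n + 1)"
  have e': "0 < e'" "2 * n * e' \<le> e"
    using \<open>0 < e\<close> n by (auto simp: e'_def field_simps)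
  obtain d1 where d1: "0 < d1" "\<And>y. norm (y - x) < d1 \<Longrightarrow> norm (w y - w x - w' (y - x)) \<le> e' * norm (y
      - x)"
    using bd[OF e'(1)] by blast
  obtain d2 where d2: "0 < d2" "ball x d2 \<subseteq> S"
    using assms(1,2) open_contains_ball by blast
  define d where "d = min d1 d2 / (n + 1)"
  have "0 < d" using d1 d2 n by (simp add: d_def)
  moreover have "norm (f (x + s *\<^sub>R u + s *\<^sub>R v) - f (x + s *\<^sub>R u) - f (x + s *\<^sub>R v) + f x
      - (s * s) *\<^sub>R w' v) \<le> e * (s * s)" if s: "0 < s" "s < d" for s
  proof -
    have sn: "s * n < min d1 d2"
    proof -
      have "s * (n + 1) < min d1 d2"
        using s n by (simp add: d_def less_divide_eq add_nonneg_pos)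
      then show ?thesis using s by (simp add: algebra_simps)
    qed
    have near: "norm (r *\<^sub>R u + q *\<^sub>R v) \<le> s * n" if "r \<in> {0..s}" "q \<in> {0..s}" for r q
    proof -
      have "norm (r *\<^sub>R u + q *\<^sub>R v) \<le> r * norm u + q * norm v"
        using that norm_triangle_ineq[of "r *\<^sub>R u" "q *\<^sub>R v"] by simp
      also have "\<dots> \<le> s * norm u + s * norm v"
        using that by (intro add_mono mult_right_mono) auto
      finally show ?thesis by (simp add: n_def algebra_simps)
    qed
    have inS: "x + r *\<^sub>R u + q *\<^sub>R v \<in> S" if "r \<in> {0..s}" "q \<in> {0..s}" for r q
    proof -
      have "dist x (x + r *\<^sub>R u + q *\<^sub>R v) < d2"
        using near[OF that] sn unfolding dist_commute[of x] by (simp add: dist_norm add.assoc)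
      then show ?thesis using d2 by auto
    qed
    have wbd: "norm (w (x + r *\<^sub>R u + q *\<^sub>R v) - w x - w' (r *\<^sub>R u + q *\<^sub>R v)) \<le> e' * (s * n)"
      if "r \<in> {0..s}" "q \<in> {0..s}" for r q
    proof -
      have "norm (x + r *\<^sub>R u + q *\<^sub>R v - x) < d1"
        using near[OF that] sn by (simp add: add.assoc)
      from d1(2)[OF this] have "norm (w (x + r *\<^sub>R u + q *\<^sub>R v) - w x - w' (r *\<^sub>R u + q *\<^sub>R v))
          \<le> e' * norm (r *\<^sub>R u + q *\<^sub>R v)"
        by (simp add: add.assoc)
      also have "\<dots> \<le> e' * (s * n)"
        using near[OF that] e'(1) by (intro mult_left_mono) auto
      finally show ?thesis .
    qed
    define k where "k r = f (x + r *\<^sub>R u + s *\<^sub>R v) - f (x + r *\<^sub>R u) - r *\<^sub>R (s *\<^sub>R w' v)" for r :: real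
    define D where "D r = w (x + r *\<^sub>R u + s *\<^sub>R v) - w (x + r *\<^sub>R u) - s *\<^sub>R w' v" for r :: real
    have der: "((\<lambda>r. f (x + r *\<^sub>R u + q *\<^sub>R v)) has_derivative (\<lambda>h. h *\<^sub>R w (x + r *\<^sub>R u + q *\<^sub>R v)))
        (at r within {0..s})" if "r \<in> {0..s}" "q \<in> {0..s}" for r q
    proof -
      have Df: "(f has_derivative frechet_derivative f (at (x + r *\<^sub>R u + q *\<^sub>R v))) (at (x +
          r *\<^sub>R u + q *\<^sub>R v))"
        by (intro has_derivative_frechet f inS that)
      interpret Df: bounded_linear "frechet_derivative f (at (x + r *\<^sub>R u + q *\<^sub>R v))"
        using Df by (rule has_derivative_bounded_linear)
      have "((\<lambda>r. x + r *\<^sub>R u + q *\<^sub>R v) has_derivative (\<lambda>h. h *\<^sub>R u)) (at r within {0..s})"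
        by (auto intro!: derivative_eq_intros)
      from has_derivative_compose[OF this Df] show ?thesis
        by (simp add: w_def Df.scaleR)
    qed
    have "(k has_derivative (\<lambda>h. h *\<^sub>R D r)) (at r within {0..s})" if "r \<in> {0..s}" for r
    proof -
      have "((\<lambda>r. f (x + r *\<^sub>R u + s *\<^sub>R v) - f (x + r *\<^sub>R u +
          0 *\<^sub>R v) - r *\<^sub>R (s *\<^sub>R w' v)) has_derivative
          (\<lambda>h. h *\<^sub>R w (x + r *\<^sub>R u + s *\<^sub>R v) - h *\<^sub>R w (x + r *\<^sub>R u + 0 *\<^sub>R v) - h *\<^sub>R (s *\<^sub>R w' v)))
          (at r within {0..s})"
        using that s by (intro has_derivative_diff der has_derivative_scaleR_left
            has_derivative_ident) auto
      then show ?thesis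
        by (simp add: k_def[abs_def] D_def scaleR_diff_right)
    qed
    moreover have "onorm (\<lambda>h. h *\<^sub>R D r) \<le> e * s" if "r \<in> {0..s}" for r
    proof (rule onorm_le)
      fix h :: real
      have "D r = (w (x + r *\<^sub>R u + s *\<^sub>R v) - w x - w' (r *\<^sub>R u + s *\<^sub>R v))
          - (w (x + r *\<^sub>R u + 0 *\<^sub>R v) - w x - w' (r *\<^sub>R u + 0 *\<^sub>R v))"
        by (simp add: D_def w'.add w'.scaleR)
      also have "norm \<dots> \<le> e' * (s * n) + e' * (s * n)"
        by (intro order_trans[OF norm_triangle_ineq4] add_mono wbd) (use that s in auto)
      also have "\<dots> = (2 * n * e') * s" by simp
      also have "\<dots> \<le> e * s"
        using e' s by (intro mult_right_mono) auto
      finally have "norm (D r) \<le> e * s" .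
      then show "norm (h *\<^sub>R D r) \<le> e * s * norm h"
        by (simp add: mult.commute[of "\<bar>h\<bar>"] mult_right_mono)
    qed
    ultimately have "norm (k s - k 0) \<le> e * s * norm (s - 0)"
      by (intro differentiable_bound[of "{0..s}" k "\<lambda>r h. h *\<^sub>R D r"]) (use s in auto)
    moreover have "k s - k 0 = f (x + s *\<^sub>R u + s *\<^sub>R v) - f (x + s *\<^sub>R u) - f (x + s *\<^sub>R v) +
        f x - (s * s) *\<^sub>R w' v"
      by (simp add: k_def)
    ultimately show ?thesis using s by (simp add: mult.assoc)
  qed
  ultimately show ?thesis unfolding w'_def w_def[abs_def] by blast
qed

lemma second_derivative_symmetric:
  fixes f :: "'a::real_normed_vector \<Rightarrow> 'b::real_normed_vector"
  assumes "open S" "x \<in> S" "\<And>y. y \<in> S \<Longrightarrow> f differentiable (at y)"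
    and "(\<lambda>y. frechet_derivative f (at y) u) differentiable (at x)"
    and "(\<lambda>y. frechet_derivative f (at y) v) differentiable (at x)"
  shows "frechet_derivative (\<lambda>y. frechet_derivative f (at y) u) (at x) v =
         frechet_derivative (\<lambda>y. frechet_derivative f (at y) v) (at x) u" (is "?A = ?B")
proof (rule ccontr)
  assume "?A \<noteq> ?B"
  define e where "e = norm (?A - ?B) / 3"
  have "e > 0" using \<open>?A \<noteq> ?B\<close> by (simp add: e_def)
  define \<Delta> where "\<Delta> s = f (x + s *\<^sub>R u + s *\<^sub>R v) - f (x + s *\<^sub>R u) - f (x + s *\<^sub>R v) + f x"
      for s :: real
  obtain d1 where d1: "0 < d1" "\<And>s. 0 < s \<Longrightarrow> s < d1 \<Longrightarrow> norm (\<Delta> s - (s * s) *\<^sub>R ?A) \<le> e * (s * s)"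
    using second_difference_estimate[OF assms(1-4) \<open>e > 0\<close>, of v] unfolding \<Delta>_def by blast
  obtain d2 where d2: "0 < d2" "\<And>s. 0 < s \<Longrightarrow> s < d2 \<Longrightarrow>
      norm (f (x + s *\<^sub>R v + s *\<^sub>R u) - f (x + s *\<^sub>R v) - f (x + s *\<^sub>R u) +
          f x - (s * s) *\<^sub>R ?B) \<le> e * (s * s)"
    using second_difference_estimate[OF assms(1-3,5) \<open>e > 0\<close>, of u] by blast
  define s where "s = min d1 d2 / 2"
  have s: "0 < s" "s < d1" "s < d2" using d1(1) d2(1) by (auto simp: s_def)
  have "norm (\<Delta> s - (s * s) *\<^sub>R ?B) \<le> e * (s * s)"
    using d2(2)[OF s(1,3)] by (simp add: \<Delta>_def algebra_simps)
  moreover have "norm ((s * s) *\<^sub>R (?A - ?B)) \<le> norm (\<Delta> s - (s * s) *\<^sub>R ?A) +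
      norm (\<Delta> s - (s * s) *\<^sub>R ?B)"
    using norm_triangle_ineq4[of "\<Delta> s - (s * s) *\<^sub>R ?B" "\<Delta> s - (s * s) *\<^sub>R ?A"]
    by (simp add: scaleR_diff_right add.commute)
  ultimately have "(s * s) * norm (?A - ?B) \<le> 2 * (e * (s * s))"
    using d1(2)[OF s(1,2)] by simp
  then have "norm (?A - ?B) \<le> 2 * e"
    using s by (simp add: mult.commute)
  then show False using \<open>e > 0\<close> by (simp add: e_def)
qed

section \<open>Multilinear functions of lists and the naturality of the exterior derivative in coordinates\<close>

text \<open>What \<open>alt_multilinear\<close> becomes in a chart, where all tangent spaces are identified with the
  model space.\<close>

definition list_multilinear :: "nat \<Rightarrow> ('a::real_vector list \<Rightarrow> 'v::real_vector) \<Rightarrow> bool" where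
  "list_multilinear k g \<longleftrightarrow> (\<forall>vs i u w r s. length vs = k \<longrightarrow> i < k \<longrightarrow>
     g (vs[i := r *\<^sub>R u + s *\<^sub>R w]) = r *\<^sub>R g (vs[i := u]) + s *\<^sub>R g (vs[i := w]))"

definition list_alternating :: "nat \<Rightarrow> ('a list \<Rightarrow> 'v::zero) \<Rightarrow> bool" where
  "list_alternating k g \<longleftrightarrow> (\<forall>vs. length vs = k \<longrightarrow> \<not> distinct vs \<longrightarrow> g vs = 0)"

lemma list_multilinear_linear:
  assumes "list_multilinear k g" "length vs = k" "i < k"
  shows "linear (\<lambda>u. g (vs[i := u]))"
proof (rule linearI)
  show "g (vs[i := u + w]) = g (vs[i := u]) + g (vs[i := w])" for u w
    using assms(1)[unfolded list_multilinear_def, rule_format, OF assms(2,3), of 1 u 1 w] by simp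
  show "g (vs[i := r *\<^sub>R u]) = r *\<^sub>R g (vs[i := u])" for r u
    using assms(1)[unfolded list_multilinear_def, rule_format, OF assms(2,3), of r u 0 0] by simp
qed

lemma list_multilinear_linear_append:
  assumes "list_multilinear k g" "length xs + Suc (length ys) = k"
  shows "linear (\<lambda>u. g (xs @ u # ys))"
  using list_multilinear_linear[OF assms(1), of "xs @ undefined # ys" "length xs"] assms(2) by simp

text \<open>The entries of \<open>xs\<close> stand for basis vectors that have already replaced the original
  arguments.\<close>

lemma list_multilinear_expand_suffix:
  assumes "list_multilinear k g" and B: "linear_coordinates B c" and "length xs + length ws = k"
  shows "g (xs @ ws) = (\<Sum>bs | set bs \<subseteq> B \<and> length bs = length ws.
    (\<Prod>j<length ws. c (bs ! j) (ws ! j)) *\<^sub>R g (xs @ bs))"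
  using assms(3)
proof (induction ws arbitrary: xs)
  case Nil
  have "{bs. set bs \<subseteq> B \<and> length bs = 0} = {[]}" by auto
  then show ?case by simp
next
  case (Cons a ws)
  let ?L = "{bs. set bs \<subseteq> B \<and> length bs = length ws}"
  have "g (xs @ a # ws) = (\<Sum>b\<in>B. c b a *\<^sub>R g (xs @ b # ws))"
    using Cons.prems by (intro linear_coordinates_expand[OF B]
        list_multilinear_linear_append[OF assms(1)]) simp
  also have "\<dots> = (\<Sum>b\<in>B. \<Sum>bs\<in>?L. (c b a * (\<Prod>j<length ws. c (bs ! j) (ws ! j))) *\<^sub>R g (xs @ b # bs))"
  proof (rule sum.cong[OF refl])
    fix b assume "b \<in> B"
    have "g ((xs @ [b]) @ ws) = (\<Sum>bs\<in>?L. (\<Prod>j<length ws. c (bs ! j) (ws ! j)) *\<^sub>R g ((xs @ [b]) @ bs))"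
      using Cons.prems by (intro Cons.IH) simp
    then show "c b a *\<^sub>R g (xs @ b # ws) =
        (\<Sum>bs\<in>?L. (c b a * (\<Prod>j<length ws. c (bs ! j) (ws ! j))) *\<^sub>R g (xs @ b # bs))"
      by (simp add: scaleR_sum_right)
  qed
  also have "\<dots> = (\<Sum>bs\<in>?L. \<Sum>b\<in>B. (c b a * (\<Prod>j<length ws. c (bs ! j) (ws ! j))) *\<^sub>R g (xs @ b # bs))"
    by (rule sum.swap)
  also have "\<dots> = (\<Sum>(bs, b)\<in>?L \<times> B. (c b a * (\<Prod>j<length ws. c (bs ! j) (ws ! j))) *\<^sub>R g (xs @ b # bs))"
    by (rule sum.cartesian_product)
  also have "\<dots> = (\<Sum>bs | set bs \<subseteq> B \<and> length bs = Suc (length ws).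
      (\<Prod>j<Suc (length ws). c (bs ! j) ((a # ws) ! j)) *\<^sub>R g (xs @ bs))"
    unfolding lists_length_Suc_eq
    by (subst sum.reindex) (auto simp: inj_on_def prod.lessThan_Suc_shift case_prod_beta
        simp del: prod.lessThan_Suc intro!: sum.cong)
  finally show ?case by simp
qed

lemma list_multilinear_expand:
  assumes "list_multilinear k g" and "linear_coordinates B c" and "length ws = k"
  shows "g ws = (\<Sum>bs | set bs \<subseteq> B \<and> length bs = k. (\<Prod>j<k. c (bs ! j) (ws ! j)) *\<^sub>R g bs)"
  using list_multilinear_expand_suffix[OF assms(1,2), of "[]" ws] assms(3) by simp

lemma smooth_on_multilinear:
  fixes F :: "'a::real_normed_vector \<Rightarrow> 'b::real_normed_vector" and h :: "nat \<Rightarrow> 'a \<Rightarrow>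
      'c::real_normed_vector"
    and B :: "'b set" and C :: "'c set" and \<omega> :: "'b \<Rightarrow> 'c list \<Rightarrow> 'v::real_normed_vector"
  assumes B: "linear_coordinates B b" and C: "linear_coordinates C c" and "open S"
    and F: "smooth_on S F" "F ` S \<subseteq> T"
    and \<omega>: "\<And>y. y \<in> T \<Longrightarrow> list_multilinear k (\<omega> y)"
    and smooth: "\<And>ws. length ws = k \<Longrightarrow> smooth_on T (\<lambda>y. \<omega> y ws)"
    and h: "\<And>j. j < k \<Longrightarrow> smooth_on S (h j)"
  shows "smooth_on S (\<lambda>x. \<omega> (F x) (map (\<lambda>j. h j x) [0..<k]))"
proof (rule smooth_on_cong[OF _ \<open>open S\<close>])
  show "(\<Sum>bs | set bs \<subseteq> C \<and> length bs = k. (\<Prod>j<k. c (bs ! j) (h j x)) *\<^sub>R \<omega> (F x) bs) =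
      \<omega> (F x) (map (\<lambda>j. h j x) [0..<k])" if "x \<in> S" for x
    using F(2) that by (subst (2) list_multilinear_expand[OF \<omega> C]) auto
  have "smooth_on S (\<lambda>x. (\<Prod>j<k. c (bs ! j) (h j x)) *\<^sub>R \<omega> (F x) bs)" if "length bs = k" for bs
  proof (rule smooth_on_scaleR[OF \<open>open S\<close>])
    show "smooth_on S (\<lambda>x. \<Prod>j<k. c (bs ! j) (h j x))"
    proof (rule smooth_on_prod[OF \<open>open S\<close>])
      show "smooth_on S (\<lambda>x. c (bs ! j) (h j x))" if "j \<in> {..<k}" for j
        using C that by (intro smooth_on_bounded_linear[OF _ \<open>open S\<close> h, of "c (bs ! j)"])
          (auto simp: linear_coordinates_def)
    qed
    show "smooth_on S (\<lambda>x. \<omega> (F x) bs)"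
      by (rule smooth_on_compose[OF B \<open>open S\<close> F(2,1) smooth[OF that]])
  qed
  then show "smooth_on S (\<lambda>x. \<Sum>bs | set bs \<subseteq> C \<and> length bs =
      k. (\<Prod>j<k. c (bs ! j) (h j x)) *\<^sub>R \<omega> (F x) bs)"
    by (intro smooth_on_sum \<open>open S\<close>) auto
qed

text \<open>The product rule for a multilinear function of a base point and of \<open>k\<close> vectors, all varying:
  after expansion in a basis it is the product rule for the coefficients, and the terms are
  collected by the same expansion read backwards.\<close>

lemma has_derivative_multilinear:
  fixes F :: "'a::real_normed_vector \<Rightarrow> 'b::real_normed_vector" and h :: "nat \<Rightarrow> 'a \<Rightarrow>
      'c::real_normed_vector"
    and C :: "'c set" and \<omega> :: "'b \<Rightarrow> 'c list \<Rightarrow> 'v::real_normed_vector"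
  assumes C: "linear_coordinates C c" and "open T" "F x0 \<in> T"
    and \<omega>: "\<And>y. y \<in> T \<Longrightarrow> list_multilinear k (\<omega> y)"
    and diff: "\<And>ws. length ws = k \<Longrightarrow> (\<lambda>y. \<omega> y ws) differentiable (at (F x0))"
    and F: "(F has_derivative F') (at x0)"
    and h: "\<And>j. j < k \<Longrightarrow> (h j has_derivative h' j) (at x0)"
  shows "((\<lambda>x. \<omega> (F x) (map (\<lambda>j. h j x) [0..<k])) has_derivative
    (\<lambda>u. frechet_derivative (\<lambda>y. \<omega> y (map (\<lambda>j. h j x0) [0..<k])) (at (F x0)) (F' u) +
      (\<Sum>j<k. \<omega> (F x0) ((map (\<lambda>j. h j x0) [0..<k])[j := h' j u])))) (at x0)"
proof -
  define W where "W bs = frechet_derivative (\<lambda>y. \<omega> y bs) (at (F x0))" for bs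
  have W: "((\<lambda>y. \<omega> y bs) has_derivative W bs) (at (F x0))" if "length bs = k" for bs
    unfolding W_def using diff[OF that] by (rule has_derivative_frechet)
  define I where "I = {bs. set bs \<subseteq> C \<and> length bs = k}"
  have I: "length bs = k" if "bs \<in> I" for bs using that by (simp add: I_def)
  have c: "bounded_linear (c b)" for b using C by (simp add: linear_coordinates_def)
  define ws where "ws = map (\<lambda>j. h j x0) [0..<k]"
  \<comment> \<open>The derivatives of \<open>\<omega>\<close> at fixed arguments are again multilinear in them.\<close>
  have W_expand: "W ws v = (\<Sum>bs\<in>I. (\<Prod>j<k. c (bs ! j) (h j x0)) *\<^sub>R W bs v)" for v
  proof -
    have "((\<lambda>y. \<Sum>bs\<in>I. (\<Prod>j<k. c (bs ! j) (ws ! j)) *\<^sub>R \<omega> y bs) has_derivative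
        (\<lambda>v. \<Sum>bs\<in>I. (\<Prod>j<k. c (bs ! j) (ws ! j)) *\<^sub>R W bs v)) (at (F x0))"
      by (intro has_derivative_sum has_derivative_scaleR_right W I)
    then have "((\<lambda>y. \<omega> y ws) has_derivative
        (\<lambda>v. \<Sum>bs\<in>I. (\<Prod>j<k. c (bs ! j) (ws ! j)) *\<^sub>R W bs v)) (at (F x0))"
    proof (rule has_derivative_transform_within_open[OF _ \<open>open T\<close> \<open>F x0 \<in> T\<close>])
      show "(\<Sum>bs\<in>I. (\<Prod>j<k. c (bs ! j) (ws ! j)) *\<^sub>R \<omega> y bs) = \<omega> y ws" if "y \<in> T" for y
        using list_multilinear_expand[OF \<omega>[OF that] C, of ws] by (simp add: ws_def I_def)
    qed
    then have "(\<lambda>v. \<Sum>bs\<in>I. (\<Prod>j<k. c (bs ! j) (ws ! j)) *\<^sub>R W bs v) = W ws"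
      unfolding W_def[of ws] by (rule frechet_derivative_at)
    then show ?thesis by (auto simp: ws_def fun_eq_iff)
  qed
  have replace: "\<omega> (F x0) (ws[j := v]) =
      (\<Sum>bs\<in>I. (c (bs ! j) v * (\<Prod>i\<in>{..<k} - {j}. c (bs ! i) (h i x0))) *\<^sub>R \<omega> (F x0) bs)" if "j < k"
          for j v
  proof -
    have "(\<Prod>i<k. c (bs ! i) (ws[j := v] ! i)) = c (bs ! j) v * (\<Prod>i\<in>{..<k} - {j}. c (bs ! i) (h i
        x0))" for bs
      using that by (subst prod.remove[of _ j]) (auto simp: ws_def intro!: prod.cong)
    then show ?thesis
      using list_multilinear_expand[OF \<omega>[OF \<open>F x0 \<in> T\<close>] C, of "ws[j := v]"] by (simp add: ws_def I_def)
  qed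
  have prod: "((\<lambda>x. \<Prod>j<k. c (bs ! j) (h j x)) has_derivative
      (\<lambda>u. \<Sum>j<k. c (bs ! j) (h' j u) * (\<Prod>i\<in>{..<k} - {j}. c (bs ! i) (h i x0)))) (at x0)" for bs
    by (rule has_derivative_prod) (auto intro!: bounded_linear.has_derivative[OF c] h)
  have "((\<lambda>x. \<Sum>bs\<in>I. (\<Prod>j<k. c (bs ! j) (h j x)) *\<^sub>R \<omega> (F x) bs) has_derivative
      (\<lambda>u. \<Sum>bs\<in>I. (\<Prod>j<k. c (bs ! j) (h j x0)) *\<^sub>R W bs (F' u) +
        (\<Sum>j<k. c (bs ! j) (h' j u) * (\<Prod>i\<in>{..<k} - {j}. c (bs ! i) (h i x0))) *\<^sub>R \<omega> (F x0) bs)) (at x0)"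
    by (intro has_derivative_sum has_derivative_scaleR prod has_derivative_compose[OF F W] I)
  also have "(\<lambda>u. \<Sum>bs\<in>I. (\<Prod>j<k. c (bs ! j) (h j x0)) *\<^sub>R W bs (F' u) +
        (\<Sum>j<k. c (bs ! j) (h' j u) * (\<Prod>i\<in>{..<k} - {j}. c (bs ! i) (h i x0))) *\<^sub>R \<omega> (F x0) bs) =
      (\<lambda>u. W ws (F' u) + (\<Sum>j<k. \<omega> (F x0) (ws[j := h' j u])))"
    by (simp add: W_expand replace sum.distrib scaleR_sum_left sum.swap[of _ I])
  finally have der: "((\<lambda>x. \<Sum>bs\<in>I. (\<Prod>j<k. c (bs ! j) (h j x)) *\<^sub>R \<omega> (F x) bs) has_derivative
      (\<lambda>u. W ws (F' u) + (\<Sum>j<k. \<omega> (F x0) (ws[j := h' j u])))) (at x0)" .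
  have eq: "(\<Sum>bs\<in>I. (\<Prod>j<k. c (bs ! j) (h j x)) *\<^sub>R \<omega> (F x) bs) = \<omega> (F x) (map (\<lambda>j. h j x) [0..<k])"
    if "F x \<in> T" for x
    using list_multilinear_expand[OF \<omega>[OF that] C, of "map (\<lambda>j. h j x) [0..<k]"] by (simp add: I_def)
  have "isCont F x0" using F by (rule has_derivative_continuous)
  then have ev: "\<forall>\<^sub>F x in at x0. F x \<in> T"
    using \<open>open T\<close> \<open>F x0 \<in> T\<close> by (auto simp: isCont_def intro: topological_tendstoD)
  have "\<forall>\<^sub>F x in at x0. (\<Sum>bs\<in>I. (\<Prod>j<k. c (bs ! j) (h j x)) *\<^sub>R \<omega> (F x) bs) =
      \<omega> (F x) (map (\<lambda>j. h j x) [0..<k])"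
    by (rule eventually_mono[OF ev eq])
  from has_derivative_transform_eventually[OF der this eq[OF \<open>F x0 \<in> T\<close>]] show ?thesis
    by (simp add: ws_def W_def)
qed

lemma list_alternating_swap:
  assumes "list_multilinear k g" "list_alternating k g" "length xs + Suc (Suc (length ys)) = k"
  shows "g (xs @ a # b # ys) = - g (xs @ b # a # ys)"
proof -
  have 1: "linear (\<lambda>u. g (xs @ u # v # ys))" for v
    using list_multilinear_linear_append[OF assms(1), of xs "v # ys"] assms(3) by simp
  have 2: "linear (\<lambda>u. g (xs @ v # u # ys))" for v
    using list_multilinear_linear_append[OF assms(1), of "xs @ [v]" ys] assms(3) by simp
  have 0: "g (xs @ v # v # ys) = 0" for v
    using assms(2,3) by (simp add: list_alternating_def)
  have "0 = g (xs @ (a + b) # (a + b) # ys)" by (simp add: 0)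
  also have "\<dots> = g (xs @ a # b # ys) + g (xs @ b # a # ys)"
    by (subst linear_add[OF 1], subst linear_add[OF 2], subst linear_add[OF 2]) (simp add: 0)
  finally show ?thesis by (simp add: eq_neg_iff_add_eq_0)
qed

text \<open>Moving an entry across \<open>ys\<close> takes \<open>length ys\<close> transpositions of neighbours.\<close>

lemma list_alternating_move:
  assumes "list_multilinear k g" "list_alternating k g" "length xs + Suc (length ys + length zs) = k"
  shows "g (xs @ ys @ a # zs) = (-1) ^ length ys *\<^sub>R g (xs @ a # ys @ zs)"
  using assms(3)
proof (induction ys arbitrary: xs)
  case Nil
  then show ?case by simp
next
  case (Cons y ys)
  have "g (xs @ (y # ys) @ a # zs) = (-1) ^ length ys *\<^sub>R g (xs @ y # a # ys @ zs)"
    using Cons.IH[of "xs @ [y]"] Cons.prems by simp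
  also have "g (xs @ y # a # ys @ zs) = - g (xs @ a # y # ys @ zs)"
    using Cons.prems by (intro list_alternating_swap[OF assms(1,2)]) simp
  finally show ?case by simp
qed

lemma length_remove_nth: "i < length xs \<Longrightarrow> length (remove_nth i xs) = length xs - 1"
  by (simp add: remove_nth_def)

text \<open>In the double sum the terms for the ordered pairs \<open>(a, b)\<close> and \<open>(b, a)\<close> of arguments that
  are fed into the symmetric \<open>H\<close> differ by moving the entry \<open>H\<close> across \<open>b - a - 1\<close> others, and by
  the signs \<open>(-1)\<^sup>a\<close> and \<open>(-1)\<^sup>b\<close>; hence they cancel.\<close>

lemma alternating_symmetric_cancel:
  fixes g :: "'b::real_vector list \<Rightarrow> 'v::real_vector"
  assumes g: "list_multilinear k g" "list_alternating k g"
    and H: "\<And>u v. H u v = H v u" and us: "length us = Suc k"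
  shows "(\<Sum>i<Suc k. \<Sum>j<k. (-1) ^ i *\<^sub>R g ((map A (remove_nth i us))[j :=
      H (us ! i) (remove_nth i us ! j)])) = 0"
proof -
  define t where "t i j = (-1) ^ i *\<^sub>R g ((map A (remove_nth i us))[j :=
      H (us ! i) (remove_nth i us ! j)])"
    for i j :: nat
  \<comment> \<open>\<open>U a b\<close> is the term in which the arguments \<open>a\<close> and \<open>b\<close> are fed into \<open>H\<close>; after the removal of
      argument \<open>a\<close>, argument \<open>b\<close> has moved down by one if it came later.\<close>
  define U where "U a b = (if a = b then 0 else t a (if b < a then b else b - 1))" for a b
  have U: "U a b = - U b a" if ab: "a < b" "b < Suc k" for a b
  proof -
    define P Q R where "P = take a us" and "Q = take (b - Suc a) (drop (Suc a) us)" and "R =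
        drop (Suc b) us"
    have len: "length P = a" "length Q = b - Suc a" using ab us by (auto simp: P_def Q_def)
    have split: "us = P @ us ! a # Q @ us ! b # R"
    proof -
      have "drop (Suc a) us = Q @ drop (b - Suc a) (drop (Suc a) us)"
        by (simp only: Q_def append_take_drop_id)
      also have "drop (b - Suc a) (drop (Suc a) us) = us ! b # R"
        using ab us by (simp add: R_def Cons_nth_drop_Suc)
      finally show ?thesis
        using ab us id_take_nth_drop[of a us] by (simp add: P_def)
    qed
    define x y where "x = us ! a" and "y = us ! b"
    have us': "us = P @ x # Q @ y # R" using split by (simp add: x_def y_def)
    have ra: "remove_nth a us = P @ Q @ y # R"
      using len by (simp add: us' remove_nth_def)
    have rb: "remove_nth b us = P @ x # Q @ R"
    proof -
      have b: "b = length (P @ x # Q)" using len ab by simp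
      have "us = (P @ x # Q) @ y # R" by (simp add: us')
      then show ?thesis unfolding remove_nth_def b by simp
    qed
    have b1: "b - 1 = length P + length Q" using len ab by simp
    have na: "remove_nth a us ! (b - 1) = y"
      unfolding ra b1 by (simp add: nth_append)
    have nb: "remove_nth b us ! a = x"
      using len by (simp add: rb nth_append)
    have "U a b = (-1) ^ a *\<^sub>R g ((map A P @ map A Q @ A y # map A R)[b - 1 := H x y])"
      using ab na by (simp add: U_def t_def ra x_def)
    also have "(map A P @ map A Q @ A y # map A R)[b - 1 := H x y] = map A P @ map A Q @ H x y # map A R"
      unfolding b1 by (simp add: list_update_append)
    also have "g \<dots> = (-1) ^ length (map A Q) *\<^sub>R g (map A P @ H x y # map A Q @ map A R)"
      using us arg_cong[OF us', of length] by (intro list_alternating_move[OF g]) simp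
    also have "map A P @ H x y # map A Q @ map A R = (map A (remove_nth b us))[a := H y x]"
      using len by (simp add: rb list_update_append H)
    also have "(-1) ^ a *\<^sub>R (-1) ^ length (map A Q) *\<^sub>R g ((map A (remove_nth b us))[a := H y x]) =
        - ((-1) ^ b *\<^sub>R g ((map A (remove_nth b us))[a := H y x]))"
    proof -
      have "b = Suc (a + (b - Suc a))" using ab by simp
      then have "(-1::real) ^ b = - ((-1) ^ a * (-1) ^ (b - Suc a))"
        by (metis power_Suc power_add mult_minus1)
      then show ?thesis using len by simp
    qed
    also have "(-1) ^ b *\<^sub>R g ((map A (remove_nth b us))[a := H y x]) = U b a"
      using ab nb by (simp add: U_def t_def y_def)
    finally show ?thesis .
  qed
  then have anti: "U a b = - U b a" if "a < Suc k" "b < Suc k" for a b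
    using that by (cases a b rule: linorder_cases) (auto simp: U_def)
  have row: "(\<Sum>j<k. t i j) = (\<Sum>b<Suc k. U i b)" if "i < Suc k" for i
  proof -
    have "(\<Sum>b<Suc k. U i b) = (\<Sum>b\<in>{..<Suc k} - {i}. U i b)"
      by (rule sum.mono_neutral_right) (auto simp: U_def)
    also have "\<dots> = (\<Sum>j<k. t i j)"
      by (rule sum.reindex_bij_witness[where i = "\<lambda>j. if j < i then j else Suc j" and
            j = "\<lambda>b. if b < i then b else b - 1"])
         (use that in \<open>auto simp: U_def split: if_splits\<close>)
    finally show ?thesis ..
  qed
  have "(\<Sum>i<Suc k. \<Sum>j<k. t i j) = (\<Sum>a<Suc k. \<Sum>b<Suc k. U a b)"
    by (rule sum.cong[OF refl], rule row) simp
  moreover have "(\<Sum>a<Suc k. \<Sum>b<Suc k. U a b) = - (\<Sum>a<Suc k. \<Sum>b<Suc k. U a b)"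
  proof -
    have "(\<Sum>a<Suc k. \<Sum>b<Suc k. U a b) = (\<Sum>b<Suc k. \<Sum>a<Suc k. U a b)"
      by (rule sum.swap)
    also have "\<dots> = (\<Sum>b<Suc k. \<Sum>a<Suc k. - U b a)"
      by (rule sum.cong[OF refl], rule sum.cong[OF refl], rule anti) auto
    finally show ?thesis unfolding sum_negf .
  qed
  then have "(2::real) *\<^sub>R (\<Sum>a<Suc k. \<Sum>b<Suc k. U a b) = 0"
    by (metis scaleR_2 neg_eq_iff_add_eq_0)
  ultimately show ?thesis by (simp add: t_def)
qed

text \<open>Differentiating \<open>\<omega>\<close> at \<open>F x\<close> on the vectors \<open>DF u\<^sub>j\<close> gives the right-hand side and, from the
  factors \<open>DF u\<^sub>j\<close>, terms with the second derivative of \<open>F\<close>. The latter is symmetric, so that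
  alternation makes their signed sum vanish.\<close>

lemma ext_d_pullback_in_coordinates:
  fixes F :: "'a::real_normed_vector \<Rightarrow> 'b::real_normed_vector"
    and \<omega> :: "'b \<Rightarrow> 'b list \<Rightarrow> 'v::real_normed_vector" and B :: "'b set"
  assumes B: "linear_coordinates B c" and "open S" "x0 \<in> S" and F: "smooth_on S F"
    and "open T" "F x0 \<in> T" and \<omega>: "\<And>y. y \<in> T \<Longrightarrow> list_multilinear k (\<omega> y)"
    and alt: "list_alternating k (\<omega> (F x0))"
    and diff: "\<And>ws. length ws = k \<Longrightarrow> (\<lambda>y. \<omega> y ws) differentiable (at (F x0))"
    and us: "length us = Suc k"
  shows "(\<Sum>i<Suc k. (-1) ^ i *\<^sub>R frechet_derivative
        (\<lambda>x. \<omega> (F x) (map (frechet_derivative F (at x)) (remove_nth i us))) (at x0) (us ! i)) =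
    (\<Sum>i<Suc k. (-1) ^ i *\<^sub>R frechet_derivative
        (\<lambda>y. \<omega> y (map (frechet_derivative F (at x0)) (remove_nth i us))) (at (F x0))
          (frechet_derivative F (at x0) (us ! i)))"
proof -
  define D where "D x = frechet_derivative F (at x)" for x
  define H where "H u v = frechet_derivative (\<lambda>x. D x v) (at x0) u" for u v
  have diffF: "F differentiable (at y)" if "y \<in> S" for y
    by (rule smooth_on_imp_differentiable[OF F that])
  have diffD: "(\<lambda>x. D x v) differentiable (at x0)" for v
    unfolding D_def by (rule smooth_on_imp_differentiable[OF smooth_on_derivative[OF F] \<open>x0 \<in> S\<close>])
  have H: "H u v = H v u" for u v
    unfolding H_def D_def
    by (rule second_derivative_symmetric[OF \<open>open S\<close> \<open>x0 \<in> S\<close> diffF diffD[unfolded D_def]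
        diffD[unfolded D_def]])
  have "frechet_derivative (\<lambda>x. \<omega> (F x) (map (D x) vs)) (at x0) u =
      frechet_derivative (\<lambda>y. \<omega> y (map (D x0) vs)) (at (F x0)) (D x0 u) +
      (\<Sum>j<k. \<omega> (F x0) ((map (D x0) vs)[j := H u (vs ! j)]))" if vs: "length vs = k" for vs u
  proof -
    have map: "map (\<lambda>j. D x (vs ! j)) [0..<k] = map (D x) vs" for x
      using vs by (auto intro: nth_equalityI)
    have "((\<lambda>x. \<omega> (F x) (map (\<lambda>j. D x (vs ! j)) [0..<k])) has_derivative
      (\<lambda>u. frechet_derivative (\<lambda>y. \<omega> y (map (\<lambda>j. D x0 (vs ! j)) [0..<k])) (at (F x0)) (D x0 u) +
        (\<Sum>j<k. \<omega> (F x0) ((map (\<lambda>j. D x0 (vs ! j)) [0..<k])[j := H u (vs ! j)])))) (at x0)"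
      using has_derivative_multilinear[where F = F and F' = "D x0" and h = "\<lambda>j x. D x (vs ! j)" and
          h' = "\<lambda>j u. H u (vs ! j)", OF B \<open>open T\<close> \<open>F x0 \<in> T\<close> \<omega> diff]
        has_derivative_frechet[OF diffF[OF \<open>x0 \<in> S\<close>]] has_derivative_frechet[OF diffD]
      by (simp add: D_def H_def)
    then show ?thesis
      unfolding map by (metis (mono_tags, lifting) frechet_derivative_at)
  qed
  then have "(\<Sum>i<Suc k. (-1) ^ i *\<^sub>R frechet_derivative (\<lambda>x. \<omega> (F x) (map (D x) (remove_nth i us)))
      (at x0) (us ! i)) =
    (\<Sum>i<Suc k. (-1) ^ i *\<^sub>R frechet_derivative (\<lambda>y. \<omega> y (map (D x0) (remove_nth i us))) (at (F x0))
        (D x0 (us ! i))) +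
    (\<Sum>i<Suc k. \<Sum>j<k. (-1) ^ i *\<^sub>R \<omega> (F x0) ((map (D x0) (remove_nth i us))[j :=
        H (us ! i) (remove_nth i us ! j)]))"
    using us by (simp add: length_remove_nth scaleR_add_right sum.distrib scaleR_sum_right del:
        sum.lessThan_Suc)
  also have "(\<Sum>i<Suc k. \<Sum>j<k. (-1) ^ i *\<^sub>R \<omega> (F x0) ((map (D x0) (remove_nth i us))[j :=
      H (us ! i) (remove_nth i us ! j)])) = 0"
    by (rule alternating_symmetric_cancel[OF \<omega>[OF \<open>F x0 \<in> T\<close>] alt H us])
  finally show ?thesis by (simp add: D_def)
qed

section \<open>Charts, tangent vectors and the chain rule\<close>

lemma frechet_derivative_cong_open:
  assumes "open S" "x \<in> S" "\<And>y. y \<in> S \<Longrightarrow> f y = g y"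
  shows "frechet_derivative f (at x) = frechet_derivative g (at x)"
proof -
  have "(f has_derivative D) (at x) \<longleftrightarrow> (g has_derivative D) (at x)" for D
    using assms by (metis has_derivative_transform_within_open)
  then show ?thesis by (simp add: frechet_derivative_def)
qed

lemma chart_open:
  assumes "smooth_manifold A" "c \<in> A"
  shows "open (fst c)" "open (snd c ` fst c)"
  using assms by (auto simp: smooth_manifold_def)

lemma chart_inverse:
  assumes "smooth_manifold A" "c \<in> A"
  shows "p \<in> fst c \<Longrightarrow> chart_inv c (snd c p) = p"
    and "x \<in> snd c ` fst c \<Longrightarrow> chart_inv c x \<in> fst c"
    and "x \<in> snd c ` fst c \<Longrightarrow> snd c (chart_inv c x) = x"
    and "continuous_on (fst c) (snd c)"
    and "continuous_on (snd c ` fst c) (chart_inv c)"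
proof -
  have "homeomorphism (fst c) (snd c ` fst c) (snd c) (chart_inv c)"
    using assms by (auto simp: smooth_manifold_def)
  then show "p \<in> fst c \<Longrightarrow> chart_inv c (snd c p) = p"
    and "x \<in> snd c ` fst c \<Longrightarrow> chart_inv c x \<in> fst c"
    and "x \<in> snd c ` fst c \<Longrightarrow> snd c (chart_inv c x) = x"
    and "continuous_on (fst c) (snd c)"
    and "continuous_on (snd c ` fst c) (chart_inv c)"
    by (auto simp: homeomorphism_def)
qed

lemma chart_image_eq:
  assumes "smooth_manifold A" "c \<in> A"
  shows "snd c ` (fst c \<inter> U) = snd c ` fst c \<inter> chart_inv c -` U"
  using chart_inverse[OF assms] by force

lemma chart_image_open:
  assumes "smooth_manifold A" "c \<in> A" "open (fst c \<inter> U)"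
  shows "open (snd c ` (fst c \<inter> U))"
proof -
  have "open (snd c ` fst c \<inter> chart_inv c -` (fst c \<inter> U))"
    by (rule continuous_open_preimage[OF chart_inverse(5)[OF assms(1,2)]
        chart_open(2)[OF assms(1,2)] assms(3)])
  then show ?thesis
    using chart_image_eq[OF assms(1,2), of "fst c \<inter> U"] by simp
qed

lemma chart_at:
  assumes "p \<in> mcarrier A"
  shows "chart_at A p \<in> A" "p \<in> fst (chart_at A p)"
proof -
  have "\<exists>c. c \<in> A \<and> p \<in> fst c" using assms by (auto simp: mcarrier_def)
  from someI_ex[OF this] show "chart_at A p \<in> A" "p \<in> fst (chart_at A p)"
    by (simp_all add: chart_at_def)
qed

lemma chart_subset_mcarrier: "c \<in> A \<Longrightarrow> p \<in> fst c \<Longrightarrow> p \<in> mcarrier A"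
  by (auto simp: mcarrier_def)

lemma open_mcarrier: "smooth_manifold A \<Longrightarrow> open (mcarrier A)"
  by (auto simp: mcarrier_def smooth_manifold_def)

definition smooth_manifold_map ::
  "('m::{t2_space, second_countable_topology}, 'a::real_normed_vector) atlas \<Rightarrow>
   ('n::{t2_space, second_countable_topology}, 'b::real_normed_vector) atlas \<Rightarrow> ('m \<Rightarrow> 'n) \<Rightarrow> bool" where
  "smooth_manifold_map A B f \<longleftrightarrow> smooth_manifold A \<and> smooth_manifold B \<and> smooth_map A B f"

lemma smooth_manifold_mapD:
  assumes "smooth_manifold_map A B f"
  shows "smooth_manifold A" "smooth_manifold B" "smooth_map A B f"
    and "p \<in> mcarrier A \<Longrightarrow> f p \<in> mcarrier B" "continuous_on (mcarrier A) f"
  using assms by (auto simp: smooth_manifold_map_def smooth_map_def)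

lemma smooth_manifold_map_id: "smooth_manifold A \<Longrightarrow> smooth_manifold_map A A id"
  unfolding smooth_manifold_map_def smooth_map_def
  by (auto simp: smooth_manifold_def)

lemma open_chart_preimage:
  assumes "smooth_manifold_map A B f" "c \<in> A" "open V"
  shows "open (fst c \<inter> f -` V)"
proof -
  have "continuous_on (fst c) f"
    using smooth_manifold_mapD(5)[OF assms(1)] assms(2)
    by (auto intro: continuous_on_subset chart_subset_mcarrier)
  then show ?thesis
    using chart_open(1)[OF smooth_manifold_mapD(1)[OF assms(1)] assms(2)] assms(3)
    by (rule continuous_open_preimage)
qed

lemma open_preimage:
  assumes "smooth_manifold_map A B f" "open V"
  shows "open (mcarrier A \<inter> f -` V)"
  using smooth_manifold_mapD(5)[OF assms(1)] open_mcarrier[OF smooth_manifold_mapD(1)[OF assms(1)]]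
      assms(2)
  by (rule continuous_open_preimage)

lemma local_rep_smooth:
  assumes "smooth_manifold_map A B f" "c \<in> A" "d \<in> B"
  shows "smooth_on (snd c ` (fst c \<inter> f -` fst d)) (snd d \<circ> f \<circ> chart_inv c)"
    and "open V \<Longrightarrow> open (snd c ` (fst c \<inter> f -` V))"
  using assms smooth_manifold_mapD(3)[OF assms(1)] open_chart_preimage[OF assms(1,2)]
  by (auto simp: smooth_map_def intro!: chart_image_open[OF smooth_manifold_mapD(1)[OF assms(1)]
      assms(2)])

lemma local_rep_has_derivative:
  assumes "smooth_manifold_map A B f" "c \<in> A" "d \<in> B" "p \<in> fst c" "f p \<in> fst d"
  shows "(snd d \<circ> f \<circ> chart_inv c has_derivative
    frechet_derivative (snd d \<circ> f \<circ> chart_inv c) (at (snd c p))) (at (snd c p))"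
  using assms by (intro smooth_on_has_derivative[OF local_rep_smooth(1)[OF assms(1-3)]]) auto

text \<open>All chain rules on manifolds come from this one: with \<open>f\<close> the identity it compares two
  charts, and \<open>h\<close> is a function, or a coordinate map after a further map.\<close>

lemma has_derivative_in_charts:
  assumes f: "smooth_manifold_map A B f" and "c \<in> A" "d \<in> B" "p \<in> fst c" "f p \<in> fst d"
    and h: "(h \<circ> chart_inv d has_derivative H) (at (snd d (f p)))"
  shows "(h \<circ> f \<circ> chart_inv c has_derivative
    (\<lambda>u. H (frechet_derivative (snd d \<circ> f \<circ> chart_inv c) (at (snd c p)) u))) (at (snd c p))"
proof -
  note A = smooth_manifold_mapD(1)[OF f] and B = smooth_manifold_mapD(2)[OF f]
  have "((\<lambda>x. (h \<circ> chart_inv d) ((snd d \<circ> f \<circ> chart_inv c) x)) has_derivative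
      (\<lambda>u. H (frechet_derivative (snd d \<circ> f \<circ> chart_inv c) (at (snd c p)) u))) (at (snd c p))"
    by (rule has_derivative_compose[OF local_rep_has_derivative[OF assms(1-5)]])
       (use h chart_inverse(1)[OF A assms(2,4)] in \<open>simp add: comp_def\<close>)
  moreover have "open (snd c ` (fst c \<inter> f -` fst d))"
    by (rule local_rep_smooth(2)[OF f assms(2,3) chart_open(1)[OF B assms(3)]])
  moreover have "snd c p \<in> snd c ` (fst c \<inter> f -` fst d)"
    using assms by auto
  moreover have "(h \<circ> chart_inv d) ((snd d \<circ> f \<circ> chart_inv c) x) = (h \<circ> f \<circ> chart_inv c) x"
    if "x \<in> snd c ` (fst c \<inter> f -` fst d)" for x
    using that chart_inverse(1)[OF A assms(2)] chart_inverse(1)[OF B assms(3)] by auto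
  ultimately show ?thesis by (rule has_derivative_transform_within_open)
qed

lemma frechet_derivative_in_charts:
  assumes "smooth_manifold_map A B f" and "c \<in> A" "d \<in> B" "p \<in> fst c" "f p \<in> fst d"
    and "h \<circ> chart_inv d differentiable (at (snd d (f p)))"
  shows "frechet_derivative (h \<circ> f \<circ> chart_inv c) (at (snd c p)) u =
    frechet_derivative (h \<circ> chart_inv d) (at (snd d (f p)))
      (frechet_derivative (snd d \<circ> f \<circ> chart_inv c) (at (snd c p)) u)"
  using frechet_derivative_at[OF has_derivative_in_charts[OF assms(1-5) has_derivative_frechet[OF
      assms(6)]]]
  by (simp add: fun_eq_iff)

lemma transition_has_derivative:
  assumes "smooth_manifold A" "c \<in> A" "d \<in> A" "p \<in> fst c" "p \<in> fst d"
  shows "(snd d \<circ> chart_inv c has_derivative frechet_derivative (snd d \<circ> chart_inv c) (at (snd c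
      p))) (at (snd c p))"
  using local_rep_has_derivative[OF smooth_manifold_map_id[OF assms(1)] assms(2-4)] assms(5) by simp

lemma frechet_derivative_change_chart:
  assumes "smooth_manifold A" "c \<in> A" "d \<in> A" "p \<in> fst c" "p \<in> fst d"
    and "h \<circ> chart_inv d differentiable (at (snd d p))"
  shows "frechet_derivative (h \<circ> chart_inv c) (at (snd c p)) u =
    frechet_derivative (h \<circ> chart_inv d) (at (snd d p))
      (frechet_derivative (snd d \<circ> chart_inv c) (at (snd c p)) u)"
    and "h \<circ> chart_inv c differentiable (at (snd c p))"
  using frechet_derivative_in_charts[OF smooth_manifold_map_id[OF assms(1)] assms(2-4), of h] assms(5,6)
    has_derivative_in_charts[OF smooth_manifold_map_id[OF assms(1)]
        assms(2-4) _ has_derivative_frechet, of h]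
  by (auto simp: differentiable_def)

lemma tangent_space_component:
  "v \<in> tangent_space A p \<Longrightarrow> c \<in> A \<Longrightarrow> d \<in> A \<Longrightarrow> p \<in> fst c \<Longrightarrow> p \<in> fst d \<Longrightarrow>
    v d = frechet_derivative (snd d \<circ> chart_inv c) (at (snd c p)) (v c)"
  unfolding tangent_space_def by blast

lemma tangent_space_outside:
  "v \<in> tangent_space A p \<Longrightarrow> \<not> (c \<in> A \<and> p \<in> fst c) \<Longrightarrow> v c = 0"
  unfolding tangent_space_def by blast

lemma tangent_spaceI:
  assumes "\<And>c d. c \<in> A \<Longrightarrow> d \<in> A \<Longrightarrow> p \<in> fst c \<Longrightarrow> p \<in> fst d \<Longrightarrow>
      v d = frechet_derivative (snd d \<circ> chart_inv c) (at (snd c p)) (v c)"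
    and "\<And>c. \<not> (c \<in> A \<and> p \<in> fst c) \<Longrightarrow> v c = 0"
  shows "v \<in> tangent_space A p"
  using assms unfolding tangent_space_def by blast

lemma tangent_space_eq_coord_tvec:
  assumes "v \<in> tangent_space A p" "c \<in> A" "p \<in> fst c"
  shows "coord_tvec A c p (v c) = v"
proof
  fix d
  show "coord_tvec A c p (v c) d = v d"
  proof (cases "d \<in> A \<and> p \<in> fst d")
    case True
    then show ?thesis using tangent_space_component[OF assms(1,2) _ assms(3), of d]
        by (simp add: coord_tvec_def)
  next
    case False
    then show ?thesis using tangent_space_outside[OF assms(1) False] by (auto simp: coord_tvec_def)
  qed
qed

lemma coord_tvec_component:
  assumes "smooth_manifold A" "c \<in> A" "p \<in> fst c"
  shows "coord_tvec A c p u c = u"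
proof -
  have "frechet_derivative (snd c \<circ> chart_inv c) (at (snd c p)) =
      frechet_derivative (\<lambda>x. x) (at (snd c p))"
    by (rule frechet_derivative_cong_open[OF chart_open(2)[OF assms(1,2)]])
       (use assms chart_inverse(3)[OF assms(1,2)] in auto)
  then show ?thesis using assms by (simp add: coord_tvec_def)
qed

lemma coord_tvec_in_tangent_space:
  assumes "smooth_manifold A" "c \<in> A" "p \<in> fst c"
  shows "coord_tvec A c p u \<in> tangent_space A p"
proof (rule tangent_spaceI)
  fix d e assume de: "d \<in> A" "e \<in> A" "p \<in> fst d" "p \<in> fst e"
  have "frechet_derivative (snd e \<circ> chart_inv c) (at (snd c p)) u =
      frechet_derivative (snd e \<circ> chart_inv d) (at (snd d p)) (frechet_derivative (snd d \<circ> chart_inv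
          c) (at (snd c p)) u)"
    by (rule frechet_derivative_change_chart(1)[OF assms(1,2) de(1) assms(3) de(3)
          differentiableI[OF transition_has_derivative[OF assms(1) de]]])
  then show "coord_tvec A c p u e = frechet_derivative (snd e \<circ> chart_inv d) (at (snd d p))
      (coord_tvec A c p u d)"
    using de by (simp add: coord_tvec_def)
qed (auto simp: coord_tvec_def)

lemma coord_tvec_lin:
  assumes "smooth_manifold A" "c \<in> A" "p \<in> fst c"
  shows "coord_tvec A c p (r *\<^sub>R u + s *\<^sub>R w) = tv_lin r (coord_tvec A c p u) s (coord_tvec A c p w)"
proof
  fix d
  show "coord_tvec A c p (r *\<^sub>R u + s *\<^sub>R w) d = tv_lin r (coord_tvec A c p u) s (coord_tvec A c p w) d"
  proof (cases "d \<in> A \<and> p \<in> fst d")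
    case True
    then have "linear (frechet_derivative (snd d \<circ> chart_inv c) (at (snd c p)))"
      using transition_has_derivative[OF assms(1,2) _ assms(3)] by (blast intro: has_derivative_linear)
    with True show ?thesis by (simp add: coord_tvec_def tv_lin_def linear_add linear_scale)
  qed (auto simp: coord_tvec_def tv_lin_def)
qed

lemma tangent_space_lin:
  assumes "smooth_manifold A" "v \<in> tangent_space A p" "w \<in> tangent_space A p"
  shows "tv_lin r v s w \<in> tangent_space A p"
proof (rule tangent_spaceI)
  fix c d assume cd: "c \<in> A" "d \<in> A" "p \<in> fst c" "p \<in> fst d"
  note L = has_derivative_linear[OF transition_has_derivative[OF assms(1) cd]]
  show "tv_lin r v s w d = frechet_derivative (snd d \<circ> chart_inv c) (at (snd c p)) (tv_lin r v s w c)"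
    unfolding tv_lin_def tangent_space_component[OF assms(2) cd] tangent_space_component[OF assms(3) cd]
    by (simp add: linear_add[OF L] linear_scale[OF L])
qed (use tangent_space_outside[OF assms(2)] tangent_space_outside[OF assms(3)]
    in \<open>auto simp: tv_lin_def\<close>)

text \<open>The definition of \<open>tmap\<close> selects a chart at \<open>p\<close>; the transformation law of tangent vectors
  makes its formula valid in every chart.\<close>

lemma tmap_component:
  assumes f: "smooth_manifold_map A B f" and v: "v \<in> tangent_space A p" and "c \<in> A" "p \<in> fst c" "d \<in>
      B" "f p \<in> fst d"
  shows "tmap A B f p v d = frechet_derivative (snd d \<circ> f \<circ> chart_inv c) (at (snd c p)) (v c)"
proof -
  note A = smooth_manifold_mapD(1)[OF f]
  define e where "e = chart_at A p"
  have e: "e \<in> A" "p \<in> fst e"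
    using chart_at[OF chart_subset_mcarrier[OF assms(3,4)]] by (auto simp: e_def)
  have "frechet_derivative (snd d \<circ> f \<circ> chart_inv e) (at (snd e p)) (v e) =
      frechet_derivative (snd d \<circ> f \<circ> chart_inv c) (at (snd c p))
        (frechet_derivative (snd c \<circ> chart_inv e) (at (snd e p)) (v e))"
    by (rule frechet_derivative_change_chart(1)[OF A e(1) assms(3) e(2) assms(4)
          differentiableI[OF local_rep_has_derivative[OF f assms(3,5,4,6)]]])
  also have "frechet_derivative (snd c \<circ> chart_inv e) (at (snd e p)) (v e) = v c"
    using tangent_space_component[OF v e(1) assms(3) e(2) assms(4)] by simp
  finally show ?thesis
    using assms by (simp add: tmap_def Let_def e_def comp_def)
qed

lemma tmap_in_tangent_space:
  assumes f: "smooth_manifold_map A B f" and v: "v \<in> tangent_space A p" and p: "p \<in> mcarrier A"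
  shows "tmap A B f p v \<in> tangent_space B (f p)"
proof (rule tangent_spaceI)
  fix d e assume de: "d \<in> B" "e \<in> B" "f p \<in> fst d" "f p \<in> fst e"
  note c = chart_at[OF p]
  show "tmap A B f p v e = frechet_derivative (snd e \<circ> chart_inv d) (at (snd d (f p))) (tmap A B f p
      v d)"
    unfolding tmap_component[OF f v c de(1,3)] tmap_component[OF f v c de(2,4)]
    by (rule frechet_derivative_in_charts[OF f c(1) de(1) c(2) de(3)
          differentiableI[OF transition_has_derivative[OF smooth_manifold_mapD(2)[OF f] de]]])
qed (auto simp: tmap_def)

lemma tmap_coord_tvec:
  assumes f: "smooth_manifold_map A B f" and "c \<in> A" "p \<in> fst c" "d \<in> B" "f p \<in> fst d"
  shows "tmap A B f p (coord_tvec A c p u) =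
    coord_tvec B d (f p) (frechet_derivative (snd d \<circ> f \<circ> chart_inv c) (at (snd c p)) u)"
proof -
  note A = smooth_manifold_mapD(1)[OF f]
  note u = coord_tvec_in_tangent_space[OF A assms(2,3), of u]
  show ?thesis
    using tangent_space_eq_coord_tvec[OF tmap_in_tangent_space[OF f u chart_subset_mcarrier[OF
        assms(2,3)]] assms(4,5)]
    by (simp add: tmap_component[OF f u assms(2-5)] coord_tvec_component[OF A assms(2,3)])
qed

lemma tmap_lin:
  assumes f: "smooth_manifold_map A B f" and p: "p \<in> mcarrier A"
  shows "tmap A B f p (tv_lin r v s w) = tv_lin r (tmap A B f p v) s (tmap A B f p w)"
proof
  fix d
  show "tmap A B f p (tv_lin r v s w) d = tv_lin r (tmap A B f p v) s (tmap A B f p w) d"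
  proof (cases "d \<in> B \<and> f p \<in> fst d")
    case True
    then have "linear (frechet_derivative (snd d \<circ> f \<circ> chart_inv (chart_at A p)) (at (snd (chart_at
        A p) p)))"
      using local_rep_has_derivative[OF f chart_at(1)[OF p] _ chart_at(2)[OF p]]
      by (blast intro: has_derivative_linear)
    with True show ?thesis by (simp add: tmap_def Let_def tv_lin_def linear_add linear_scale)
  qed (auto simp: tmap_def tv_lin_def)
qed

lemma tmap_cong:
  assumes A: "smooth_manifold A" and p: "p \<in> mcarrier A" and eq: "\<And>q. q \<in> mcarrier A \<Longrightarrow> f q = g q"
  shows "tmap A B f p = tmap A B g p"
proof -
  note c = chart_at[OF p]
  have "frechet_derivative (snd d \<circ> f \<circ> chart_inv (chart_at A p)) (at (snd (chart_at A p) p)) =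
      frechet_derivative (snd d \<circ> g \<circ> chart_inv (chart_at A p)) (at (snd (chart_at A p) p))"
          for d :: "('c, 'd) chart"
    by (rule frechet_derivative_cong_open[OF chart_open(2)[OF A c(1)]])
       (use c chart_subset_mcarrier[OF c(1)] chart_inverse(2)[OF A c(1)] eq in auto)
  then show ?thesis
    by (auto simp: tmap_def fun_eq_iff eq[OF p] Let_def)
qed

lemma tmap_compose:
  assumes f: "smooth_manifold_map A B f" and g: "smooth_manifold_map B C g"
    and p: "p \<in> mcarrier A" and v: "v \<in> tangent_space A p"
  shows "tmap B C g (f p) (tmap A B f p v) = tmap A C (\<lambda>q. g (f q)) p v"
proof
  fix e
  note c = chart_at[OF p] and fp = smooth_manifold_mapD(4)[OF f p]
  note d = chart_at[OF fp]
  show "tmap B C g (f p) (tmap A B f p v) e = tmap A C (\<lambda>q. g (f q)) p v e"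
  proof (cases "e \<in> C \<and> g (f p) \<in> fst e")
    case True
    have "frechet_derivative (snd e \<circ> g \<circ> f \<circ> chart_inv (chart_at A p)) (at (snd (chart_at A p) p))
        (v (chart_at A p)) =
        frechet_derivative (snd e \<circ> g \<circ> chart_inv (chart_at B (f p))) (at (snd (chart_at B (f p)) (f p)))
          (tmap A B f p v (chart_at B (f p)))"
      unfolding tmap_component[OF f v c d]
      using True by (intro frechet_derivative_in_charts[OF f c(1) d(1) c(2) d(2)]
          differentiableI[OF local_rep_has_derivative[OF g d(1) _ d(2)]]) auto
    then show ?thesis
      using True by (simp add: tmap_def Let_def comp_def)
  qed (auto simp: tmap_def)
qed

lemma fun_deriv_in_chart:
  assumes A: "smooth_manifold A" and v: "v \<in> tangent_space A p" and "c \<in> A" "p \<in> fst c"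
    and h: "h \<circ> chart_inv c differentiable (at (snd c p))"
  shows "fun_deriv A h p v = frechet_derivative (h \<circ> chart_inv c) (at (snd c p)) (v c)"
proof -
  note e = chart_at[OF chart_subset_mcarrier[OF assms(3,4)]]
  show ?thesis
    using frechet_derivative_change_chart(1)[OF A e(1) assms(3) e(2) assms(4) h]
      tangent_space_component[OF v e(1) assms(3) e(2) assms(4)]
    by (simp add: fun_deriv_def Let_def)
qed

lemma fun_deriv_compose:
  assumes f: "smooth_manifold_map A B f" and p: "p \<in> mcarrier A" and v: "v \<in> tangent_space A p"
    and "d \<in> B" "f p \<in> fst d" and h: "h \<circ> chart_inv d differentiable (at (snd d (f p)))"
  shows "fun_deriv A (\<lambda>q. h (f q)) p v = fun_deriv B h (f p) (tmap A B f p v)"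
proof -
  note c = chart_at[OF p]
  have "fun_deriv A (h \<circ> f) p v = frechet_derivative (h \<circ> chart_inv d) (at (snd d (f p))) (tmap A B
      f p v d)"
    unfolding fun_deriv_def Let_def tmap_component[OF f v c assms(4,5)]
    by (rule frechet_derivative_in_charts[OF f c(1) assms(4) c(2) assms(5) h])
  also have "\<dots> = fun_deriv B h (f p) (tmap A B f p v)"
    by (rule fun_deriv_in_chart[OF smooth_manifold_mapD(2)[OF f] tmap_in_tangent_space[OF f v p]
        assms(4,5) h, symmetric])
  finally show ?thesis by (simp add: comp_def)
qed

section \<open>Pull-back of differential forms\<close>

text \<open>Forms that need to be smooth near some points only. Connection forms with respect to local
  frames are of this kind.\<close>

definition smooth_form_on ::
  "('m, 'a::real_normed_vector) atlas \<Rightarrow> 'm set \<Rightarrow> nat \<Rightarrow> ('m, 'a,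
      'v::real_normed_vector) form \<Rightarrow> bool" where
  "smooth_form_on A N k \<alpha> \<longleftrightarrow>
     (\<forall>p\<in>N \<inter> mcarrier A. alt_multilinear (tangent_space A p) k (\<alpha> p)) \<and>
     (\<forall>c\<in>A. \<forall>us. length us = k \<longrightarrow> smooth_on (snd c ` (fst c \<inter> N)) (\<lambda>x. coord_rep A c \<alpha> x us))"

lemma diff_forms_smooth: "\<alpha> \<in> diff_forms A k \<Longrightarrow> smooth_form_on A UNIV k \<alpha>"
  by (simp add: diff_forms_def smooth_form_on_def)

lemma diff_forms_outside:
  "\<alpha> \<in> diff_forms A k \<Longrightarrow> \<not> (p \<in> mcarrier A \<and> length vs = k \<and> set vs \<subseteq> tangent_space A p) \<Longrightarrow> \<alpha> p vs = 0"
  unfolding diff_forms_def by blast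

lemma alt_multilinearD:
  assumes "alt_multilinear V k g" "length vs = k" "set vs \<subseteq> V"
  shows "i < k \<Longrightarrow> u \<in> V \<Longrightarrow> w \<in> V \<Longrightarrow>
      g (vs[i := tv_lin r u s w]) = r *\<^sub>R g (vs[i := u]) + s *\<^sub>R g (vs[i := w])"
    and "\<not> distinct vs \<Longrightarrow> g vs = 0"
  using assms unfolding alt_multilinear_def by blast+

lemma coord_rep_multilinear:
  fixes A :: "('m::{t2_space, second_countable_topology}, 'a::real_normed_vector) atlas"
    and \<alpha> :: "('m, 'a, 'v::real_normed_vector) form"
  assumes A: "smooth_manifold A" and \<alpha>: "smooth_form_on A N k \<alpha>" and c: "c \<in> A" and x: "x \<in> snd c `
      (fst c \<inter> N)"
  shows "list_multilinear k (coord_rep A c \<alpha> x)" "list_alternating k (coord_rep A c \<alpha> x)"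
proof -
  define p where "p = chart_inv c x"
  have p: "p \<in> fst c" "p \<in> N" using x chart_inverse(1)[OF A c] by (auto simp: p_def)
  have alt: "alt_multilinear (tangent_space A p) k (\<alpha> p)"
    using \<alpha> p chart_subset_mcarrier[OF c] by (auto simp: smooth_form_on_def)
  note T = coord_tvec_in_tangent_space[OF A c p(1)]
  show "list_multilinear k (coord_rep A c \<alpha> x)"
    unfolding list_multilinear_def
  proof (intro allI impI)
    fix vs :: "'a list" and i u w r s assume "length vs = k" "i < k"
    then have "\<alpha> p ((map (coord_tvec A c p) vs)[i := tv_lin r (coord_tvec A c p u) s (coord_tvec A c
        p w)]) =
        r *\<^sub>R \<alpha> p ((map (coord_tvec A c p) vs)[i := coord_tvec A c p u]) +
        s *\<^sub>R \<alpha> p ((map (coord_tvec A c p) vs)[i := coord_tvec A c p w])"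
      using T by (intro alt_multilinearD(1)[OF alt]) auto
    then show "coord_rep A c \<alpha> x (vs[i := r *\<^sub>R u + s *\<^sub>R w]) =
        r *\<^sub>R coord_rep A c \<alpha> x (vs[i := u]) + s *\<^sub>R coord_rep A c \<alpha> x (vs[i := w])"
      by (simp add: coord_rep_def p_def[symmetric] map_update coord_tvec_lin[OF A c p(1)])
  qed
  show "list_alternating k (coord_rep A c \<alpha> x)"
    unfolding list_alternating_def
  proof (intro allI impI)
    fix vs :: "'a list" assume "length vs = k" "\<not> distinct vs"
    then have "\<alpha> p (map (coord_tvec A c p) vs) = 0"
      using T by (intro alt_multilinearD(2)[OF alt]) (auto simp: distinct_map)
    then show "coord_rep A c \<alpha> x vs = 0"
      by (simp add: coord_rep_def p_def[symmetric])
  qed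
qed

lemma coord_rep_pullback:
  assumes f: "smooth_manifold_map A B f" and c: "c \<in> A" and d: "d \<in> B" and x: "x \<in> snd c ` (fst c \<inter>
      f -` fst d)"
  shows "coord_rep A c (pullback A B f \<alpha>) x us =
    coord_rep B d \<alpha> ((snd d \<circ> f \<circ> chart_inv c) x) (map (frechet_derivative (snd d \<circ> f \<circ> chart_inv c)
        (at x)) us)"
proof -
  note A = smooth_manifold_mapD(1)[OF f] and B = smooth_manifold_mapD(2)[OF f]
  obtain p where p: "p \<in> fst c" "f p \<in> fst d" "x = snd c p" using x by auto
  have "set (map (coord_tvec A c p) us) \<subseteq> tangent_space A p"
    by (auto intro: coord_tvec_in_tangent_space[OF A c p(1)])
  then show ?thesis
    using p(1,2) chart_subset_mcarrier[OF c p(1)]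
    by (simp add: p(3) coord_rep_def chart_inverse(1)[OF A c] chart_inverse(1)[OF B d] pullback_def
        tmap_coord_tvec[OF f c p(1) d p(2)] comp_def)
qed

lemma manifold_linear_coordinates:
  assumes "smooth_manifold (A :: ('m::{t2_space, second_countable_topology},
      'a::real_normed_vector) atlas)"
  obtains B :: "'a::real_normed_vector set" and c where "linear_coordinates B c"
  using assms linear_coordinates_exist[where 'a = 'a] unfolding smooth_manifold_def by blast

lemma map_upt_nth: "map (\<lambda>j. g (us ! j)) [0..<length us] = map g us"
  by (rule nth_equalityI) auto

text \<open>In charts, the pull-back evaluates the local representative at \<open>F x\<close> on the vectors
  \<open>DF u\<^sub>j\<close>, which is a multilinear function of smoothly varying arguments.\<close>

lemma pullback_smooth_form_on:
  fixes A :: "('m::{t2_space, second_countable_topology}, 'a::real_normed_vector) atlas"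
    and B :: "('n::{t2_space, second_countable_topology}, 'b::real_normed_vector) atlas"
    and \<alpha> :: "('n, 'b, 'v::real_normed_vector) form"
  assumes f: "smooth_manifold_map A B f" and N: "open N" and \<alpha>: "smooth_form_on B N k \<alpha>"
  shows "smooth_form_on A (f -` N) k (pullback A B f \<alpha>)"
proof -
  note A = smooth_manifold_mapD(1)[OF f] and B = smooth_manifold_mapD(2)[OF f]
  have 1: "alt_multilinear (tangent_space A p) k (pullback A B f \<alpha> p)" if "p \<in> f -` N \<inter> mcarrier A" for p
  proof -
    have p: "p \<in> mcarrier A" "f p \<in> N" using that by auto
    have alt: "alt_multilinear (tangent_space B (f p)) k (\<alpha> (f p))"
      using \<alpha> p smooth_manifold_mapD(4)[OF f] by (auto simp: smooth_form_on_def)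
    note T = tmap_in_tangent_space[OF f _ p(1)]
    show ?thesis
      unfolding alt_multilinear_def
    proof (intro conjI allI impI ballI)
      fix vs i u w r s
      assume vs: "length vs = k \<and> set vs \<subseteq> tangent_space A p \<and> i < k"
        and uw: "u \<in> tangent_space A p" "w \<in> tangent_space A p"
      have sub: "set (vs[i := v]) \<subseteq> tangent_space A p" if "v \<in> tangent_space A p" for v
        using vs that set_update_subset_insert[of vs i v] by auto
      have "\<alpha> (f p) ((map (tmap A B f p) vs)[i := tv_lin r (tmap A B f p u) s (tmap A B f p w)]) =
          r *\<^sub>R \<alpha> (f p) ((map (tmap A B f p) vs)[i := tmap A B f p u]) +
          s *\<^sub>R \<alpha> (f p) ((map (tmap A B f p) vs)[i := tmap A B f p w])"
        using T uw vs by (intro alt_multilinearD(1)[OF alt]) auto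
      then show "pullback A B f \<alpha> p (vs[i := tv_lin r u s w]) =
          r *\<^sub>R pullback A B f \<alpha> p (vs[i := u]) + s *\<^sub>R pullback A B f \<alpha> p (vs[i := w])"
        using sub[OF uw(1)] sub[OF uw(2)] sub[OF tangent_space_lin[OF A uw]] p
        by (simp add: pullback_def map_update tmap_lin[OF f p(1)])
    next
      fix vs
      assume vs: "length vs = k \<and> set vs \<subseteq> tangent_space A p \<and> \<not> distinct vs"
      then have "\<alpha> (f p) (map (tmap A B f p) vs) = 0"
        using T by (intro alt_multilinearD(2)[OF alt]) (auto simp: distinct_map)
      then show "pullback A B f \<alpha> p vs = 0" by (simp add: pullback_def)
    qed
  qed
  obtain Bb :: "'b set" and b where Bb: "linear_coordinates Bb b"
    by (rule manifold_linear_coordinates[OF B])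
  have 2: "smooth_on (snd c ` (fst c \<inter> f -` N)) (\<lambda>x. coord_rep A c (pullback A B f \<alpha>) x us)"
    if c: "c \<in> A" and us: "length us = k" for c us
  proof (rule smooth_on_local)
    fix x assume "x \<in> snd c ` (fst c \<inter> f -` N)"
    then obtain p where p: "p \<in> fst c" "f p \<in> N" "x = snd c p" by auto
    define d where "d = chart_at B (f p)"
    have d: "d \<in> B" "f p \<in> fst d"
      using chart_at[OF smooth_manifold_mapD(4)[OF f chart_subset_mcarrier[OF c p(1)]]]
          by (auto simp: d_def)
    define F where "F = snd d \<circ> f \<circ> chart_inv c"
    define S where "S = snd c ` (fst c \<inter> f -` (fst d \<inter> N))"
    have S: "open S" "x \<in> S"
      using p d chart_open(1)[OF B d(1)] N local_rep_smooth(2)[OF f c d(1), of "fst d \<inter> N"]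
          by (auto simp: S_def)
    have sub: "S \<subseteq> snd c ` (fst c \<inter> f -` fst d)" by (auto simp: S_def)
    have F: "smooth_on S F"
      unfolding F_def by (rule smooth_on_subset[OF local_rep_smooth(1)[OF f c d(1)] sub])
    have FS: "F ` S \<subseteq> snd d ` (fst d \<inter> N)"
      using chart_inverse(1)[OF A c] by (auto simp: F_def S_def)
    have "smooth_on S (\<lambda>x. coord_rep B d \<alpha> (F x)
        (map (\<lambda>j. frechet_derivative F (at x) (us ! j)) [0..<k]))"
    proof (rule smooth_on_multilinear[OF Bb Bb S(1) F FS])
      show "list_multilinear k (coord_rep B d \<alpha> y)" if "y \<in> snd d ` (fst d \<inter> N)" for y
        by (rule coord_rep_multilinear(1)[OF B \<alpha> d(1) that])
      show "smooth_on (snd d ` (fst d \<inter> N)) (\<lambda>y. coord_rep B d \<alpha> y ws)" if "length ws = k" for ws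
        using \<alpha> d(1) that by (auto simp: smooth_form_on_def)
      show "smooth_on S (\<lambda>x. frechet_derivative F (at x) (us ! j))" for j
        by (rule smooth_on_derivative[OF F])
    qed
    then have "smooth_on S (\<lambda>x. coord_rep A c (pullback A B f \<alpha>) x us)"
    proof (rule smooth_on_cong[OF _ S(1)])
      show "coord_rep B d \<alpha> (F x) (map (\<lambda>j. frechet_derivative F (at x) (us ! j)) [0..<k]) =
          coord_rep A c (pullback A B f \<alpha>) x us" if "x \<in> S" for x
        using that sub us map_upt_nth[of "frechet_derivative F (at x)" us]
        by (subst coord_rep_pullback[OF f c d(1)]) (auto simp: F_def)
    qed
    with S show "\<exists>T. open T \<and> x \<in> T \<and> smooth_on T (\<lambda>x. coord_rep A c (pullback A B f \<alpha>) x us)" by blast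
  qed
  from 1 2 show ?thesis by (simp add: smooth_form_on_def)
qed

lemma remove_nth_map: "remove_nth i (map g xs) = map g (remove_nth i xs)"
  by (simp add: remove_nth_def take_map drop_map)

lemma set_remove_nth_subset: "set (remove_nth i xs) \<subseteq> set xs"
  using set_take_subset[of i xs] set_drop_subset[of "Suc i" xs] by (auto simp: remove_nth_def)

text \<open>Both sides are read off in the charts that the definition of \<open>ext_d\<close> selects at \<open>p\<close> and at
  \<open>f p\<close>, so that the identity in coordinates applies to the local representative of \<open>f\<close> between
  them.\<close>

lemma ext_d_pullback:
  fixes A :: "('m::{t2_space, second_countable_topology}, 'a::real_normed_vector) atlas"
    and B :: "('n::{t2_space, second_countable_topology}, 'b::real_normed_vector) atlas"
    and \<alpha> :: "('n, 'b, 'v::real_normed_vector) form"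
  assumes f: "smooth_manifold_map A B f" and N: "open N" and \<alpha>: "smooth_form_on B N k \<alpha>"
    and p: "p \<in> mcarrier A" "f p \<in> N" and vs: "set vs \<subseteq> tangent_space A p" "length vs = Suc k"
  shows "ext_d A (pullback A B f \<alpha>) p vs = ext_d B \<alpha> (f p) (map (tmap A B f p) vs)"
proof -
  note A = smooth_manifold_mapD(1)[OF f] and B = smooth_manifold_mapD(2)[OF f]
  define c where "c = chart_at A p"
  define d where "d = chart_at B (f p)"
  note fp = smooth_manifold_mapD(4)[OF f p(1)]
  have c: "c \<in> A" "p \<in> fst c" using chart_at[OF p(1)] by (auto simp: c_def)
  have d: "d \<in> B" "f p \<in> fst d" using chart_at[OF fp] by (auto simp: d_def)
  define F where "F = snd d \<circ> f \<circ> chart_inv c"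
  have Fp: "F (snd c p) = snd d (f p)" by (simp add: F_def chart_inverse(1)[OF A c])
  define S where "S = snd c ` (fst c \<inter> f -` (fst d \<inter> N))"
  have S: "open S" "snd c p \<in> S"
    using p c d chart_open(1)[OF B d(1)] N local_rep_smooth(2)[OF f c(1) d(1), of "fst d \<inter> N"]
        by (auto simp: S_def)
  have sub: "S \<subseteq> snd c ` (fst c \<inter> f -` fst d)" by (auto simp: S_def)
  have F: "smooth_on S F"
    unfolding F_def by (rule smooth_on_subset[OF local_rep_smooth(1)[OF f c(1) d(1)] sub])
  define T where "T = snd d ` (fst d \<inter> N)"
  have T: "open T" "F (snd c p) \<in> T"
    using chart_image_open[OF B d(1), of N] chart_open(1)[OF B d(1)] N p d by (auto simp: T_def Fp)
  obtain Bb :: "'b set" and b where Bb: "linear_coordinates Bb b"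
    by (rule manifold_linear_coordinates[OF B])
  define us where "us = map (\<lambda>v. v c) vs"
  define D where "D = frechet_derivative F (at (snd c p))"
  have smooth: "smooth_on T (\<lambda>y. coord_rep B d \<alpha> y ws)" if "length ws = k" for ws
    using \<alpha> d(1) that by (auto simp: smooth_form_on_def T_def)
  have rep: "frechet_derivative (\<lambda>x. coord_rep A c (pullback A B f \<alpha>) x ws) (at (snd c p)) =
      frechet_derivative (\<lambda>x. coord_rep B d \<alpha> (F x) (map (frechet_derivative F (at x)) ws)) (at (snd
          c p))" for ws
    by (rule frechet_derivative_cong_open[OF S])
       (use sub in \<open>auto simp: F_def coord_rep_pullback[OF f c(1) d(1)]\<close>)
  have comp: "(tmap A B f p v) d = D (v c)" if "v \<in> set vs" for v
    using that vs(1) unfolding D_def F_def by (intro tmap_component[OF f _ c d]) auto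
  have maps: "map (\<lambda>v. v d) (remove_nth i (map (tmap A B f p) vs)) = map D (remove_nth i us)" for i
    using set_remove_nth_subset[of i vs] comp by (auto simp: remove_nth_map us_def)
  have nths: "(map (tmap A B f p) vs ! i) d = D (us ! i)" if "i \<in> {..<Suc k}" for i
    using that vs comp[of "vs ! i"] by (simp add: us_def)
  have "ext_d A (pullback A B f \<alpha>) p vs = (\<Sum>i<Suc k. (-1) ^ i *\<^sub>R frechet_derivative
        (\<lambda>x. coord_rep A c (pullback A B f \<alpha>) x (map (\<lambda>v. v c) (remove_nth i vs))) (at (snd c p))
            ((vs ! i) c))"
    using p(1) vs by (simp add: ext_d_def Let_def c_def[symmetric] del: sum.lessThan_Suc)
  also have "\<dots> = (\<Sum>i<Suc k. (-1) ^ i *\<^sub>R frechet_derivative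
        (\<lambda>x. coord_rep B d \<alpha> (F x) (map (frechet_derivative F (at x)) (remove_nth i us))) (at (snd c
            p)) (us ! i))"
    unfolding rep by (rule sum.cong[OF refl]) (use vs in \<open>simp add: us_def remove_nth_map\<close>)
  also have "\<dots> = (\<Sum>i<Suc k. (-1) ^ i *\<^sub>R frechet_derivative
        (\<lambda>y. coord_rep B d \<alpha> y (map D (remove_nth i us))) (at (F (snd c p))) (D (us ! i)))"
    unfolding D_def
  proof (rule ext_d_pullback_in_coordinates[OF Bb S F T])
    show "list_multilinear k (coord_rep B d \<alpha> y)" if "y \<in> T" for y
      by (rule coord_rep_multilinear(1)[OF B \<alpha> d(1) that[unfolded T_def]])
    show "list_alternating k (coord_rep B d \<alpha> (F (snd c p)))"
      by (rule coord_rep_multilinear(2)[OF B \<alpha> d(1) T(2)[unfolded T_def]])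
    show "(\<lambda>y. coord_rep B d \<alpha> y ws) differentiable (at (F (snd c p)))" if "length ws = k" for ws
      by (rule smooth_on_imp_differentiable[OF smooth[OF that] T(2)])
    show "length us = Suc k" using vs by (simp add: us_def)
  qed
  also have "\<dots> = (\<Sum>i<Suc k. (-1) ^ i *\<^sub>R frechet_derivative
        (\<lambda>y. coord_rep B d \<alpha> y (map (\<lambda>v. v d) (remove_nth i (map (tmap A B f p) vs)))) (at (snd d (f p)))
          ((map (tmap A B f p) vs ! i) d))"
    unfolding Fp maps by (rule sum.cong[OF refl]) (simp only: nths)
  also have "\<dots> = ext_d B \<alpha> (f p) (map (tmap A B f p) vs)"
    using fp vs tmap_in_tangent_space[OF f _ p(1)]
    by (auto simp: ext_d_def Let_def d_def[symmetric] simp del: sum.lessThan_Suc)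
  finally show ?thesis .
qed

lemma pullback_diff_forms:
  assumes f: "smooth_manifold_map A B f" and \<alpha>: "\<alpha> \<in> diff_forms B k"
  shows "pullback A B f \<alpha> \<in> diff_forms A k"
proof -
  have "smooth_form_on A UNIV k (pullback A B f \<alpha>)"
    using pullback_smooth_form_on[OF f open_UNIV diff_forms_smooth[OF \<alpha>]] by simp
  moreover have "pullback A B f \<alpha> p vs = 0"
    if "\<not> (p \<in> mcarrier A \<and> length vs = k \<and> set vs \<subseteq> tangent_space A p)" for p vs
    using that diff_forms_outside[OF \<alpha>, of "f p" "map (tmap A B f p) vs"] by (auto simp: pullback_def)
  ultimately show ?thesis
    by (simp add: diff_forms_def smooth_form_on_def)
qed

lemma ext_d_wrong_degree:
  assumes "\<And>p vs. length vs \<noteq> k \<Longrightarrow> \<alpha> p vs = 0" "length vs \<noteq> Suc k"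
  shows "ext_d A \<alpha> p vs = 0"
proof -
  have "coord_rep A c \<alpha> x (map (\<lambda>v. v c) (remove_nth i vs)) = 0" if "i < length vs" for c x i
    using assms that by (auto simp: coord_rep_def length_remove_nth)
  then show ?thesis by (simp add: ext_d_def Let_def)
qed

text \<open>Both sides vanish, by convention, on arguments that are not \<open>k + 1\<close> tangent vectors at a
  point of the manifold.\<close>

lemma pullback_ext_d:
  assumes f: "smooth_manifold_map A B f" and \<alpha>: "\<alpha> \<in> diff_forms B k"
  shows "pullback A B f (ext_d B \<alpha>) = ext_d A (pullback A B f \<alpha>)"
proof (intro ext)
  fix p vs
  show "pullback A B f (ext_d B \<alpha>) p vs = ext_d A (pullback A B f \<alpha>) p vs"
  proof (cases "p \<in> mcarrier A \<and> set vs \<subseteq> tangent_space A p")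
    case True
    show ?thesis
    proof (cases "length vs = Suc k")
      case len: True
      show ?thesis
        using True ext_d_pullback[OF f open_UNIV diff_forms_smooth[OF \<alpha>] _ _ _ len]
        by (simp add: pullback_def)
    next
      case False
      then show ?thesis
        using ext_d_wrong_degree[of k \<alpha> "map (tmap A B f p) vs" B "f p"]
          ext_d_wrong_degree[of k "pullback A B f \<alpha>" vs A p]
          diff_forms_outside[OF \<alpha>] diff_forms_outside[OF pullback_diff_forms[OF f \<alpha>]]
        by (auto simp: pullback_def)
    qed
  qed (auto simp: pullback_def ext_d_def)
qed

lemma pullback_pullback:
  assumes f: "smooth_manifold_map A B f" and g: "smooth_manifold_map B C g"
    and h: "\<And>p. p \<in> mcarrier A \<Longrightarrow> g (f p) = h p"
  shows "pullback A B f (pullback B C g \<alpha>) = pullback A C h \<alpha>"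
proof (intro ext)
  fix p vs
  show "pullback A B f (pullback B C g \<alpha>) p vs = pullback A C h \<alpha> p vs"
  proof (cases "p \<in> mcarrier A \<and> set vs \<subseteq> tangent_space A p")
    case True
    then have "map (tmap B C g (f p)) (map (tmap A B f p) vs) = map (tmap A C h p) vs"
      using tmap_cong[OF smooth_manifold_mapD(1)[OF f], of p "\<lambda>q. g (f q)" h C] h
      by (auto simp: tmap_compose[OF f g])
    moreover have "set (map (tmap A B f p) vs) \<subseteq> tangent_space B (f p)"
      using True tmap_in_tangent_space[OF f] by auto
    ultimately show ?thesis
      using True smooth_manifold_mapD(4)[OF f] h by (simp add: pullback_def del: map_map)
  qed (auto simp: pullback_def)
qed

section \<open>The relative de Rham complex\<close>

lemma zero_in_diff_forms: "0 \<in> diff_forms A k"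
  by (simp add: diff_forms_def alt_multilinear_def coord_rep_def)

lemma ext_d_zero [simp]: "ext_d A 0 = 0"
  by (simp add: ext_d_def coord_rep_def fun_eq_iff Let_def)

lemma pullback_zero [simp]: "pullback A B f 0 = 0"
  by (simp add: pullback_def fun_eq_iff)

lemma pullback_diff:
  fixes \<alpha> :: "('n, 'b::real_normed_vector, 'v::group_add) form"
  shows "pullback A B f (\<alpha> - \<beta>) = pullback A B f \<alpha> - pullback A B f \<beta>"
  by (auto simp: pullback_def fun_eq_iff)

lemma pullback_lin:
  fixes \<alpha> :: "('n, 'b::real_normed_vector, real) form"
  shows "pullback A B f (\<lambda>p vs. r * \<alpha> p vs + s * \<beta> p vs) =
    (\<lambda>p vs. r * pullback A B f \<alpha> p vs + s * pullback A B f \<beta> p vs)"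
  by (auto simp: pullback_def fun_eq_iff)

lemma diff_forms_lin:
  fixes \<alpha> :: "('m::{t2_space, second_countable_topology}, 'a::real_normed_vector, real) form"
  assumes A: "smooth_manifold A" and "\<alpha> \<in> diff_forms A k" "\<beta> \<in> diff_forms A k"
  shows "(\<lambda>p vs. r * \<alpha> p vs + s * \<beta> p vs) \<in> diff_forms A k"
proof -
  have "smooth_on (snd c ` fst c) (\<lambda>x. coord_rep A c (\<lambda>p vs. r * \<alpha> p vs + s * \<beta> p vs) x us)"
    if "c \<in> A" "length us = k" for c us
  proof -
    have "smooth_on (snd c ` fst c) (\<lambda>x. r * coord_rep A c \<alpha> x us + s * coord_rep A c \<beta> x us)"
      using assms that by (intro smooth_on_add smooth_on_mult smooth_on_const chart_open(2)) (auto
          simp: diff_forms_def)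
    then show ?thesis by (simp add: coord_rep_def)
  qed
  moreover have "alt_multilinear (tangent_space A p) k (\<lambda>vs. r * \<alpha> p vs + s * \<beta> p vs)"
      if "p \<in> mcarrier A" for p
  proof -
    have "alt_multilinear (tangent_space A p) k (\<alpha> p)" "alt_multilinear (tangent_space A p) k (\<beta> p)"
      using assms(2,3) that by (auto simp: diff_forms_def)
    then show ?thesis by (simp add: alt_multilinear_def algebra_simps)
  qed
  ultimately show ?thesis
    using diff_forms_outside[OF assms(2)] diff_forms_outside[OF assms(3)]
    by (simp add: diff_forms_def)
qed

lemma diff_forms_coord_rep_differentiable:
  assumes "\<alpha> \<in> diff_forms A k" "c \<in> A" "p \<in> fst c"
  shows "(\<lambda>x. coord_rep A c \<alpha> x us) differentiable (at (snd c p))"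
proof (cases "length us = k")
  case True
  then have "smooth_on (snd c ` fst c) (\<lambda>x. coord_rep A c \<alpha> x us)"
    using assms by (auto simp: diff_forms_def)
  then show ?thesis using assms(3) by (intro smooth_on_imp_differentiable) auto
next
  case False
  then have "(\<lambda>x. coord_rep A c \<alpha> x us) = (\<lambda>x. 0)"
    using diff_forms_outside[OF assms(1)] by (auto simp: coord_rep_def fun_eq_iff)
  then show ?thesis by simp
qed

lemma ext_d_lin:
  fixes \<alpha> :: "('m, 'a::real_normed_vector, real) form"
  assumes "\<alpha> \<in> diff_forms A k" "\<beta> \<in> diff_forms A k"
  shows "ext_d A (\<lambda>p vs. r * \<alpha> p vs + s * \<beta> p vs) = (\<lambda>p vs. r * ext_d A \<alpha> p vs + s * ext_d A \<beta> p vs)"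
proof (intro ext)
  fix p vs
  show "ext_d A (\<lambda>p vs. r * \<alpha> p vs + s * \<beta> p vs) p vs = r * ext_d A \<alpha> p vs + s * ext_d A \<beta> p vs"
  proof (cases "p \<in> mcarrier A \<and> set vs \<subseteq> tangent_space A p")
    case True
    then have c: "chart_at A p \<in> A" "p \<in> fst (chart_at A p)" by (auto intro: chart_at)
    have "frechet_derivative (\<lambda>x. coord_rep A (chart_at A p) (\<lambda>p vs. r * \<alpha> p vs + s * \<beta> p vs) x us)
          (at (snd (chart_at A p) p)) =
        (\<lambda>u. r * frechet_derivative (\<lambda>x. coord_rep A (chart_at A p) \<alpha> x us) (at (snd (chart_at A p) p)) u
           + s * frechet_derivative (\<lambda>x. coord_rep A (chart_at A p) \<beta> x us) (at (snd (chart_at A p)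
               p)) u)" for us
    proof -
      have "((\<lambda>x. r * coord_rep A (chart_at A p) \<alpha> x us +
          s * coord_rep A (chart_at A p) \<beta> x us) has_derivative
        (\<lambda>u. r * frechet_derivative (\<lambda>x. coord_rep A (chart_at A p) \<alpha> x us) (at (snd (chart_at A p) p)) u
           + s * frechet_derivative (\<lambda>x. coord_rep A (chart_at A p) \<beta> x us) (at (snd (chart_at A p)
               p)) u))
        (at (snd (chart_at A p) p))"
        by (intro has_derivative_add has_derivative_mult_right has_derivative_frechet
            diff_forms_coord_rep_differentiable[OF assms(1) c]
                diff_forms_coord_rep_differentiable[OF assms(2) c])
      from frechet_derivative_at[OF this] show ?thesis by (simp add: coord_rep_def)
    qed
    then show ?thesis
      using True by (simp add: ext_d_def Let_def sum_distrib_left sum.distrib algebra_simps)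
  qed (auto simp: ext_d_def)
qed

text \<open>For \<open>k = 0\<close> the second component is \<open>0\<close>, which is a form of every degree.\<close>

lemma rel_forms_components:
  assumes "\<Psi> \<in> rel_forms F k"
  shows "fst \<Psi> \<in> diff_forms (tgt F) k" "snd \<Psi> \<in> diff_forms (src F) (k - 1)"
  using assms by (auto simp: rel_forms_def zero_in_diff_forms split: if_splits)

lemma smooth_arrowD:
  assumes "smooth_arrow F"
  shows "smooth_manifold (src F)" "smooth_manifold (tgt F)" "smooth_manifold_map (src F) (tgt F)
      (amap F)"
  using assms by (auto simp: smooth_arrow_def smooth_manifold_map_def)

lemma rel_forms_lin:
  assumes "smooth_arrow F" "\<Psi> \<in> rel_forms F k" "\<Theta> \<in> rel_forms F k"
  shows "rel_lin r \<Psi> s \<Theta> \<in> rel_forms F k"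
proof (cases "k = 0")
  case True
  then show ?thesis
    using assms diff_forms_lin[OF smooth_arrowD(2)[OF assms(1)]]
    by (auto simp: rel_forms_def rel_lin_def fun_eq_iff)
next
  case False
  then show ?thesis
    using assms diff_forms_lin[OF smooth_arrowD(2)[OF assms(1)]]
        diff_forms_lin[OF smooth_arrowD(1)[OF assms(1)]]
    by (auto simp: rel_forms_def rel_lin_def)
qed

lemma rel_d_lin:
  assumes "\<Psi> \<in> rel_forms F k" "\<Theta> \<in> rel_forms F k"
  shows "rel_d F (rel_lin r \<Psi> s \<Theta>) = rel_lin r (rel_d F \<Psi>) s (rel_d F \<Theta>)"
  using ext_d_lin[OF rel_forms_components(1)[OF assms(1)] rel_forms_components(1)[OF assms(2)], of r s]
    ext_d_lin[OF rel_forms_components(2)[OF assms(1)] rel_forms_components(2)[OF assms(2)], of r s]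
  by (simp add: rel_d_def rel_lin_def pullback_lin fun_eq_iff algebra_simps)

lemma rel_zero: "0 \<in> rel_forms F k" "rel_d F 0 = 0" "rel_lin r 0 s 0 = 0"
  by (auto simp: rel_forms_def zero_in_diff_forms rel_d_def rel_lin_def zero_prod_def fun_eq_iff)

lemma rel_closed_lin:
  assumes "smooth_arrow F" "\<Psi> \<in> rel_closed F k" "\<Theta> \<in> rel_closed F k"
  shows "rel_lin r \<Psi> s \<Theta> \<in> rel_closed F k"
  using assms rel_forms_lin[OF assms(1)] by (auto simp: rel_closed_def rel_d_lin rel_zero)

lemma rel_exact_lin:
  assumes "smooth_arrow F" "\<Psi> \<in> rel_exact F k" "\<Theta> \<in> rel_exact F k"
  shows "rel_lin r \<Psi> s \<Theta> \<in> rel_exact F k"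
proof (cases "k = 0")
  case True
  then show ?thesis using assms by (simp add: rel_exact_def rel_zero)
next
  case False
  then obtain \<Psi>' \<Theta>' where "\<Psi>' \<in> rel_forms F (k - 1)" "\<Theta>' \<in> rel_forms F (k - 1)"
    "\<Psi> = rel_d F \<Psi>'" "\<Theta> = rel_d F \<Theta>'"
    using assms by (auto simp: rel_exact_def)
  then show ?thesis
    using False rel_d_lin[of \<Psi>' F "k - 1" \<Theta>' r s] rel_forms_lin[OF assms(1), of \<Psi>' "k - 1" \<Theta>' r s]
    by (auto simp: rel_exact_def intro: image_eqI[where x = "rel_lin r \<Psi>' s \<Theta>'"])
qed

lemma rel_class_refl: "\<Psi> \<in> rel_closed F k \<Longrightarrow> \<Psi> \<in> rel_class F k \<Psi>"
  by (auto simp: rel_class_def rel_exact_def rel_zero intro: image_eqI[where x = 0])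

lemma rel_class_eq:
  assumes F: "smooth_arrow F" and "\<Psi>' \<in> rel_class F k \<Psi>"
  shows "rel_class F k \<Psi>' = rel_class F k \<Psi>"
proof -
  have d: "\<Psi>' - \<Psi> \<in> rel_exact F k" using assms by (simp add: rel_class_def)
  have "\<Theta> - \<Psi> = rel_lin 1 (\<Theta> - \<Psi>') 1 (\<Psi>' - \<Psi>)" "\<Theta> - \<Psi>' = rel_lin 1 (\<Theta> - \<Psi>) (-1) (\<Psi>' - \<Psi>)" for \<Theta>
    by (simp_all add: rel_lin_def prod_eq_iff fun_eq_iff)
  then have "\<Theta> - \<Psi> \<in> rel_exact F k \<longleftrightarrow> \<Theta> - \<Psi>' \<in> rel_exact F k" for \<Theta>
    using rel_exact_lin[OF F _ d] by metis
  then show ?thesis by (simp add: rel_class_def)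
qed

lemma class_lin_rel_class:
  assumes F: "smooth_arrow F" and "\<Psi> \<in> rel_closed F k" "\<Theta> \<in> rel_closed F k"
  shows "class_lin F k r (rel_class F k \<Psi>) s (rel_class F k \<Theta>) = rel_class F k (rel_lin r \<Psi> s \<Theta>)"
proof -
  have "rel_class F k (rel_lin r \<Psi>' s \<Theta>') = rel_class F k (rel_lin r \<Psi> s \<Theta>)"
    if "\<Psi>' \<in> rel_class F k \<Psi>" "\<Theta>' \<in> rel_class F k \<Theta>" for \<Psi>' \<Theta>'
  proof (rule rel_class_eq[OF F])
    have "rel_lin r \<Psi>' s \<Theta>' - rel_lin r \<Psi> s \<Theta> = rel_lin r (\<Psi>' - \<Psi>) s (\<Theta>' - \<Theta>)"
      by (simp add: rel_lin_def prod_eq_iff fun_eq_iff algebra_simps)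
    then show "rel_lin r \<Psi>' s \<Theta>' \<in> rel_class F k (rel_lin r \<Psi> s \<Theta>)"
      using that rel_closed_lin[OF F] rel_exact_lin[OF F] by (auto simp: rel_class_def)
  qed
  then show ?thesis
    using rel_class_refl[OF assms(2)] rel_class_refl[OF assms(3)] unfolding class_lin_def by blast
qed

section \<open>Pull-back along a morphism of arrows\<close>

lemma arrow_morphismD:
  assumes "smooth_arrow F" "smooth_arrow F'" "arrow_morphism F F' \<phi> \<psi>"
  shows "smooth_manifold_map (src F) (src F') \<phi>" "smooth_manifold_map (tgt F) (tgt F') \<psi>"
    and "p \<in> mcarrier (src F) \<Longrightarrow> amap F' (\<phi> p) = \<psi> (amap F p)"
  using assms by (auto simp: smooth_arrow_def arrow_morphism_def smooth_manifold_map_def)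

lemma rel_pullback_lin:
  "rel_pullback F F' \<phi> \<psi> (rel_lin r \<Psi> s \<Theta>) =
    rel_lin r (rel_pullback F F' \<phi> \<psi> \<Psi>) s (rel_pullback F F' \<phi> \<psi> \<Theta>)"
  by (simp add: rel_pullback_def rel_lin_def pullback_lin)

lemma rel_pullback_zero [simp]: "rel_pullback F F' \<phi> \<psi> 0 = 0"
  by (simp add: rel_pullback_def zero_prod_def)

lemma rel_pullback_diff:
  "rel_pullback F F' \<phi> \<psi> (\<Psi> - \<Theta>) = rel_pullback F F' \<phi> \<psi> \<Psi> - rel_pullback F F' \<phi> \<psi> \<Theta>"
  by (simp add: rel_pullback_def pullback_diff)

context
  fixes F :: "('m::{t2_space, second_countable_topology}, 'a::real_normed_vector,
               'n::{t2_space, second_countable_topology}, 'b::real_normed_vector) arrow"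
    and F' :: "('m'::{t2_space, second_countable_topology}, 'a'::real_normed_vector,
                'n'::{t2_space, second_countable_topology}, 'b'::real_normed_vector) arrow"
    and \<phi> :: "'m \<Rightarrow> 'm'" and \<psi> :: "'n \<Rightarrow> 'n'"
  assumes F: "smooth_arrow F" and F': "smooth_arrow F'"
    and \<Phi>: "arrow_morphism F F' \<phi> \<psi>"
begin

lemma rel_pullback_forms:
  assumes "\<Psi> \<in> rel_forms F' k"
  shows "rel_pullback F F' \<phi> \<psi> \<Psi> \<in> rel_forms F k"
  using assms pullback_diff_forms[OF arrow_morphismD(1)[OF F F' \<Phi>], of "snd \<Psi>" "k - 1"]
    pullback_diff_forms[OF arrow_morphismD(2)[OF F F' \<Phi>], of "fst \<Psi>" k]
  by (auto simp: rel_forms_def rel_pullback_def split: if_splits)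

text \<open>On the second component this uses \<open>\<phi>\<^sup>* F'\<^sup>* = F\<^sup>* \<psi>\<^sup>*\<close>, which is the commutativity of the
  square.\<close>

lemma rel_pullback_d:
  assumes "\<Psi> \<in> rel_forms F' k"
  shows "rel_pullback F F' \<phi> \<psi> (rel_d F' \<Psi>) = rel_d F (rel_pullback F F' \<phi> \<psi> \<Psi>)"
proof -
  note \<phi> = arrow_morphismD(1)[OF F F' \<Phi>] and \<psi> = arrow_morphismD(2)[OF F F' \<Phi>]
  have "pullback (src F) (src F') \<phi> (pullback (src F') (tgt F') (amap F') (fst \<Psi>)) =
      pullback (src F) (tgt F) (amap F) (pullback (tgt F) (tgt F') \<psi> (fst \<Psi>))"
    using pullback_pullback[OF \<phi> smooth_arrowD(3)[OF F'] arrow_morphismD(3)[OF F F' \<Phi>], of "fst \<Psi>"]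
      pullback_pullback[OF smooth_arrowD(3)[OF F] \<psi> refl, of "fst \<Psi>"]
    by simp
  then show ?thesis
    using pullback_ext_d[OF \<psi> rel_forms_components(1)[OF assms]]
        pullback_ext_d[OF \<phi> rel_forms_components(2)[OF assms]]
    by (simp add: rel_pullback_def rel_d_def pullback_diff)
qed

lemma rel_pullback_closed:
  assumes "\<Psi> \<in> rel_closed F' k"
  shows "rel_pullback F F' \<phi> \<psi> \<Psi> \<in> rel_closed F k"
  using assms rel_pullback_forms rel_pullback_d[of \<Psi> k] by (auto simp: rel_closed_def)

lemma rel_pullback_exact:
  assumes "\<Psi> \<in> rel_exact F' k"
  shows "rel_pullback F F' \<phi> \<psi> \<Psi> \<in> rel_exact F k"
  using assms rel_pullback_forms rel_pullback_d by (auto simp: rel_exact_def split: if_splits)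

lemma rel_pullback_class:
  assumes "\<Psi> \<in> rel_closed F' k" "\<Psi>' \<in> rel_class F' k \<Psi>"
  shows "rel_class F k (rel_pullback F F' \<phi> \<psi> \<Psi>') = rel_class F k (rel_pullback F F' \<phi> \<psi> \<Psi>)"
proof (rule rel_class_eq[OF F])
  show "rel_pullback F F' \<phi> \<psi> \<Psi>' \<in> rel_class F k (rel_pullback F F' \<phi> \<psi> \<Psi>)"
    using assms rel_pullback_closed rel_pullback_exact[of "\<Psi>' - \<Psi>" k]
    by (auto simp: rel_class_def rel_pullback_diff)
qed

lemma rel_pullback_cohomology:
  "\<exists>h. h \<in> rel_cohomology F' k \<rightarrow> rel_cohomology F k \<and>
     (\<forall>\<Psi>\<in>rel_closed F' k. h (rel_class F' k \<Psi>) = rel_class F k (rel_pullback F F' \<phi> \<psi> \<Psi>)) \<and>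
     (\<forall>X\<in>rel_cohomology F' k. \<forall>Y\<in>rel_cohomology F' k. \<forall>r s.
        h (class_lin F' k r X s Y) = class_lin F k r (h X) s (h Y))"
proof -
  \<comment> \<open>All members of a class have pull-backs in the same class, so that the union below is that
      class.\<close>
  define h where "h X = (\<Union>\<Psi>\<in>X. rel_class F k (rel_pullback F F' \<phi> \<psi> \<Psi>))" for X
  have h: "h (rel_class F' k \<Psi>) = rel_class F k (rel_pullback F F' \<phi> \<psi> \<Psi>)" if "\<Psi> \<in> rel_closed F' k" for \<Psi>
    using rel_pullback_class[OF that] rel_class_refl[OF that] unfolding h_def by blast
  have "h (class_lin F' k r (rel_class F' k \<Psi>) s (rel_class F' k \<Theta>)) =
      class_lin F k r (h (rel_class F' k \<Psi>)) s (h (rel_class F' k \<Theta>))"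
    if "\<Psi> \<in> rel_closed F' k" "\<Theta> \<in> rel_closed F' k" for \<Psi> \<Theta> r s
    using that by (simp add: h class_lin_rel_class F F' rel_closed_lin rel_pullback_closed
        rel_pullback_lin)
  moreover have "h \<in> rel_cohomology F' k \<rightarrow> rel_cohomology F k"
    using h rel_pullback_closed by (auto simp: rel_cohomology_def)
  ultimately show ?thesis
    using h by (intro exI[of _ h]) (auto simp: rel_cohomology_def)
qed

end

section \<open>Smooth singular chains\<close>

lemma Ck_partial_subset: "Ck_partial p n W f \<Longrightarrow> V \<subseteq> W \<Longrightarrow> Ck_partial p n V f"
proof (induction n arbitrary: f)
  case 0
  then show ?case by (auto intro: continuous_on_subset)
next
  case (Suc n)
  then show ?case
    by (simp, meson continuous_on_subset subsetD)
qed

lemma Ck_partial_continuous: "Ck_partial p n W f \<Longrightarrow> continuous_on W f"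
  by (cases n) auto

lemma Ck_partial_Suc_imp: "Ck_partial p (Suc n) W f \<Longrightarrow> Ck_partial p n W f"
proof (induction n arbitrary: f)
  case (Suc n)
  then show ?case by (metis Ck_partial.simps(2))
qed auto

lemma Ck_partial_SucI:
  assumes "continuous_on W f"
    and "\<And>i x. i \<le> p \<Longrightarrow> x \<in> W \<Longrightarrow> ((\<lambda>s. f (x(i := s))) has_vector_derivative g i x) (at (x i))"
    and "\<And>i. i \<le> p \<Longrightarrow> Ck_partial p n W (g i)"
  shows "Ck_partial p (Suc n) W f"
  unfolding Ck_partial.simps using assms by blast

lemma Ck_partial_SucE:
  assumes "Ck_partial p (Suc n) W f"
  obtains g where "\<And>i x. i \<le> p \<Longrightarrow> x \<in> W \<Longrightarrow> ((\<lambda>s. f (x(i := s))) has_vector_derivative g i x) (at (x i))"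
    and "\<And>i. i \<le> p \<Longrightarrow> Ck_partial p n W (g i)"
proof -
  have "\<forall>i. \<exists>g. i \<le> p \<longrightarrow> (\<forall>x\<in>W. ((\<lambda>s. f (x(i := s))) has_vector_derivative g x) (at (x i))) \<and>
      Ck_partial p n W g"
    using assms unfolding Ck_partial.simps by blast
  from choice[OF this] show ?thesis using that by blast
qed

lemma Ck_on_continuous: "Ck_on n S f \<Longrightarrow> continuous_on S f"
proof (induction n)
  case (Suc n)
  then show ?case using Ck_on_Suc_imp by blast
qed simp

lemma open_coordinate_line:
  fixes W :: "('i \<Rightarrow> 'a::topological_space) set"
  assumes "open W"
  shows "open {s. x(i := s) \<in> W}"
proof -
  have "continuous_on UNIV (\<lambda>s. x(i := s))"
  proof (rule continuous_on_coordinatewise_then_product)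
    show "continuous_on UNIV (\<lambda>s. (x(i := s)) k)" for k
      by (cases "k = i") (auto intro!: continuous_intros)
  qed
  then have "open ((\<lambda>s. x(i := s)) -` W)" using assms by (intro open_vimage) auto
  then show ?thesis by (simp add: vimage_def)
qed

lemma Ck_partial_cong:
  assumes "open W" "\<And>x. x \<in> W \<Longrightarrow> f x = g x" "Ck_partial p n W f"
  shows "Ck_partial p n W g"
proof (cases n)
  case 0
  then show ?thesis using assms by (simp cong: continuous_on_cong)
next
  case (Suc m)
  from Ck_partial_SucE[OF assms(3)[unfolded Suc]] obtain f' where
    f': "\<And>i x. i \<le> p \<Longrightarrow> x \<in> W \<Longrightarrow> ((\<lambda>s. f (x(i := s))) has_vector_derivative f' i x) (at (x i))"
    "\<And>i. i \<le> p \<Longrightarrow> Ck_partial p m W (f' i)" by blast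
  have d: "((\<lambda>s. g (x(i := s))) has_vector_derivative f' i x) (at (x i))" if "i \<le> p" "x \<in> W" for i x
    by (rule has_vector_derivative_transform_within_open[OF f'(1)[OF that]
        open_coordinate_line[OF assms(1)]])
       (use that assms(2) in auto)
  have c: "continuous_on W g"
    using Ck_partial_continuous[OF assms(3)] assms(2) by (simp cong: continuous_on_cong)
  show ?thesis unfolding Suc by (rule Ck_partial_SucI[OF c d f'(2)])
qed

text \<open>The definition only asks for some partial derivative on each piece. Since partial
  derivatives are unique on open sets, the pieces fit together to the one given by
  \<open>vector_derivative\<close>.\<close>

lemma Ck_partial_local:
  assumes "\<And>x. x \<in> W \<Longrightarrow> \<exists>V. open V \<and> x \<in> V \<and> Ck_partial p n V f"
  shows "Ck_partial p n W f"
  using assms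
proof (induction n arbitrary: f)
  case 0
  have "continuous (at x) f" if "x \<in> W" for x
    using 0[OF that] by (auto simp: continuous_on_eq_continuous_at)
  then show ?case by (auto intro: continuous_at_imp_continuous_on)
next
  case (Suc n)
  have "continuous (at x) f" if x: "x \<in> W" for x
    using Suc.prems[OF x] by (auto simp: continuous_on_eq_continuous_at)
  then have "continuous_on W f" by (auto intro: continuous_at_imp_continuous_on)
  moreover have "\<exists>g. (\<forall>x\<in>W. ((\<lambda>s. f (x(i := s))) has_vector_derivative g x) (at (x i))) \<and>
      Ck_partial p n W g"
    if i: "i \<le> p" for i
  proof -
    define G where "G x = vector_derivative (\<lambda>s. f (x(i := s))) (at (x i))" for x
    have G: "\<exists>V. open V \<and> x \<in> V \<and> Ck_partial p n V G \<and>
        ((\<lambda>s. f (x(i := s))) has_vector_derivative G x) (at (x i))" if x: "x \<in> W" for x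
    proof -
      obtain V where V: "open V" "x \<in> V" "Ck_partial p (Suc n) V f" using Suc.prems[OF x] by blast
      from Ck_partial_SucE[OF V(3)] i obtain g
        where g: "\<And>y. y \<in> V \<Longrightarrow> ((\<lambda>s. f (y(i := s))) has_vector_derivative g y) (at (y i))"
          "Ck_partial p n V g" by metis
      have "g y = G y" if "y \<in> V" for y
        unfolding G_def using vector_derivative_at[OF g(1)[OF that]] by simp
      then have "Ck_partial p n V G" "((\<lambda>s. f (x(i := s))) has_vector_derivative G x) (at (x i))"
        using Ck_partial_cong[OF V(1) _ g(2), of G] g(1)[OF V(2)] V(2) by auto
      with V show ?thesis by blast
    qed
    have "Ck_partial p n W G"
      by (rule Suc.IH) (use G in blast)
    with G show ?thesis by blast
  qed
  ultimately show ?case by simp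
qed

lemma Ck_partial_bounded_linear:
  assumes L: "bounded_linear L" and "Ck_partial p n W f"
  shows "Ck_partial p n W (\<lambda>x. L (f x))"
  using assms(2)
proof (induction n arbitrary: f)
  case 0
  then show ?case using L by (simp add: bounded_linear.continuous_on)
next
  case (Suc n)
  from Ck_partial_SucE[OF Suc.prems] obtain g where
    g: "\<And>i x. i \<le> p \<Longrightarrow> x \<in> W \<Longrightarrow> ((\<lambda>s. f (x(i := s))) has_vector_derivative g i x) (at (x i))"
    "\<And>i. i \<le> p \<Longrightarrow> Ck_partial p n W (g i)" by blast
  have c: "continuous_on W (\<lambda>x. L (f x))"
    using Ck_partial_continuous[OF Suc.prems] L by (simp add: bounded_linear.continuous_on)
  show ?case
    by (rule Ck_partial_SucI[OF c bounded_linear.has_vector_derivative[OF L g(1)] Suc.IH[OF g(2)]])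
qed

lemma Ck_partial_add:
  assumes "Ck_partial p n W f" "Ck_partial p n W g"
  shows "Ck_partial p n W (\<lambda>x. f x + g x)"
  using assms
proof (induction n arbitrary: f g)
  case 0
  then show ?case by (simp add: continuous_on_add)
next
  case (Suc n)
  from Ck_partial_SucE[OF Suc.prems(1)] obtain f' where
    f': "\<And>i x. i \<le> p \<Longrightarrow> x \<in> W \<Longrightarrow> ((\<lambda>s. f (x(i := s))) has_vector_derivative f' i x) (at (x i))"
    "\<And>i. i \<le> p \<Longrightarrow> Ck_partial p n W (f' i)" by blast
  from Ck_partial_SucE[OF Suc.prems(2)] obtain g' where
    g': "\<And>i x. i \<le> p \<Longrightarrow> x \<in> W \<Longrightarrow> ((\<lambda>s. g (x(i := s))) has_vector_derivative g' i x) (at (x i))"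
    "\<And>i. i \<le> p \<Longrightarrow> Ck_partial p n W (g' i)" by blast
  have c: "continuous_on W (\<lambda>x. f x + g x)"
    using Ck_partial_continuous[OF Suc.prems(1)] Ck_partial_continuous[OF Suc.prems(2)]
        by (rule continuous_on_add)
  show ?case
    by (rule Ck_partial_SucI[OF c has_vector_derivative_add[OF f'(1) g'(1)] Suc.IH[OF f'(2) g'(2)]])
qed

lemma Ck_partial_zero: "Ck_partial p n W (\<lambda>x. 0)"
  by (induction n) (auto intro!: exI[of _ "\<lambda>x. 0"])

lemma Ck_partial_sum:
  "(\<And>i. i \<in> I \<Longrightarrow> Ck_partial p n W (f i)) \<Longrightarrow> Ck_partial p n W (\<lambda>x. \<Sum>i\<in>I. f i x)"
  by (induction I rule: infinite_finite_induct) (auto intro: Ck_partial_add Ck_partial_zero)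

lemma Ck_partial_scaleR:
  assumes "Ck_partial p n W f" "Ck_partial p n W g"
  shows "Ck_partial p n W (\<lambda>x. f x *\<^sub>R g x)"
  using assms
proof (induction n arbitrary: f g)
  case 0
  then show ?case by (simp add: continuous_on_scaleR)
next
  case (Suc n)
  from Ck_partial_SucE[OF Suc.prems(1)] obtain f' where
    f': "\<And>i x. i \<le> p \<Longrightarrow> x \<in> W \<Longrightarrow> ((\<lambda>s. f (x(i := s))) has_vector_derivative f' i x) (at (x i))"
    "\<And>i. i \<le> p \<Longrightarrow> Ck_partial p n W (f' i)" by blast
  from Ck_partial_SucE[OF Suc.prems(2)] obtain g' where
    g': "\<And>i x. i \<le> p \<Longrightarrow> x \<in> W \<Longrightarrow> ((\<lambda>s. g (x(i := s))) has_vector_derivative g' i x) (at (x i))"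
    "\<And>i. i \<le> p \<Longrightarrow> Ck_partial p n W (g' i)" by blast
  have c: "continuous_on W (\<lambda>x. f x *\<^sub>R g x)"
    using Ck_partial_continuous[OF Suc.prems(1)] Ck_partial_continuous[OF Suc.prems(2)]
        by (rule continuous_on_scaleR)
  have d: "((\<lambda>s. f (x(i := s)) *\<^sub>R g (x(i := s))) has_vector_derivative f x *\<^sub>R g' i x +
      f' i x *\<^sub>R g x) (at (x i))"
    if "i \<le> p" "x \<in> W" for i x
    using bounded_bilinear.has_vector_derivative[OF bounded_bilinear_scaleR f'(1)[OF that]
        g'(1)[OF that]] by simp
  have e: "Ck_partial p n W (\<lambda>x. f x *\<^sub>R g' i x + f' i x *\<^sub>R g x)" if "i \<le> p" for i
    using that by (intro Ck_partial_add Suc.IH f'(2) g'(2) Ck_partial_Suc_imp[OF Suc.prems(1)]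
        Ck_partial_Suc_imp[OF Suc.prems(2)])
  show ?case by (rule Ck_partial_SucI[OF c d e])
qed

text \<open>As for \<open>Ck_on_compose\<close>, the varying direction in the chain rule is expanded in a basis.\<close>

lemma Ck_partial_compose:
  fixes f :: "(nat \<Rightarrow> real) \<Rightarrow> 'b::real_normed_vector" and B :: "'b set"
  assumes B: "linear_coordinates B c" and "f ` W \<subseteq> T" "Ck_partial p n W f" "Ck_on n T g"
  shows "Ck_partial p n W (\<lambda>x. g (f x))"
  using assms(3,4)
proof (induction n arbitrary: g)
  case 0
  then show ?case using assms(2) by (auto intro: continuous_on_compose2)
next
  case (Suc n)
  from Ck_partial_SucE[OF Suc.prems(1)] obtain f' where
    f': "\<And>i x. i \<le> p \<Longrightarrow> x \<in> W \<Longrightarrow> ((\<lambda>s. f (x(i := s))) has_vector_derivative f' i x) (at (x i))"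
    "\<And>i. i \<le> p \<Longrightarrow> Ck_partial p n W (f' i)" by blast
  have fx: "f x \<in> T" if "x \<in> W" for x using that assms(2) by auto
  have cont: "continuous_on W (\<lambda>x. g (f x))"
    using Ck_partial_continuous[OF Suc.prems(1)] Ck_on_continuous[OF Suc.prems(2)] assms(2)
    by (auto intro: continuous_on_compose2)
  have d: "((\<lambda>s. g (f (x(i := s)))) has_vector_derivative
      (\<Sum>b\<in>B. c b (f' i x) *\<^sub>R frechet_derivative g (at (f x)) b)) (at (x i))" if "i \<le> p" "x \<in> W" for i x
  proof -
    note D = Ck_on_SucD(1)[OF Suc.prems(2) fx[OF that(2)]]
    have D': "(g has_derivative frechet_derivative g (at (f x))) (at (f (x(i := x i))))"
      using D by simp
    have "((\<lambda>s. g (f (x(i := s)))) has_derivative (\<lambda>h. frechet_derivative g (at (f x)) (h *\<^sub>R f' i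
        x))) (at (x i))"
      by (rule has_derivative_compose[OF f'(1)[OF that, unfolded has_vector_derivative_def] D'])
    also have "(\<lambda>h. frechet_derivative g (at (f x)) (h *\<^sub>R f' i x)) =
        (\<lambda>h. h *\<^sub>R (\<Sum>b\<in>B. c b (f' i x) *\<^sub>R frechet_derivative g (at (f x)) b))"
      using linear_coordinates_expand[OF B has_derivative_linear[OF D], of "f' i x"]
      by (simp add: linear_scale[OF has_derivative_linear[OF D]])
    finally show ?thesis by (simp add: has_vector_derivative_def fun_upd_def)
  qed
  have e: "Ck_partial p n W (\<lambda>x. \<Sum>b\<in>B. c b (f' i x) *\<^sub>R frechet_derivative g (at (f x)) b)"
      if "i \<le> p" for i
  proof (rule Ck_partial_sum, rule Ck_partial_scaleR)
    show "Ck_partial p n W (\<lambda>x. c b (f' i x))" for b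
      using B by (intro Ck_partial_bounded_linear[OF _ f'(2)[OF that],
          of "c b"]) (simp add: linear_coordinates_def)
    show "Ck_partial p n W (\<lambda>x. frechet_derivative g (at (f x)) b)" for b
      by (rule Suc.IH[OF Ck_partial_Suc_imp[OF Suc.prems(1)] Ck_on_SucD(2)[OF Suc.prems(2)]])
  qed
  show ?case by (rule Ck_partial_SucI[OF cont d e])
qed

text \<open>If \<open>g\<close> extends \<open>\<sigma>\<close> to a neighbourhood of the standard simplex, then \<open>f \<circ> g\<close> extends the
  image; its smoothness is checked near each point, through a chart of the source manifold.\<close>

lemma smooth_simplex_map:
  fixes A :: "('m::{t2_space, second_countable_topology}, 'a::real_normed_vector) atlas"
  assumes f: "smooth_manifold_map A B f" and \<sigma>: "smooth_simplex k A \<sigma>"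
  shows "smooth_simplex k B (simplex_map k f \<sigma>)"
proof -
  note A = smooth_manifold_mapD(1)[OF f] and B = smooth_manifold_mapD(2)[OF f]
  obtain W g where Wg: "open W \<and> standard_simplex k \<subseteq> W \<and> (\<forall>x\<in>standard_simplex k. g x = \<sigma> x) \<and>
      continuous_on W g \<and> g ` W \<subseteq> mcarrier A \<and>
      (\<forall>c\<in>A. \<forall>n. Ck_partial k n (W \<inter> g -` fst c) (snd c \<circ> g))"
    using \<sigma> unfolding smooth_simplex_def by blast
  then have W: "open W" "standard_simplex k \<subseteq> W" "\<And>x. x \<in> standard_simplex k \<Longrightarrow> g x = \<sigma> x"
    "continuous_on W g" "g ` W \<subseteq> mcarrier A"
    and g: "\<And>c n. c \<in> A \<Longrightarrow> Ck_partial k n (W \<inter> g -` fst c) (snd c \<circ> g)"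
    by simp_all
  obtain Bb :: "'a set" and b where Bb: "linear_coordinates Bb b"
    by (rule manifold_linear_coordinates[OF A])
  have "continuous_map (top_of_set (mcarrier A)) (top_of_set (mcarrier B)) f"
    using smooth_manifold_mapD(4,5)[OF f] by auto
  then have sing: "singular_simplex k (top_of_set (mcarrier B)) (simplex_map k f \<sigma>)"
    using \<sigma> by (auto simp: smooth_simplex_def intro: singular_simplex_simplex_map)
  have "Ck_partial k n (W \<inter> (f \<circ> g) -` fst d) (snd d \<circ> (f \<circ> g))" if d: "d \<in> B" for d n
  proof (rule Ck_partial_local)
    fix x assume "x \<in> W \<inter> (f \<circ> g) -` fst d"
    then have x: "x \<in> W" "f (g x) \<in> fst d" "g x \<in> mcarrier A" using W(5) by auto
    define c where "c = chart_at A (g x)"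
    have c: "c \<in> A" "g x \<in> fst c" using chart_at[OF x(3)] by (auto simp: c_def)
    define V where "V = W \<inter> g -` (fst c \<inter> f -` fst d)"
    have V: "open V" "x \<in> V"
      using continuous_open_preimage[OF W(4,1) open_chart_preimage[OF f c(1) chart_open(1)[OF B d]]] x c
      by (auto simp: V_def)
    have "Ck_partial k n V (\<lambda>x. (snd d \<circ> f \<circ> chart_inv c) ((snd c \<circ> g) x))"
    proof (rule Ck_partial_compose[OF Bb])
      show "(snd c \<circ> g) ` V \<subseteq> snd c ` (fst c \<inter> f -` fst d)" by (auto simp: V_def)
      show "Ck_partial k n V (snd c \<circ> g)"
        by (rule Ck_partial_subset[OF g[OF c(1)]]) (auto simp: V_def)
      show "Ck_on n (snd c ` (fst c \<inter> f -` fst d)) (snd d \<circ> f \<circ> chart_inv c)"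
        using local_rep_smooth(1)[OF f c(1) d] by (simp add: smooth_on_def)
    qed
    then have "Ck_partial k n V (snd d \<circ> (f \<circ> g))"
      by (rule Ck_partial_cong[OF V(1), rotated]) (auto simp: V_def chart_inverse(1)[OF A c(1)])
    with V show "\<exists>V. open V \<and> x \<in> V \<and> Ck_partial k n V (snd d \<circ> (f \<circ> g))" by blast
  qed
  moreover have "continuous_on W (f \<circ> g)"
    by (rule continuous_on_compose[OF W(4) continuous_on_subset[OF smooth_manifold_mapD(5)[OF f] W(5)]])
  moreover have "(f \<circ> g) ` W \<subseteq> mcarrier B" using W(5) smooth_manifold_mapD(4)[OF f] by auto
  moreover have "\<forall>x\<in>standard_simplex k. (f \<circ> g) x = simplex_map k f \<sigma> x"
    using W(3) by (auto simp: simplex_map_def)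
  ultimately show ?thesis
    unfolding smooth_simplex_def using sing W(1,2) by blast
qed

lemma smooth_chains_map:
  assumes "smooth_manifold_map A B f" "S \<in> smooth_chains A k"
  shows "chain_map k f S \<in> smooth_chains B k"
proof -
  have "Poly_Mapping.keys (chain_map k f S) \<subseteq> (\<Union>\<sigma>\<in>Poly_Mapping.keys S. Poly_Mapping.keys (frag_of
      (simplex_map k f \<sigma>)))"
    using keys_frag_extend[of "frag_of \<circ> simplex_map k f" S] by (simp add: chain_map_def)
  then show ?thesis
    using assms smooth_simplex_map[OF assms(1)] by (fastforce simp: smooth_chains_def)
qed

lemma smooth_chains_singular:
  "S \<in> smooth_chains A k \<Longrightarrow> singular_chain k (top_of_set (mcarrier A)) S"
  by (auto simp: smooth_chains_def singular_chain_def smooth_simplex_def)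

lemma rel_push_chains:
  assumes "smooth_arrow F" "smooth_arrow F'" "arrow_morphism F F' \<phi> \<psi>" and "c \<in> rel_chains F k"
  shows "rel_push k \<phi> \<psi> c \<in> rel_chains F' k"
  using assms(4) smooth_chains_map[OF arrow_morphismD(1)[OF assms(1-3)], of "snd c" "k - 1"]
    smooth_chains_map[OF arrow_morphismD(2)[OF assms(1-3)], of "fst c" k]
  by (auto simp: rel_chains_def rel_push_def split: if_splits)

lemma rel_push_boundary:
  assumes "smooth_arrow F" "smooth_arrow F'" "arrow_morphism F F' \<phi> \<psi>" and "c \<in> rel_chains F k"
  shows "rel_push (k - 1) \<phi> \<psi> (rel_boundary F k c) = rel_boundary F' k (rel_push k \<phi> \<psi> c)"
proof -
  obtain S T where c: "c = (S, T)" by (cases c)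
  have S: "singular_chain k (top_of_set (mcarrier (tgt F))) S"
    and T: "singular_chain (k - 1) (top_of_set (mcarrier (src F))) T"
    using assms(4) by (auto simp: rel_chains_def c smooth_chains_singular split: if_splits)
  have "chain_map (k - 1) \<psi> (chain_map (k - 1) (amap F) T) = chain_map (k - 1) (\<psi> \<circ> amap F) T"
    by (simp add: chain_map_compose)
  also have "\<dots> = chain_map (k - 1) (amap F' \<circ> \<phi>) T"
    using arrow_morphismD(3)[OF assms(1-3)] by (intro chain_map_eq[OF T]) auto
  also have "\<dots> = chain_map (k - 1) (amap F') (chain_map (k - 1) \<phi> T)"
    by (simp add: chain_map_compose)
  finally show ?thesis
    using chain_boundary_chain_map[OF S, of \<psi>] chain_boundary_chain_map[OF T, of \<phi>]
    by (simp add: c rel_push_def rel_boundary_def chain_map_diff chain_map_minus)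
qed

section \<open>Integration over smooth simplices\<close>

lemma has_vector_derivative_in_charts:
  assumes f: "smooth_manifold_map A B f" and "c \<in> A" "d \<in> B" "\<gamma> t \<in> fst c" "f (\<gamma> t) \<in> fst d"
    and "isCont \<gamma> t" "(snd c \<circ> \<gamma>) differentiable (at t)"
  shows "(snd d \<circ> (f \<circ> \<gamma>) has_vector_derivative
    frechet_derivative (snd d \<circ> f \<circ> chart_inv c) (at (snd c (\<gamma> t))) (vector_derivative (snd c \<circ> \<gamma>)
        (at t))) (at t)"
proof -
  note A = smooth_manifold_mapD(1)[OF f]
  define D where "D = frechet_derivative (snd d \<circ> f \<circ> chart_inv c) (at (snd c (\<gamma> t)))"
  have D: "(snd d \<circ> f \<circ> chart_inv c has_derivative D) (at ((snd c \<circ> \<gamma>) t))"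
    unfolding D_def using local_rep_has_derivative[OF f assms(2-5)] by simp
  have \<gamma>: "(snd c \<circ> \<gamma> has_derivative (\<lambda>h. h *\<^sub>R vector_derivative (snd c \<circ> \<gamma>) (at t))) (at t)"
    using assms(7) by (simp add: vector_derivative_works has_vector_derivative_def)
  have "((\<lambda>s. (snd d \<circ> f \<circ> chart_inv c) ((snd c \<circ> \<gamma>) s)) has_derivative
      (\<lambda>h. D (h *\<^sub>R vector_derivative (snd c \<circ> \<gamma>) (at t)))) (at t)"
    by (rule has_derivative_compose[OF \<gamma>, of "snd d \<circ> f \<circ> chart_inv c" D]) (fact D)
  moreover have "\<forall>\<^sub>F s in at t. \<gamma> s \<in> fst c"
    using assms(4,6) chart_open(1)[OF A assms(2)] by (auto simp: isCont_def intro: topological_tendstoD)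
  then have "\<forall>\<^sub>F s in at t. (snd d \<circ> f \<circ> chart_inv c) ((snd c \<circ> \<gamma>) s) = (snd d \<circ> (f \<circ> \<gamma>)) s"
    by (rule eventually_mono) (simp add: chart_inverse(1)[OF A assms(2)])
  ultimately have "(snd d \<circ> (f \<circ> \<gamma>) has_derivative (\<lambda>h. D (h *\<^sub>R vector_derivative (snd c \<circ> \<gamma>) (at
      t)))) (at t)"
    by (rule has_derivative_transform_eventually) (simp_all add: chart_inverse(1)[OF A assms(2,4)])
  then show ?thesis
    unfolding has_vector_derivative_def D_def[symmetric]
        by (simp add: linear_scale[OF has_derivative_linear[OF D]])
qed

text \<open>If a curve is continuous, then differentiability at \<open>t\<close> does not depend on the chart; hence
  the default value \<open>0\<close> is taken in all charts at \<open>\<gamma> t\<close> or in none.\<close>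

lemma velocity_in_tangent_space:
  assumes A: "smooth_manifold A"
  shows "velocity A \<gamma> t \<in> tangent_space A (\<gamma> t)"
proof (rule tangent_spaceI)
  fix c d assume cd: "c \<in> A" "d \<in> A" "\<gamma> t \<in> fst c" "\<gamma> t \<in> fst d"
  note id = smooth_manifold_map_id[OF A]
  show "velocity A \<gamma> t d = frechet_derivative (snd d \<circ> chart_inv c) (at (snd c (\<gamma> t))) (velocity A \<gamma>
      t c)"
  proof (cases "isCont \<gamma> t \<and> (snd c \<circ> \<gamma>) differentiable (at t)")
    case True
    have "(snd d \<circ> \<gamma> has_vector_derivative
        frechet_derivative (snd d \<circ> chart_inv c) (at (snd c (\<gamma> t))) (vector_derivative (snd c \<circ> \<gamma>)
            (at t))) (at t)"
      using has_vector_derivative_in_charts[where \<gamma> = \<gamma> and t = t, OF id cd(1-3)] True cd(4) by simp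
    then show ?thesis
      using True cd by (simp add: velocity_def vector_derivative_at differentiableI_vector)
  next
    case False
    then have "\<not> (isCont \<gamma> t \<and> (snd d \<circ> \<gamma>) differentiable (at t))"
      using has_vector_derivative_in_charts[where \<gamma> = \<gamma> and t = t, OF id cd(2,1,4)] cd(3)
          by (auto intro: differentiableI_vector)
    then show ?thesis
      using False cd linear_0[OF has_derivative_linear[OF transition_has_derivative[OF A cd]]]
      by (auto simp: velocity_def)
  qed
qed (auto simp: velocity_def)

text \<open>Differentiability is essential: otherwise the left-hand side is \<open>0\<close> by default, whereas
  \<open>f \<circ> \<gamma>\<close> may well have a velocity.\<close>

lemma tmap_velocity:
  assumes f: "smooth_manifold_map A B f" and "c \<in> A" "\<gamma> t \<in> fst c"
    and "isCont \<gamma> t" "(snd c \<circ> \<gamma>) differentiable (at t)"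
  shows "tmap A B f (\<gamma> t) (velocity A \<gamma> t) = velocity B (f \<circ> \<gamma>) t"
proof
  fix d
  note A = smooth_manifold_mapD(1)[OF f]
  have cont: "isCont (f \<circ> \<gamma>) t"
  proof (rule continuous_at_compose[OF assms(4)])
    show "isCont f (\<gamma> t)"
      using smooth_manifold_mapD(5)[OF f] open_mcarrier[OF A] chart_subset_mcarrier[OF assms(2,3)]
      by (auto simp: continuous_on_eq_continuous_at)
  qed
  show "tmap A B f (\<gamma> t) (velocity A \<gamma> t) d = velocity B (f \<circ> \<gamma>) t d"
  proof (cases "d \<in> B \<and> f (\<gamma> t) \<in> fst d")
    case True
    note D = has_vector_derivative_in_charts[where \<gamma> = \<gamma> and t = t and d = d,
        OF f assms(2) _ assms(3) _ assms(4,5)]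
    have "velocity B (f \<circ> \<gamma>) t d = vector_derivative (snd d \<circ> (f \<circ> \<gamma>)) (at t)"
      using True cont D by (auto simp: velocity_def intro: differentiableI_vector)
    also have "\<dots> = frechet_derivative (snd d \<circ> f \<circ> chart_inv c) (at (snd c (\<gamma> t))) (velocity A \<gamma> t c)"
      using True D assms by (simp add: velocity_def vector_derivative_at)
    finally show ?thesis
      using tmap_component[OF f velocity_in_tangent_space[OF A, of \<gamma> t] assms(2,3)] True by simp
  qed (auto simp: tmap_def velocity_def)
qed

lemma velocity_cong:
  fixes A :: "('m::{t2_space, second_countable_topology}, 'a::real_normed_vector) atlas"
  assumes "open S" "t \<in> S" "\<And>s. s \<in> S \<Longrightarrow> \<gamma> s = \<delta> s"
  shows "velocity A \<gamma> t = velocity A \<delta> t"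
proof -
  have "isCont \<gamma> t \<longleftrightarrow> isCont \<delta> t"
    using assms by (intro isCont_cong) (auto simp: eventually_nhds)
  moreover have "(snd d \<circ> \<gamma> has_vector_derivative D) (at t) \<longleftrightarrow> (snd d \<circ> \<delta> has_vector_derivative D)
      (at t)" for d :: "('m, 'a) chart" and D
    using assms has_vector_derivative_transform_within_open[OF _ assms(1,2),
        of "snd d \<circ> \<gamma>" D "snd d \<circ> \<delta>"]
      has_vector_derivative_transform_within_open[OF _ assms(1,2), of "snd d \<circ> \<delta>" D "snd d \<circ> \<gamma>"]
    by auto
  ultimately show ?thesis
    using assms(2,3) by (auto simp: velocity_def vector_derivative_works vector_derivative_def
        fun_eq_iff)
qed

text \<open>Moving one of the parameters of the standard simplex changes two of the barycentric
  coordinates at the same time. Existence of the velocity therefore needs that continuous partial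
  derivatives give a total derivative in these two coordinates.\<close>

lemma Ck_partial_diagonal_differentiable:
  fixes h :: "(nat \<Rightarrow> real) \<Rightarrow> 'b::real_normed_vector"
  assumes h: "Ck_partial p (Suc 0) V h" and "open V" "y \<in> V" and ij: "i \<le> p" "j \<le> p" "i \<noteq> j"
  shows "(\<lambda>s. h (y(i := y i - (s - y j), j := s))) differentiable (at (y j))"
proof -
  from Ck_partial_SucE[OF h] obtain g where
    g: "\<And>i x. i \<le> p \<Longrightarrow> x \<in> V \<Longrightarrow> ((\<lambda>s. h (x(i := s))) has_vector_derivative g i x) (at (x i))"
    "\<And>i. i \<le> p \<Longrightarrow> Ck_partial p 0 V (g i)" by blast
  define u where "u a b = y(i := a, j := b)" for a b
  have cu: "continuous_on S (\<lambda>z. u (fst z) (snd z))" for S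
  proof (rule continuous_on_coordinatewise_then_product)
    show "continuous_on S (\<lambda>z. u (fst z) (snd z) k)" for k
      by (cases "k = j"; cases "k = i") (auto simp: u_def intro!: continuous_intros)
  qed
  have "open ((\<lambda>z. u (fst z) (snd z)) -` V)"
    by (rule open_vimage[OF \<open>open V\<close> cu])
  moreover have uy: "u (y i) (y j) = y" by (simp add: u_def)
  ultimately obtain X Y where XY: "open X" "open Y" "y i \<in> X" "y j \<in> Y"
    "X \<times> Y \<subseteq> (\<lambda>z. u (fst z) (snd z)) -` V"
    using \<open>y \<in> V\<close> by (elim open_prod_elim[where x = "(y i, y j)"]) auto
  obtain e where e: "0 < e" "ball (y j) e \<subseteq> Y" using XY(2,4) open_contains_ball by blast
  have uV: "u a b \<in> V" if "a \<in> X" "b \<in> ball (y j) e" for a b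
  proof -
    have "(a, b) \<in> X \<times> Y" using that e(2) by auto
    then have "(a, b) \<in> (\<lambda>z. u (fst z) (snd z)) -` V" using XY(5) by blast
    then show ?thesis by simp
  qed
  have ui: "u a (y j) = y(i := a)" for a
    using ij(3) by (auto simp: u_def fun_eq_iff)
  have fx: "((\<lambda>a. h (u a (y j))) has_derivative (\<lambda>s. s *\<^sub>R g i y)) (at (y i) within X)"
    unfolding ui by (rule has_derivative_at_withinI[OF g(1)[OF ij(1) \<open>y \<in> V\<close>,
        unfolded has_vector_derivative_def]])
  have fy: "((\<lambda>b. h (u a b)) has_derivative blinfun_apply (blinfun_scaleR_left (g j (u a b)))) (at b
      within ball (y j) e)"
    if "a \<in> X" "b \<in> ball (y j) e" for a b
    using g(1)[OF ij(2) uV[OF that]] has_derivative_at_withinI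
    by (auto simp: u_def has_vector_derivative_def)
  have "continuous_on (X \<times> ball (y j) e) (\<lambda>z. g j (u (fst z) (snd z)))"
    by (rule continuous_on_compose2[OF _ cu, of V "g j"]) (use g(2)[OF ij(2)] uV in auto)
  then have "continuous_on (X \<times> ball (y j) e) (\<lambda>(a, b). blinfun_scaleR_left (g j (u a b)))"
    by (simp add: case_prod_beta bounded_linear.continuous_on[OF bounded_linear_blinfun_scaleR_left])
  then have fy_cont: "continuous (at (y i, y j) within X \<times> ball (y j) e) (\<lambda>(a,
      b). blinfun_scaleR_left (g j (u a b)))"
    using XY(3) e(1) by (simp add: continuous_on_eq_continuous_within)
  have "((\<lambda>(a, b). h (u a b)) has_derivative
      (\<lambda>(ta, tb). ta *\<^sub>R g i y + blinfun_apply (blinfun_scaleR_left (g j (u (y i) (y j)))) tb))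
      (at (y i, y j) within X \<times> ball (y j) e)"
    by (rule has_derivative_partialsI[OF fx fy fy_cont]) (use e in auto)
  moreover have "at (y i, y j) within X \<times> ball (y j) e = at (y i, y j)"
    using XY e by (intro at_within_open) (auto intro: open_Times)
  ultimately have "(\<lambda>(a, b). h (u a b)) differentiable (at (y i, y j))"
    by (auto simp: differentiable_def)
  moreover have "(\<lambda>s. (y i - (s - y j), s)) differentiable (at (y j))"
    by (auto intro!: derivative_intros differentiableI)
  ultimately have "((\<lambda>(a, b). h (u a b)) \<circ> (\<lambda>s. (y i - (s - y j), s))) differentiable (at (y j))"
    by (intro differentiable_chain_at) auto
  then show ?thesis by (simp add: comp_def u_def)
qed

lemma simplex_param_in_standard_simplex:
  assumes "\<forall>j<p. 0 < t j" "(\<Sum>j<p. t j) < 1"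
  shows "simplex_param p t \<in> standard_simplex p"
proof -
  have le: "t j \<le> (\<Sum>j<p. t j)" if "j < p" for j
    using assms(1) that by (intro member_le_sum) (auto intro: less_imp_le)
  have nonneg: "0 \<le> (\<Sum>j<p. t j)"
    using assms(1) by (intro sum_nonneg) (auto intro: less_imp_le)
  have "0 \<le> simplex_param p t i \<and> simplex_param p t i \<le> 1" for i
  proof (cases i)
    case 0
    then show ?thesis using assms(2) nonneg by (simp add: simplex_param_def)
  next
    case (Suc j)
    then show ?thesis using assms le[of j] by (auto simp: simplex_param_def intro: less_imp_le)
  qed
  moreover have "simplex_param p t i = 0" if "i > p" for i
    using that by (simp add: simplex_param_def)
  moreover have "(\<Sum>i\<le>p. simplex_param p t i) = 1"
  proof -
    have "(\<Sum>i\<le>p. simplex_param p t i) = simplex_param p t 0 + (\<Sum>i<p. simplex_param p t (Suc i))"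
      by (rule sum.atMost_shift)
    also have "(\<Sum>i<p. simplex_param p t (Suc i)) = (\<Sum>i<p. t i)"
      by (intro sum.cong) (auto simp: simplex_param_def)
    finally show ?thesis by (simp add: simplex_param_def)
  qed
  ultimately show ?thesis by (simp add: standard_simplex_def)
qed

lemma simplex_param_update:
  assumes "j < p"
  shows "simplex_param p (t(j := s)) = (simplex_param p t)(0 := simplex_param p t 0 - (s - t j),
      Suc j := s)"
proof
  fix i
  have "(\<Sum>i<p. (t(j := s)) i) = (\<Sum>i<p. t i) + (s - t j)"
    using assms by (subst (1 2) sum.remove[of _ j]) (auto intro!: sum.cong)
  then show "simplex_param p (t(j := s)) i =
      ((simplex_param p t)(0 := simplex_param p t 0 - (s - t j), Suc j := s)) i"
    using assms by (auto simp: simplex_param_def)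
qed

text \<open>Near \<open>t j\<close> the parameter curve stays in the interior of the simplex, where \<open>\<sigma>\<close> agrees with
  its smooth extension \<open>g\<close>; so the curve has a velocity, and \<open>tmap\<close> carries it to the one of the
  image.\<close>

lemma smooth_simplex_velocity:
  assumes f: "smooth_manifold_map A B f" and \<sigma>: "smooth_simplex p A \<sigma>"
    and t: "\<forall>j<p. 0 < t j" "(\<Sum>j<p. t j) < 1" and j: "j < p"
  shows "tmap A B f (\<sigma> (simplex_param p t)) (velocity A (\<lambda>s. \<sigma> (simplex_param p (t(j := s)))) (t j)) =
    velocity B (\<lambda>s. simplex_map p f \<sigma> (simplex_param p (t(j := s)))) (t j)"
proof -
  note A = smooth_manifold_mapD(1)[OF f]
  obtain W g where Wg: "open W \<and> standard_simplex p \<subseteq> W \<and> (\<forall>x\<in>standard_simplex p. g x = \<sigma> x) \<and>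
      continuous_on W g \<and> g ` W \<subseteq> mcarrier A \<and>
      (\<forall>c\<in>A. \<forall>n. Ck_partial p n (W \<inter> g -` fst c) (snd c \<circ> g))"
    using \<sigma> unfolding smooth_simplex_def by blast
  then have W: "open W" "standard_simplex p \<subseteq> W" "\<And>x. x \<in> standard_simplex p \<Longrightarrow> g x = \<sigma> x"
    "continuous_on W g" "g ` W \<subseteq> mcarrier A"
    and g: "\<And>c n. c \<in> A \<Longrightarrow> Ck_partial p n (W \<inter> g -` fst c) (snd c \<circ> g)"
    by simp_all
  define y where "y = simplex_param p t"
  have y: "y \<in> standard_simplex p" "y \<in> W"
    using simplex_param_in_standard_simplex[OF t] W(2) by (auto simp: y_def)
  have yj: "y (Suc j) = t j" using j by (simp add: y_def simplex_param_def)
  define \<gamma> where "\<gamma> s = g (simplex_param p (t(j := s)))" for s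
  have \<gamma>0: "\<gamma> (t j) = \<sigma> y" using y W(3) by (simp add: \<gamma>_def y_def)
  define I where "I = {s. 0 < s \<and> (\<Sum>i<p. (t(j := s)) i) < 1}"
  have "continuous_on UNIV (\<lambda>s. \<Sum>i<p. (t(j := s)) i)"
  proof (rule continuous_on_sum)
    show "continuous_on UNIV (\<lambda>s. (t(j := s)) i)" for i
      by (cases "i = j") (auto intro!: continuous_intros)
  qed
  then have "open ({s. 0 < s} \<inter> (\<lambda>s. \<Sum>i<p. (t(j := s)) i) -` {..<1})"
    by (intro open_Int open_vimage) (auto intro: open_Collect_less continuous_intros)
  then have "open I" by (simp add: I_def Collect_conj_eq vimage_def)
  moreover have tI: "t j \<in> I"
    unfolding I_def mem_Collect_eq fun_upd_triv using t j by simp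
  moreover have simp: "simplex_param p (t(j := s)) \<in> standard_simplex p" if "s \<in> I" for s
    using that t(1) by (intro simplex_param_in_standard_simplex) (auto simp: I_def)
  ultimately have I: "open I" "t j \<in> I"
    "\<And>s. s \<in> I \<Longrightarrow> \<gamma> s = \<sigma> (simplex_param p (t(j := s)))"
    "\<And>s. s \<in> I \<Longrightarrow> f (\<gamma> s) = simplex_map p f \<sigma> (simplex_param p (t(j := s)))"
    by (auto simp: \<gamma>_def W(3) simplex_map_def)
  have param: "simplex_param p (t(j := s)) = y(0 := y 0 - (s - y (Suc j)), Suc j := s)" for s
    unfolding y_def[symmetric] simplex_param_update[OF j] yj ..
  have "continuous_on UNIV (\<lambda>s. simplex_param p (t(j := s)))"
  proof (rule continuous_on_coordinatewise_then_product)
    show "continuous_on UNIV (\<lambda>s. simplex_param p (t(j := s)) i)" for i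
      unfolding param by (cases "i = Suc j"; cases "i = 0") (auto intro!: continuous_intros)
  qed
  then have cp: "isCont (\<lambda>s. simplex_param p (t(j := s))) (t j)"
    by (simp add: continuous_on_eq_continuous_at)
  have "isCont g (simplex_param p (t(j := t j)))"
    using W(1,4) y(2) by (simp add: continuous_on_eq_continuous_at y_def)
  with cp have cont: "isCont \<gamma> (t j)"
    unfolding \<gamma>_def by (rule isCont_o2)
  have "\<sigma> y \<in> mcarrier A" using W(3,5) y by (metis image_subset_iff)
  define c where "c = chart_at A (\<sigma> y)"
  have c: "c \<in> A" "\<sigma> y \<in> fst c" using chart_at[OF \<open>\<sigma> y \<in> mcarrier A\<close>] by (auto simp: c_def)
  have "open (W \<inter> g -` fst c)"
    by (rule continuous_open_preimage[OF W(4,1) chart_open(1)[OF A c(1)]])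
  moreover have "y \<in> W \<inter> g -` fst c" using y W(3) c(2) by simp
  ultimately have "(\<lambda>s. (snd c \<circ> g) (y(0 := y 0 - (s - y (Suc j)), Suc j :=
      s))) differentiable (at (y (Suc j)))"
    using j by (intro Ck_partial_diagonal_differentiable[OF g[OF c(1)]]) auto
  then have diff: "(snd c \<circ> \<gamma>) differentiable (at (t j))"
    by (simp add: yj[symmetric] \<gamma>_def param[unfolded yj] comp_def)
  have c': "\<gamma> (t j) \<in> fst c" using c(2) by (simp add: \<gamma>0)
  have "velocity A (\<lambda>s. \<sigma> (simplex_param p (t(j := s)))) (t j) = velocity A \<gamma> (t j)"
    by (rule velocity_cong[OF I(1,2)]) (simp add: I(3))
  moreover have "velocity B (\<lambda>s. simplex_map p f \<sigma> (simplex_param p (t(j := s)))) (t j) =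
      velocity B (f \<circ> \<gamma>) (t j)"
    by (rule velocity_cong[OF I(1,2)]) (simp add: I(4))
  ultimately show ?thesis
    using tmap_velocity[where \<gamma> = \<gamma> and t = "t j", OF f c(1) c' cont diff] by (simp add: \<gamma>0 y_def)
qed

text \<open>The integrands agree at every point of the open simplex, so that no change of variables is
  involved.\<close>

lemma simplex_integral_pullback:
  assumes f: "smooth_manifold_map A B f" and \<sigma>: "smooth_simplex p A \<sigma>"
  shows "simplex_integral A p (pullback A B f \<alpha>) \<sigma> = simplex_integral B p \<alpha> (simplex_map p f \<sigma>)"
  unfolding simplex_integral_def set_lebesgue_integral_def
proof (rule Bochner_Integration.integral_cong[OF refl])
  fix t :: "nat \<Rightarrow> real"
  note A = smooth_manifold_mapD(1)[OF f]
  define v where "v j = velocity A (\<lambda>s. \<sigma> (simplex_param p (t(j := s)))) (t j)" for j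
  show "indicator {t. (\<forall>j<p. 0 < t j) \<and> (\<Sum>j<p. t j) < 1} t *\<^sub>R
      pullback A B f \<alpha> (\<sigma> (simplex_param p t)) (map (\<lambda>j. velocity A (\<lambda>s. \<sigma> (simplex_param p (t(j :=
          s)))) (t j)) [0..<p]) =
    indicator {t. (\<forall>j<p. 0 < t j) \<and> (\<Sum>j<p. t j) < 1} t *\<^sub>R
      \<alpha> (simplex_map p f \<sigma> (simplex_param p t))
        (map (\<lambda>j. velocity B (\<lambda>s. simplex_map p f \<sigma> (simplex_param p (t(j := s)))) (t j)) [0..<p])"
  proof (cases "(\<forall>j<p. 0 < t j) \<and> (\<Sum>j<p. t j) < 1")
    case True
    then have t: "\<forall>j<p. 0 < t j" "(\<Sum>j<p. t j) < 1" by auto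
    note x = simplex_param_in_standard_simplex[OF t]
    have "\<sigma> (simplex_param p t) \<in> mcarrier A"
      using \<sigma> x by (auto simp: smooth_simplex_def singular_simplex_def continuous_map_def)
    moreover have "v j \<in> tangent_space A (\<sigma> (simplex_param p t))" for j
      using velocity_in_tangent_space[OF A, of "\<lambda>s. \<sigma> (simplex_param p (t(j := s)))" "t j"]
          by (simp add: v_def)
    moreover have "map (tmap A B f (\<sigma> (simplex_param p t))) (map v [0..<p]) =
        map (\<lambda>j. velocity B (\<lambda>s. simplex_map p f \<sigma> (simplex_param p (t(j := s)))) (t j)) [0..<p]"
      using smooth_simplex_velocity[OF f \<sigma> t] by (simp add: v_def)
    ultimately show ?thesis
      using True x unfolding v_def[symmetric] pullback_def
          by (auto simp: simplex_map_def simp del: map_map)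
  qed simp
qed

text \<open>Distinct simplices may have the same image, so that a push-forward can have fewer simplices,
  with other coefficients. Summation over a larger index set makes the integral visibly additive
  in the chain.\<close>

lemma chain_integral_superset:
  assumes "finite K" "Poly_Mapping.keys S \<subseteq> K"
  shows "chain_integral A p \<alpha> S = (\<Sum>\<sigma>\<in>K. of_int (Poly_Mapping.lookup S \<sigma>) * simplex_integral A p \<alpha> \<sigma>)"
  unfolding chain_integral_def
  using assms by (intro sum.mono_neutral_left) (auto simp: in_keys_iff)

lemma chain_integral_add: "chain_integral A p \<alpha> (S + T) = chain_integral A p \<alpha> S +
    chain_integral A p \<alpha> T"
  using keys_add[of S T]
  by (subst (1 2 3) chain_integral_superset[of "Poly_Mapping.keys S \<union> Poly_Mapping.keys T"])
     (auto simp: lookup_add sum.distrib algebra_simps)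

lemma chain_integral_zero [simp]: "chain_integral A p \<alpha> 0 = 0"
  by (simp add: chain_integral_def)

lemma chain_integral_sum: "chain_integral A p \<alpha> (\<Sum>i\<in>I. S i) = (\<Sum>i\<in>I. chain_integral A p \<alpha> (S i))"
  by (induction I rule: infinite_finite_induct) (simp_all add: chain_integral_add)

lemma chain_integral_multiple:
  "chain_integral A p \<alpha> (frag_cmul n (frag_of \<sigma>)) = of_int n * simplex_integral A p \<alpha> \<sigma>"
  by (subst chain_integral_superset[of "{\<sigma>}"]) (auto simp: keys_cmul)

lemma chain_integral_pullback:
  assumes f: "smooth_manifold_map A B f" and S: "S \<in> smooth_chains A k"
  shows "chain_integral A k (pullback A B f \<alpha>) S = chain_integral B k \<alpha> (chain_map k f S)"
proof -
  have "chain_integral B k \<alpha> (chain_map k f S) = (\<Sum>\<sigma>\<in>Poly_Mapping.keys S.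
      of_int (Poly_Mapping.lookup S \<sigma>) * simplex_integral B k \<alpha> (simplex_map k f \<sigma>))"
    by (simp add: chain_map_def frag_extend_def chain_integral_sum chain_integral_multiple)
  also have "\<dots> = chain_integral A k (pullback A B f \<alpha>) S"
    unfolding chain_integral_def
    using S by (intro sum.cong refl) (auto simp: smooth_chains_def simplex_integral_pullback[OF f])
  finally show ?thesis by simp
qed

lemma rel_pairing_pullback:
  assumes "smooth_arrow F" "smooth_arrow F'" "arrow_morphism F F' \<phi> \<psi>" and c: "c \<in> rel_chains F k"
  shows "rel_pairing F k (rel_pullback F F' \<phi> \<psi> \<Psi>) c = rel_pairing F' k \<Psi> (rel_push k \<phi> \<psi> c)"
proof -
  have "fst c \<in> smooth_chains (tgt F) k" "snd c \<in> smooth_chains (src F) (k - 1)"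
    using c by (auto simp: rel_chains_def smooth_chains_def split: if_splits)
  then show ?thesis
    using chain_integral_pullback[OF arrow_morphismD(1)[OF assms(1-3)]]
        chain_integral_pullback[OF arrow_morphismD(2)[OF assms(1-3)]]
    by (simp add: rel_pairing_def rel_pullback_def rel_push_def)
qed

lemma rel_push_add: "rel_push k \<phi> \<psi> (c + c') = rel_push k \<phi> \<psi> c + rel_push k \<phi> \<psi> c'"
  by (simp add: rel_push_def chain_map_add)

lemma rel_periods_pullback:
  assumes "smooth_arrow F" "smooth_arrow F'" "arrow_morphism F F' \<phi> \<psi>"
  shows "rel_periods F k (rel_pullback F F' \<phi> \<psi> \<Psi>) \<subseteq> rel_periods F' k \<Psi>"
proof
  fix r assume "r \<in> rel_periods F k (rel_pullback F F' \<phi> \<psi> \<Psi>)"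
  then obtain c where c: "c \<in> rel_chains F k" "rel_boundary F k c = 0"
    and r: "r = rel_pairing F k (rel_pullback F F' \<phi> \<psi> \<Psi>) c"
    by (auto simp: rel_periods_def rel_cycles_def)
  have "rel_boundary F' k (rel_push k \<phi> \<psi> c) = rel_push (k - 1) \<phi> \<psi> 0"
    using rel_push_boundary[OF assms c(1)] c(2) by simp
  also have "\<dots> = 0" by (simp add: rel_push_def zero_prod_def)
  finally have "rel_push k \<phi> \<psi> c \<in> rel_cycles F' k"
    using rel_push_chains[OF assms c(1)] by (simp add: rel_cycles_def)
  then show "r \<in> rel_periods F' k \<Psi>"
    using rel_pairing_pullback[OF assms c(1)] by (auto simp: rel_periods_def r)
qed

section \<open>Smooth functions on open subsets of a manifold\<close>

lemma smooth_fun_on_differentiable: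
  assumes "smooth_fun_on A U h" "c \<in> A" "p \<in> fst c" "p \<in> U"
  shows "h \<circ> chart_inv c differentiable (at (snd c p))"
  using assms by (intro smooth_on_imp_differentiable[of "snd c ` (fst c \<inter> U)"]) (auto simp:
      smooth_fun_on_def)

lemma smooth_fun_on_subset: "smooth_fun_on A U h \<Longrightarrow> V \<subseteq> U \<Longrightarrow> smooth_fun_on A V h"
  unfolding smooth_fun_on_def by (meson image_mono inf_mono order_refl smooth_on_subset)

text \<open>One chart around each point suffices, because transition maps are smooth.\<close>

lemma smooth_fun_on_local:
  fixes A :: "('m::{t2_space, second_countable_topology}, 'a::real_normed_vector) atlas"
  assumes A: "smooth_manifold A"
    and loc: "\<And>p. p \<in> U \<Longrightarrow> p \<in> mcarrier A \<Longrightarrow> \<exists>N c. open N \<and> p \<in> N \<and> c \<in> A \<and> p \<in> fst c \<and>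
        smooth_on (snd c ` (fst c \<inter> N)) (h \<circ> chart_inv c)"
  shows "smooth_fun_on A U h"
  unfolding smooth_fun_on_def
proof (intro ballI, rule smooth_on_local)
  fix d x assume d: "d \<in> A" and "x \<in> snd d ` (fst d \<inter> U)"
  then obtain p where p: "p \<in> fst d" "p \<in> U" "x = snd d p" by auto
  obtain N c where N: "open N" "p \<in> N" "c \<in> A" "p \<in> fst c" and sm: "smooth_on (snd c ` (fst c \<inter> N))
      (h \<circ> chart_inv c)"
    using loc[OF p(2) chart_subset_mcarrier[OF d p(1)]] by blast
  obtain B :: "'a set" and b where B: "linear_coordinates B b"
    by (rule manifold_linear_coordinates[OF A])
  define S where "S = snd d ` (fst d \<inter> (fst c \<inter> N))"
  have S: "open S" "x \<in> S"
    using chart_image_open[OF A d, of "fst c \<inter> N"] chart_open(1)[OF A d] chart_open(1)[OF A N(3)] N p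
    by (auto simp: S_def)
  have "smooth_on S (\<lambda>y. (h \<circ> chart_inv c) ((snd c \<circ> id \<circ> chart_inv d) y))"
  proof (rule smooth_on_compose[OF B S(1) _ _ sm])
    show "smooth_on S (snd c \<circ> id \<circ> chart_inv d)"
      by (rule smooth_on_subset[OF local_rep_smooth(1)[OF smooth_manifold_map_id[OF A]
          d N(3)]]) (auto simp: S_def)
    show "(snd c \<circ> id \<circ> chart_inv d) ` S \<subseteq> snd c ` (fst c \<inter> N)"
      by (auto simp: S_def chart_inverse(1)[OF A d])
  qed
  then have "smooth_on S (h \<circ> chart_inv d)"
    by (rule smooth_on_cong[OF _ S(1)]) (auto simp: S_def chart_inverse(1)[OF A d]
        chart_inverse(1)[OF A N(3)])
  with S show "\<exists>T. open T \<and> x \<in> T \<and> smooth_on T (h \<circ> chart_inv d)" by blast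
qed

lemma open_chart_image:
  "smooth_manifold A \<Longrightarrow> open U \<Longrightarrow> c \<in> A \<Longrightarrow> open (snd c ` (fst c \<inter> U))"
  by (intro chart_image_open open_Int chart_open)

lemma smooth_fun_on_cong:
  assumes "smooth_manifold A" "open U" "smooth_fun_on A U h" "\<And>p. p \<in> U \<Longrightarrow> h p = h' p"
  shows "smooth_fun_on A U h'"
  unfolding smooth_fun_on_def
proof
  fix c assume c: "c \<in> A"
  have "smooth_on (snd c ` (fst c \<inter> U)) (h \<circ> chart_inv c)" using assms(3) c
      by (simp add: smooth_fun_on_def)
  then show "smooth_on (snd c ` (fst c \<inter> U)) (h' \<circ> chart_inv c)"
    by (rule smooth_on_cong[OF _ open_chart_image[OF assms(1,2) c]])
       (auto simp: chart_inverse(1)[OF assms(1) c] assms(4))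
qed

lemma smooth_fun_on_const: "smooth_fun_on A U (\<lambda>p. k)"
  by (simp add: smooth_fun_on_def comp_def)

lemma smooth_fun_on_add:
  assumes "smooth_manifold A" "open U" "smooth_fun_on A U h" "smooth_fun_on A U h'"
  shows "smooth_fun_on A U (\<lambda>p. h p + h' p)"
  using assms by (auto simp: smooth_fun_on_def comp_def intro!: smooth_on_add open_chart_image)

lemma smooth_fun_on_mult:
  fixes h :: "'m::{t2_space, second_countable_topology} \<Rightarrow> complex"
  assumes "smooth_manifold A" "open U" "smooth_fun_on A U h" "smooth_fun_on A U h'"
  shows "smooth_fun_on A U (\<lambda>p. h p * h' p)"
  using assms by (auto simp: smooth_fun_on_def comp_def intro!: smooth_on_mult open_chart_image)

lemma smooth_fun_on_cnj:
  assumes "smooth_manifold A" "open U" "smooth_fun_on A U h"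
  shows "smooth_fun_on A U (\<lambda>p. cnj (h p))"
  using assms smooth_on_bounded_linear[OF bounded_linear_cnj open_chart_image[OF assms(1,2)]]
  by (simp add: smooth_fun_on_def comp_def)

lemma smooth_fun_on_compose:
  fixes B :: "('n::{t2_space, second_countable_topology}, 'b::real_normed_vector) atlas"
  assumes f: "smooth_manifold_map A B f" and V: "open V" and h: "smooth_fun_on B V h" and U: "U \<subseteq> f -` V"
  shows "smooth_fun_on A U (\<lambda>p. h (f p))"
proof (rule smooth_fun_on_local)
  note A = smooth_manifold_mapD(1)[OF f] and B = smooth_manifold_mapD(2)[OF f]
  show "smooth_manifold A" by (fact A)
  fix p assume p: "p \<in> U" "p \<in> mcarrier A"
  note c = chart_at[OF p(2)] and d = chart_at[OF smooth_manifold_mapD(4)[OF f p(2)]]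
  define c where "c = chart_at A p"
  define d where "d = chart_at B (f p)"
  have c: "c \<in> A" "p \<in> fst c" and d: "d \<in> B" "f p \<in> fst d" using c d by (auto simp: c_def d_def)
  obtain Bb :: "'b set" and b where Bb: "linear_coordinates Bb b"
    by (rule manifold_linear_coordinates[OF B])
  define N where "N = fst c \<inter> f -` (fst d \<inter> V)"
  have N: "open N" "p \<in> N"
    using open_chart_preimage[OF f c(1) open_Int[OF chart_open(1)[OF B d(1)] V]] c d p U
        by (auto simp: N_def)
  have S: "open (snd c ` (fst c \<inter> N))" by (rule open_chart_image[OF A N(1) c(1)])
  have "smooth_on (snd c ` (fst c \<inter> N)) (\<lambda>x. (h \<circ> chart_inv d) ((snd d \<circ> f \<circ> chart_inv c) x))"
  proof (rule smooth_on_compose[OF Bb S])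
    show "smooth_on (snd c ` (fst c \<inter> N)) (snd d \<circ> f \<circ> chart_inv c)"
      by (rule smooth_on_subset[OF local_rep_smooth(1)[OF f c(1) d(1)]]) (auto simp: N_def)
    show "(snd d \<circ> f \<circ> chart_inv c) ` (snd c ` (fst c \<inter> N)) \<subseteq> snd d ` (fst d \<inter> V)"
      by (auto simp: N_def chart_inverse(1)[OF A c(1)])
    show "smooth_on (snd d ` (fst d \<inter> V)) (h \<circ> chart_inv d)"
      using h d(1) by (simp add: smooth_fun_on_def)
  qed
  then have "smooth_on (snd c ` (fst c \<inter> N)) ((\<lambda>p. h (f p)) \<circ> chart_inv c)"
    by (rule smooth_on_cong[OF _ S]) (auto simp: N_def chart_inverse(1)[OF A c(1)]
        chart_inverse(1)[OF B d(1)])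
  with N c show "\<exists>N c. open N \<and> p \<in> N \<and> c \<in> A \<and> p \<in> fst c \<and>
      smooth_on (snd c ` (fst c \<inter> N)) ((\<lambda>p. h (f p)) \<circ> chart_inv c)"
    by blast
qed

lemma smooth_fun_on_has_derivative:
  assumes "smooth_fun_on A U h" "p \<in> U" "p \<in> mcarrier A"
  shows "((\<lambda>x. h (chart_inv (chart_at A p) x)) has_derivative (\<lambda>u. frechet_derivative (h \<circ> chart_inv
      (chart_at A p)) (at (snd (chart_at A p) p)) u))
    (at (snd (chart_at A p) p))"
  using has_derivative_frechet[OF smooth_fun_on_differentiable[OF assms(1) chart_at[OF assms(3)]
      assms(2)]]
  by (simp add: comp_def)

lemma fun_deriv_eqI:
  assumes "((\<lambda>x. h (chart_inv (chart_at A p) x)) has_derivative H) (at (snd (chart_at A p) p))"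
  shows "fun_deriv A h p v = H (v (chart_at A p))"
  using frechet_derivative_at[OF assms] by (simp add: fun_deriv_def comp_def Let_def)

lemma fun_deriv_lin:
  assumes "smooth_fun_on A U h" "p \<in> U" "p \<in> mcarrier A"
  shows "fun_deriv A h p (tv_lin r v s w) = r *\<^sub>R fun_deriv A h p v + s *\<^sub>R fun_deriv A h p w"
  using has_derivative_linear[OF smooth_fun_on_has_derivative[OF assms]]
  by (simp add: fun_deriv_def Let_def tv_lin_def linear_add linear_scale)

lemma fun_deriv_const: "fun_deriv A (\<lambda>q. k) p v = 0"
  by (rule fun_deriv_eqI) simp

lemma fun_deriv_add:
  assumes "smooth_fun_on A U h" "smooth_fun_on A U h'" "p \<in> U" "p \<in> mcarrier A"
  shows "fun_deriv A (\<lambda>q. h q + h' q) p v = fun_deriv A h p v + fun_deriv A h' p v"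
  using fun_deriv_eqI[OF has_derivative_add[OF smooth_fun_on_has_derivative[OF assms(1,3,4)]
      smooth_fun_on_has_derivative[OF assms(2,3,4)]]]
  by (simp add: fun_deriv_def Let_def)

lemma fun_deriv_mult:
  fixes h :: "'m::{t2_space, second_countable_topology} \<Rightarrow> complex"
  assumes A: "smooth_manifold A" and "smooth_fun_on A U h" "smooth_fun_on A U h'" "p \<in> U" "p \<in>
      mcarrier A"
  shows "fun_deriv A (\<lambda>q. h q * h' q) p v = fun_deriv A h p v * h' p + h p * fun_deriv A h' p v"
  using fun_deriv_eqI[OF has_derivative_mult[OF smooth_fun_on_has_derivative[OF assms(2,4,5)]
        smooth_fun_on_has_derivative[OF assms(3,4,5)]]]
  by (simp add: fun_deriv_def Let_def chart_inverse(1)[OF A chart_at[OF assms(5)]])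

lemma fun_deriv_cnj:
  assumes "smooth_fun_on A U h" "p \<in> U" "p \<in> mcarrier A"
  shows "fun_deriv A (\<lambda>q. cnj (h q)) p v = cnj (fun_deriv A h p v)"
  using fun_deriv_eqI[OF bounded_linear.has_derivative[OF bounded_linear_cnj
      smooth_fun_on_has_derivative[OF assms]]]
  by (simp add: fun_deriv_def Let_def)

lemma fun_deriv_cong:
  assumes A: "smooth_manifold A" and "open N" "p \<in> N" "p \<in> mcarrier A" "\<And>q. q \<in> N \<Longrightarrow> q \<in> mcarrier A \<Longrightarrow>
      h q = h' q"
  shows "fun_deriv A h p v = fun_deriv A h' p v"
proof -
  note c = chart_at[OF assms(4)]
  have "frechet_derivative (h \<circ> chart_inv (chart_at A p)) (at (snd (chart_at A p) p)) =
      frechet_derivative (h' \<circ> chart_inv (chart_at A p)) (at (snd (chart_at A p) p))"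
    by (rule frechet_derivative_cong_open[OF open_chart_image[OF A assms(2) c(1)]])
       (use c assms chart_subset_mcarrier[OF c(1)] in \<open>auto simp: chart_inverse(1)[OF A c(1)]\<close>)
  then show ?thesis by (simp add: fun_deriv_def Let_def)
qed

lemma smooth_fun_on_fun_deriv:
  assumes A: "smooth_manifold A" and W: "open W" "W \<subseteq> fst c" and c: "c \<in> A" and h: "smooth_fun_on A W h"
  shows "smooth_fun_on A W (\<lambda>q. fun_deriv A h q (coord_tvec A c q u))"
proof (rule smooth_fun_on_local[OF A])
  fix p assume p: "p \<in> W"
  have "smooth_on (snd c ` (fst c \<inter> W)) (\<lambda>x. frechet_derivative (h \<circ> chart_inv c) (at x) u)"
    using h c by (intro smooth_on_derivative) (simp add: smooth_fun_on_def)
  then have "smooth_on (snd c ` (fst c \<inter> W)) ((\<lambda>q. fun_deriv A h q (coord_tvec A c q u)) \<circ> chart_inv c)"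
  proof (rule smooth_on_cong[OF _ open_chart_image[OF A W(1) c]])
    fix x assume "x \<in> snd c ` (fst c \<inter> W)"
    then obtain q where q: "q \<in> fst c" "q \<in> W" "x = snd c q" by auto
    show "frechet_derivative (h \<circ> chart_inv c) (at x) u =
        ((\<lambda>q. fun_deriv A h q (coord_tvec A c q u)) \<circ> chart_inv c) x"
      using fun_deriv_in_chart[OF A coord_tvec_in_tangent_space[OF A c q(1), of u]
          c q(1) smooth_fun_on_differentiable[OF h c q(1,2)]]
      by (simp add: q(3) chart_inverse(1)[OF A c q(1)] coord_tvec_component[OF A c q(1)])
  qed
  with p W c show "\<exists>N d. open N \<and> p \<in> N \<and> d \<in> A \<and> p \<in> fst d \<and>
      smooth_on (snd d ` (fst d \<inter> N)) ((\<lambda>q. fun_deriv A h q (coord_tvec A c q u)) \<circ> chart_inv d)"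
    by blast
qed

lemma smooth_form_on_component:
  assumes A: "smooth_manifold A" and W: "open W" "W \<subseteq> fst c" "W \<subseteq> N" and c: "c \<in> A" and \<alpha>:
      "smooth_form_on A N 1 \<alpha>"
  shows "smooth_fun_on A W (\<lambda>q. \<alpha> q [coord_tvec A c q u])"
proof (rule smooth_fun_on_local[OF A])
  fix p assume p: "p \<in> W"
  have "smooth_on (snd c ` (fst c \<inter> N)) (\<lambda>x. coord_rep A c \<alpha> x [u])"
    using \<alpha> c by (simp add: smooth_form_on_def)
  then have "smooth_on (snd c ` (fst c \<inter> W)) (\<lambda>x. coord_rep A c \<alpha> x [u])"
    by (rule smooth_on_subset) (use W in auto)
  then have "smooth_on (snd c ` (fst c \<inter> W)) ((\<lambda>q. \<alpha> q [coord_tvec A c q u]) \<circ> chart_inv c)"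
    by (simp add: coord_rep_def comp_def)
  with p W c show "\<exists>N d. open N \<and> p \<in> N \<and> d \<in> A \<and> p \<in> fst d \<and>
      smooth_on (snd d ` (fst d \<inter> N)) ((\<lambda>q. \<alpha> q [coord_tvec A c q u]) \<circ> chart_inv d)"
    by blast
qed

section \<open>Line bundles in local trivialisations\<close>

lemma bundle_trivs:
  assumes "hermitian_line_bundle B L" "(U, \<tau>) \<in> trivs L"
  shows "open U" "U \<subseteq> mcarrier B"
    and "q \<in> U \<Longrightarrow> bij_betw \<tau> (fiber L q) UNIV"
    and "q \<in> U \<Longrightarrow> l \<in> fiber L q \<Longrightarrow> l' \<in> fiber L q \<Longrightarrow> \<tau> (ladd L l l') = \<tau> l + \<tau> l'"
    and "q \<in> U \<Longrightarrow> l \<in> fiber L q \<Longrightarrow> \<tau> (lscale L z l) = z * \<tau> l"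
  using assms unfolding hermitian_line_bundle_def by blast+

lemma bundle_transition:
  assumes "hermitian_line_bundle B L" "(U, \<tau>) \<in> trivs L" "(V, \<tau>') \<in> trivs L"
  shows "smooth_fun_on B (U \<inter> V) (\<lambda>p. \<tau>' (frame L \<tau> p))"
  using assms unfolding hermitian_line_bundle_def by blast

lemma bundle_fiber:
  assumes "hermitian_line_bundle B L" "q \<in> mcarrier B" "l \<in> fiber L q"
  shows "l' \<in> fiber L q \<Longrightarrow> ladd L l l' \<in> fiber L q" "lscale L z l \<in> fiber L q"
proof -
  have "\<forall>p\<in>mcarrier B. \<forall>l\<in>fiber L p. \<forall>l'\<in>fiber L p. \<forall>z.
      ladd L l l' \<in> fiber L p \<and> lscale L z l \<in> fiber L p"
    using assms(1) unfolding hermitian_line_bundle_def by (elim conjE)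
  then show "l' \<in> fiber L q \<Longrightarrow> ladd L l l' \<in> fiber L q" "lscale L z l \<in> fiber L q"
    using assms(2,3) by blast+
qed

lemma bundle_herm:
  assumes "hermitian_line_bundle B L" "q \<in> mcarrier B" "l \<in> fiber L q" "l' \<in> fiber L q"
  shows "l'' \<in> fiber L q \<Longrightarrow> herm L (ladd L l l') l'' = herm L l l'' + herm L l' l''"
    and "herm L (lscale L z l) l' = z * herm L l l'"
    and "herm L l' l = cnj (herm L l l')"
    and "l \<noteq> lscale L 0 l \<Longrightarrow> 0 < Re (herm L l l)"
  using assms unfolding hermitian_line_bundle_def by blast+

lemma bundle_triv_exists:
  assumes "hermitian_line_bundle B L" "q \<in> mcarrier B"
  obtains U \<tau> where "(U, \<tau>) \<in> trivs L" "q \<in> U"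
proof -
  have "(\<Union>(U, \<tau>)\<in>trivs L. U) = mcarrier B" using assms(1) unfolding hermitian_line_bundle_def by blast
  then show ?thesis using assms(2) that by blast
qed

lemma fiber_eqI:
  assumes "hermitian_line_bundle B L" "(U, \<tau>) \<in> trivs L" "q \<in> U" "l \<in> fiber L q" "l' \<in> fiber L q" "\<tau>
      l = \<tau> l'"
  shows "l = l'"
  using bundle_trivs(3)[OF assms(1-3)] assms(4-6) by (auto simp: bij_betw_def dest: inj_onD)

lemma frame_fiber:
  assumes "hermitian_line_bundle B L" "(U, \<tau>) \<in> trivs L" "q \<in> U"
  shows "frame L \<tau> q \<in> fiber L q" "\<tau> (frame L \<tau> q) = 1"
proof -
  have "1 \<in> \<tau> ` fiber L q" using bundle_trivs(3)[OF assms] by (simp add: bij_betw_def)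
  then show "frame L \<tau> q \<in> fiber L q" "\<tau> (frame L \<tau> q) = 1"
    unfolding frame_def by (rule inv_into_into, rule f_inv_into_f)
qed

lemma lscale_frame:
  assumes "hermitian_line_bundle B L" "(U, \<tau>) \<in> trivs L" "q \<in> U" "l \<in> fiber L q"
  shows "lscale L (\<tau> l) (frame L \<tau> q) = l"
proof (rule fiber_eqI[OF assms(1-3) _ assms(4)])
  note q = subsetD[OF bundle_trivs(2)[OF assms(1,2)] assms(3)]
  show "lscale L (\<tau> l) (frame L \<tau> q) \<in> fiber L q"
    by (rule bundle_fiber(2)[OF assms(1) q frame_fiber(1)[OF assms(1-3)]])
  show "\<tau> (lscale L (\<tau> l) (frame L \<tau> q)) = \<tau> l"
    using frame_fiber[OF assms(1-3)] by (simp add: bundle_trivs(5)[OF assms(1-3)])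
qed

lemma herm_in_triv:
  assumes L: "hermitian_line_bundle B L" "(U, \<tau>) \<in> trivs L" "q \<in> U" and l: "l \<in> fiber L q" "l' \<in>
      fiber L q"
  shows "herm L l l' = \<tau> l * cnj (\<tau> l') * herm L (frame L \<tau> q) (frame L \<tau> q)"
proof -
  note q = subsetD[OF bundle_trivs(2)[OF L(1,2)] L(3)]
  note e = frame_fiber(1)[OF L]
  have "herm L l l' = herm L (lscale L (\<tau> l) (frame L \<tau> q)) l'"
    by (simp add: lscale_frame[OF L l(1)])
  also have "\<dots> = \<tau> l * cnj (herm L l' (frame L \<tau> q))"
    by (simp add: bundle_herm(2)[OF L(1) q e l(2)] bundle_herm(3)[OF L(1) q l(2) e, symmetric])
  also have "herm L l' (frame L \<tau> q) = herm L (lscale L (\<tau> l') (frame L \<tau> q)) (frame L \<tau> q)"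
    by (simp add: lscale_frame[OF L l(2)])
  also have "\<dots> = \<tau> l' * herm L (frame L \<tau> q) (frame L \<tau> q)"
    by (simp add: bundle_herm(2)[OF L(1) q e e])
  also have "cnj \<dots> = cnj (\<tau> l') * herm L (frame L \<tau> q) (frame L \<tau> q)"
    by (simp add: bundle_herm(3)[OF L(1) q e e, symmetric])
  finally show ?thesis by simp
qed

lemma smooth_section_frame:
  assumes "hermitian_line_bundle B L" "(U, \<tau>) \<in> trivs L"
  shows "smooth_section B L U (frame L \<tau>)"
  using bundle_transition[OF assms] frame_fiber[OF assms] by (auto simp: smooth_section_def comp_def)

lemma smooth_section_subset: "smooth_section B L U s \<Longrightarrow> V \<subseteq> U \<Longrightarrow> smooth_section B L V s"
  unfolding smooth_section_def by (fast intro: smooth_fun_on_subset)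

lemma smooth_section_component:
  "smooth_section B L U s \<Longrightarrow> (V, \<tau>) \<in> trivs L \<Longrightarrow> smooth_fun_on B (U \<inter> V) (\<lambda>q. \<tau> (s q))"
  by (auto simp: smooth_section_def comp_def)

lemma smooth_section_fiber: "smooth_section B L U s \<Longrightarrow> q \<in> U \<Longrightarrow> s q \<in> fiber L q"
  by (simp add: smooth_section_def)

lemma smooth_section_ladd:
  assumes B: "smooth_manifold B" and L: "hermitian_line_bundle B L" and U: "open U" "U \<subseteq> mcarrier B"
    and s: "smooth_section B L U s" and t: "smooth_section B L U t"
  shows "smooth_section B L U (\<lambda>q. ladd L (s q) (t q))"
proof -
  have "smooth_fun_on B (U \<inter> V) (\<lambda>q. \<tau> (ladd L (s q) (t q)))" if V: "(V, \<tau>) \<in> trivs L" for V \<tau>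
  proof (rule smooth_fun_on_cong[OF B])
    show UV: "open (U \<inter> V)" using U(1) bundle_trivs(1)[OF L V] by (rule open_Int)
    show "smooth_fun_on B (U \<inter> V) (\<lambda>q. \<tau> (s q) + \<tau> (t q))"
      by (rule smooth_fun_on_add[OF B UV smooth_section_component[OF s V]
          smooth_section_component[OF t V]])
    show "\<tau> (s q) + \<tau> (t q) = \<tau> (ladd L (s q) (t q))" if "q \<in> U \<inter> V" for q
      using that bundle_trivs(4)[OF L V _ smooth_section_fiber[OF s] smooth_section_fiber[OF t]] by simp
  qed
  then show ?thesis
    using U(2) smooth_section_fiber[OF s] smooth_section_fiber[OF t]
    by (auto simp: smooth_section_def comp_def intro!: bundle_fiber(1)[OF L])
qed

lemma smooth_section_lscale:
  assumes B: "smooth_manifold B" and L: "hermitian_line_bundle B L" and U: "open U" "U \<subseteq> mcarrier B"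
    and s: "smooth_section B L U s" and f: "smooth_fun_on B U f"
  shows "smooth_section B L U (\<lambda>q. lscale L (f q) (s q))"
proof -
  have "smooth_fun_on B (U \<inter> V) (\<lambda>q. \<tau> (lscale L (f q) (s q)))" if V: "(V, \<tau>) \<in> trivs L" for V \<tau>
  proof (rule smooth_fun_on_cong[OF B])
    show UV: "open (U \<inter> V)" using U(1) bundle_trivs(1)[OF L V] by (rule open_Int)
    show "smooth_fun_on B (U \<inter> V) (\<lambda>q. f q * \<tau> (s q))"
      by (rule smooth_fun_on_mult[OF B UV smooth_fun_on_subset[OF f]
          smooth_section_component[OF s V]]) simp
    show "f q * \<tau> (s q) = \<tau> (lscale L (f q) (s q))" if "q \<in> U \<inter> V" for q
      using that bundle_trivs(5)[OF L V _ smooth_section_fiber[OF s]] by simp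
  qed
  then show ?thesis
    using U(2) smooth_section_fiber[OF s]
    by (auto simp: smooth_section_def comp_def intro!: bundle_fiber(2)[OF L])
qed

section \<open>Connections in local trivialisations\<close>

lemma connectionD:
  assumes nab: "connection B L nab" and U: "open U" "U \<subseteq> mcarrier B" and s: "smooth_section B L U s"
  shows "p \<in> U \<Longrightarrow> v \<in> tangent_space B p \<Longrightarrow> nab s p v \<in> fiber L p"
    and "p \<in> U \<Longrightarrow> v \<in> tangent_space B p \<Longrightarrow> w \<in> tangent_space B p \<Longrightarrow> nab s p (tv_lin a v b w) =
      ladd L (lscale L (of_real a) (nab s p v)) (lscale L (of_real b) (nab s p w))"
    and "p \<in> U \<Longrightarrow> v \<in> tangent_space B p \<Longrightarrow> smooth_fun_on B U f \<Longrightarrow> nab (\<lambda>q. lscale L (f q) (s q)) p v =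
      ladd L (lscale L (fun_deriv B f p v) (s p)) (lscale L (f p) (nab s p v))"
    and "p \<in> U \<Longrightarrow> v \<in> tangent_space B p \<Longrightarrow> smooth_section B L U t \<Longrightarrow> (\<And>q. q \<in> U \<Longrightarrow> s q = t q) \<Longrightarrow>
      nab s p v = nab t p v"
    and "c \<in> B \<Longrightarrow> smooth_section B L (U \<inter> fst c) (\<lambda>q. nab s q (coord_tvec B c q u))"
proof -
  have all: "(\<forall>p\<in>U. \<forall>v\<in>tangent_space B p. \<forall>w\<in>tangent_space B p.
          nab s p v \<in> fiber L p \<and>
          (\<forall>a b. nab s p (tv_lin a v b w) =
             ladd L (lscale L (of_real a) (nab s p v)) (lscale L (of_real b) (nab s p w))) \<and>
          nab (\<lambda>q. ladd L (s q) (t q)) p v = ladd L (nab s p v) (nab t p v) \<and>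
          nab (\<lambda>q. lscale L (f q) (s q)) p v =
            ladd L (lscale L (fun_deriv B f p v) (s p)) (lscale L (f p) (nab s p v)) \<and>
          ((\<forall>q\<in>U. s q = t q) \<longrightarrow> nab s p v = nab t p v)) \<and>
       (\<forall>c\<in>B. \<forall>u. smooth_section B L (U \<inter> fst c) (\<lambda>q. nab s q (coord_tvec B c q u)))"
    if "smooth_section B L U t" "smooth_fun_on B U f" for t f
    using nab[unfolded connection_def, rule_format, of U s t f] U s that by blast
  note one = all[OF s smooth_fun_on_const[of B U 0]]
  show "p \<in> U \<Longrightarrow> v \<in> tangent_space B p \<Longrightarrow> nab s p v \<in> fiber L p"
    "p \<in> U \<Longrightarrow> v \<in> tangent_space B p \<Longrightarrow> w \<in> tangent_space B p \<Longrightarrow> nab s p (tv_lin a v b w) =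
      ladd L (lscale L (of_real a) (nab s p v)) (lscale L (of_real b) (nab s p w))"
    "c \<in> B \<Longrightarrow> smooth_section B L (U \<inter> fst c) (\<lambda>q. nab s q (coord_tvec B c q u))"
    using one by blast+
  show "p \<in> U \<Longrightarrow> v \<in> tangent_space B p \<Longrightarrow> smooth_fun_on B U f \<Longrightarrow> nab (\<lambda>q. lscale L (f q) (s q)) p v =
      ladd L (lscale L (fun_deriv B f p v) (s p)) (lscale L (f p) (nab s p v))"
    using all[OF s] by blast
  show "p \<in> U \<Longrightarrow> v \<in> tangent_space B p \<Longrightarrow> smooth_section B L U t \<Longrightarrow> (\<And>q. q \<in> U \<Longrightarrow> s q = t q) \<Longrightarrow>
      nab s p v = nab t p v"
    using all[OF _ smooth_fun_on_const[of B U 0]] by blast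
qed

text \<open>The form \<open>\<alpha>\<close> with \<open>nab e = \<alpha> \<otimes> e\<close> for the frame \<open>e\<close> of the trivialisation \<open>\<tau>\<close>; it is
  meaningful only over the domain of \<open>\<tau>\<close>.\<close>

definition connection_form ::
  "('n, 'l) line_bundle \<Rightarrow> ('n, 'b, 'l) conn \<Rightarrow> ('l \<Rightarrow> complex) \<Rightarrow> ('n, 'b, complex) form" where
  "connection_form L nab \<tau> q vs = \<tau> (nab (frame L \<tau>) q (hd vs))"

lemma connection_form_smooth:
  assumes B: "smooth_manifold B" and L: "hermitian_line_bundle B L" and nab: "connection B L nab"
      and U: "(U, \<tau>) \<in> trivs L"
  shows "smooth_form_on B U 1 (connection_form L nab \<tau>)"
proof -
  note U' = bundle_trivs(1,2)[OF L U] and e = smooth_section_frame[OF L U]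
  note D = connectionD[OF nab U' e]
  have "alt_multilinear (tangent_space B q) 1 (connection_form L nab \<tau> q)" if q: "q \<in> U" for q
  proof -
    have "\<tau> (nab (frame L \<tau>) q (tv_lin r u s w)) = r *\<^sub>R \<tau> (nab (frame L \<tau>) q u) +
        s *\<^sub>R \<tau> (nab (frame L \<tau>) q w)"
      if "u \<in> tangent_space B q" "w \<in> tangent_space B q" for u w r s
      using D(1)[OF q] q that U' bundle_fiber(2)[OF L]
      by (simp add: D(2)[OF q that] bundle_trivs(4,5)[OF L U q] subset_iff scaleR_conv_of_real)
    then show ?thesis
      by (auto simp: alt_multilinear_def connection_form_def length_Suc_conv)
  qed
  moreover have "smooth_on (snd c ` (fst c \<inter> U)) (\<lambda>x. coord_rep B c (connection_form L nab \<tau>) x us)"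
    if c: "c \<in> B" and us: "length us = 1" for c us
  proof -
    obtain u where u: "us = [u]" using us by (auto simp: length_Suc_conv)
    have "smooth_fun_on B (U \<inter> fst c \<inter> U) (\<lambda>q. \<tau> (nab (frame L \<tau>) q (coord_tvec B c q u)))"
      by (rule smooth_section_component[OF D(5)[OF c] U])
    then have "smooth_on (snd c ` (fst c \<inter> (U \<inter> fst c \<inter> U))) (\<lambda>x. coord_rep B c (connection_form L
        nab \<tau>) x us)"
      using c by (simp add: smooth_fun_on_def u coord_rep_def connection_form_def comp_def)
    then show ?thesis by (rule smooth_on_subset) auto
  qed
  ultimately show ?thesis by (simp add: smooth_form_on_def)
qed

text \<open>A section is \<open>g e\<close> with \<open>e\<close> the frame and \<open>g = \<tau> \<circ> s\<close>, so that this is the Leibniz rule.\<close>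

lemma connection_in_triv:
  assumes B: "smooth_manifold B" and L: "hermitian_line_bundle B L" and nab: "connection B L nab"
    and U: "open U" "U \<subseteq> mcarrier B" and s: "smooth_section B L U s" and V: "(V, \<tau>) \<in> trivs L"
    and q: "q \<in> U" "q \<in> V" and v: "v \<in> tangent_space B q"
  shows "\<tau> (nab s q v) = fun_deriv B (\<lambda>q. \<tau> (s q)) q v + \<tau> (s q) * connection_form L nab \<tau> q [v]"
proof -
  note V' = bundle_trivs(1,2)[OF L V]
  have W: "open (U \<inter> V)" "U \<inter> V \<subseteq> mcarrier B" and qW: "q \<in> U \<inter> V" using U V' q by auto
  note e = smooth_section_subset[OF smooth_section_frame[OF L V], of "U \<inter> V", simplified]
  note s' = smooth_section_subset[OF s, of "U \<inter> V", simplified]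
  note sm = smooth_section_component[OF s V]
  note E = connectionD[OF nab W e]
  note ef = frame_fiber[OF L V q(2)] and qB = subsetD[OF W(2) qW]
  have "nab s q v = nab (\<lambda>q. lscale L (\<tau> (s q)) (frame L \<tau> q)) q v"
  proof (rule connectionD(4)[OF nab W s' qW v])
    show "smooth_section B L (U \<inter> V) (\<lambda>q. lscale L (\<tau> (s q)) (frame L \<tau> q))"
      by (rule smooth_section_lscale[OF B L W e sm])
    show "s q = lscale L (\<tau> (s q)) (frame L \<tau> q)" if "q \<in> U \<inter> V" for q
      using that lscale_frame[OF L V] smooth_section_fiber[OF s] by simp
  qed
  also have "\<dots> = ladd L (lscale L (fun_deriv B (\<lambda>q. \<tau> (s q)) q v) (frame L \<tau> q)) (lscale L (\<tau> (s q))
      (nab (frame L \<tau>) q v))"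
    by (rule E(3)[OF qW v sm])
  finally show ?thesis
    using ef E(1)[OF qW v] bundle_fiber(2)[OF L qB]
    by (simp add: bundle_trivs(4,5)[OF L V q(2)] connection_form_def)
qed

section \<open>Pull-back of line bundles with connection\<close>

lemma bundle_herm_smooth:
  assumes "hermitian_line_bundle B L" "(U, \<tau>) \<in> trivs L"
  shows "smooth_fun_on B U (\<lambda>p. herm L (frame L \<tau> p) (frame L \<tau> p))"
  using assms unfolding hermitian_line_bundle_def by blast

context
  fixes A :: "('m::{t2_space, second_countable_topology}, 'a::real_normed_vector) atlas"
    and B :: "('n::{t2_space, second_countable_topology}, 'b::real_normed_vector) atlas"
    and f :: "'m \<Rightarrow> 'n" and L :: "('n, 'l) line_bundle"
  assumes f: "smooth_manifold_map A B f" and L: "hermitian_line_bundle B L"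
begin

abbreviation (input) "fL \<equiv> pullback_bundle A f L"

lemmas dom_manifold = smooth_manifold_mapD(1)[OF f]
lemmas cod_manifold = smooth_manifold_mapD(2)[OF f]
lemmas map_carrier = smooth_manifold_mapD(4)[OF f]

lemma fiber_pullback: "p \<in> mcarrier A \<Longrightarrow> fiber fL p = Pair p ` fiber L (f p)"
  by (auto simp: fiber_def pullback_bundle_def)

lemma fiber_pullback_iff: "p \<in> mcarrier A \<Longrightarrow> x \<in> fiber fL p \<longleftrightarrow> fst x = p \<and> snd x \<in> fiber L (f p)"
  by (cases x) (auto simp: fiber_pullback)

lemma pullback_bundle_simps:
  "ladd fL x y = (fst x, ladd L (snd x) (snd y))" "lscale fL z x = (fst x, lscale L z (snd x))"
  "herm fL x y = herm L (snd x) (snd y)"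
  "trivs fL = {(mcarrier A \<inter> f -` U, \<tau> \<circ> snd) | U \<tau>. (U, \<tau>) \<in> trivs L}"
  by (simp_all add: pullback_bundle_def)

lemma pullback_triv: "(U, \<tau>) \<in> trivs L \<Longrightarrow> (mcarrier A \<inter> f -` U, \<tau> \<circ> snd) \<in> trivs fL"
  by (auto simp: pullback_bundle_simps)

lemma bij_betw_pullback_triv:
  assumes "p \<in> mcarrier A" "bij_betw \<tau> (fiber L (f p)) UNIV"
  shows "bij_betw (\<tau> \<circ> snd) (fiber fL p) UNIV"
proof (rule bij_betw_trans[OF _ assms(2)])
  show "bij_betw snd (fiber fL p) (fiber L (f p))"
    by (rule bij_betw_byWitness[where f' = "Pair p"]) (auto simp: fiber_pullback[OF assms(1)])
qed

lemma frame_pullback: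
  assumes "(U, \<tau>) \<in> trivs L" "p \<in> mcarrier A" "f p \<in> U"
  shows "frame fL (\<tau> \<circ> snd) p = (p, frame L \<tau> (f p))"
  unfolding frame_def[of fL]
proof (rule inv_into_f_eq)
  show "inj_on (\<tau> \<circ> snd) (fiber fL p)"
    using bij_betw_pullback_triv[OF assms(2) bundle_trivs(3)[OF L assms(1,3)]]
        by (simp add: bij_betw_def)
  show "(p, frame L \<tau> (f p)) \<in> fiber fL p"
    using frame_fiber(1)[OF L assms(1,3)] by (simp add: fiber_pullback_iff[OF assms(2)])
  show "(\<tau> \<circ> snd) (p, frame L \<tau> (f p)) = 1"
    using frame_fiber(2)[OF L assms(1,3)] by simp
qed

lemma pullback_bundle_hermitian: "hermitian_line_bundle A fL"
  unfolding hermitian_line_bundle_def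
proof (intro conjI)
  show "proj fL ` total fL \<subseteq> mcarrier A"
    by (auto simp: pullback_bundle_def)
  show "\<forall>p\<in>mcarrier A. \<forall>l\<in>fiber fL p. \<forall>l'\<in>fiber fL p. \<forall>z. ladd fL l l' \<in> fiber fL p \<and>
      lscale fL z l \<in> fiber fL p"
    by (auto simp: fiber_pullback pullback_bundle_simps bundle_fiber[OF L map_carrier])
  show "(\<Union>(U, \<tau>)\<in>trivs fL. U) = mcarrier A"
  proof
    show "mcarrier A \<subseteq> (\<Union>(U, \<tau>)\<in>trivs fL. U)"
    proof
      fix p assume p: "p \<in> mcarrier A"
      obtain U \<tau> where U: "(U, \<tau>) \<in> trivs L" "f p \<in> U" by (rule bundle_triv_exists[OF L
          map_carrier[OF p]])
      then have "p \<in> mcarrier A \<inter> f -` U" using p by simp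
      then show "p \<in> (\<Union>(U, \<tau>)\<in>trivs fL. U)" using pullback_triv[OF U(1)] by blast
    qed
  qed (auto simp: pullback_bundle_simps)
  show "\<forall>(V, \<sigma>)\<in>trivs fL. open V \<and> (\<forall>p\<in>V. bij_betw \<sigma> (fiber fL p) UNIV \<and>
      (\<forall>l\<in>fiber fL p. \<forall>l'\<in>fiber fL p. \<forall>z. \<sigma> (ladd fL l l') = \<sigma> l + \<sigma> l' \<and> \<sigma> (lscale fL z l) = z * \<sigma> l))"
  proof (clarify, intro conjI ballI allI)
    fix V \<sigma> assume "(V, \<sigma>) \<in> trivs fL"
    then obtain U \<tau> where U: "(U, \<tau>) \<in> trivs L" and V: "V = mcarrier A \<inter> f -` U" "\<sigma> = \<tau> \<circ> snd"
      by (auto simp: pullback_bundle_simps)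
    show "open V" unfolding V by (rule open_preimage[OF f bundle_trivs(1)[OF L U]])
    fix p assume "p \<in> V"
    then have p: "p \<in> mcarrier A" "f p \<in> U" by (auto simp: V)
    show "bij_betw \<sigma> (fiber fL p) UNIV"
      unfolding V by (rule bij_betw_pullback_triv[OF p(1) bundle_trivs(3)[OF L U p(2)]])
    fix l l' z assume "l \<in> fiber fL p" "l' \<in> fiber fL p"
    then show "\<sigma> (ladd fL l l') = \<sigma> l + \<sigma> l'" "\<sigma> (lscale fL z l) = z * \<sigma> l"
      by (auto simp: V fiber_pullback[OF p(1)] pullback_bundle_simps bundle_trivs(4,5)[OF L U p(2)])
  qed
  show "\<forall>(V, \<sigma>)\<in>trivs fL. \<forall>(V', \<sigma>')\<in>trivs fL. smooth_fun_on A (V \<inter> V') (\<lambda>p. \<sigma>' (frame fL \<sigma> p))"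
  proof clarify
    fix V \<sigma> V' \<sigma>' assume "(V, \<sigma>) \<in> trivs fL" "(V', \<sigma>') \<in> trivs fL"
    then obtain U \<tau> U' \<tau>' where U: "(U, \<tau>) \<in> trivs L" "(U', \<tau>') \<in> trivs L"
      and V: "V = mcarrier A \<inter> f -` U" "\<sigma> = \<tau> \<circ> snd" "V' = mcarrier A \<inter> f -` U'" "\<sigma>' = \<tau>' \<circ> snd"
      by (auto simp: pullback_bundle_simps)
    note UU = open_Int[OF bundle_trivs(1)[OF L U(1)] bundle_trivs(1)[OF L U(2)]]
    have "smooth_fun_on A (V \<inter> V') (\<lambda>p. \<tau>' (frame L \<tau> (f p)))"
      by (rule smooth_fun_on_compose[OF f UU bundle_transition[OF L U]]) (auto simp: V)
    then show "smooth_fun_on A (V \<inter> V') (\<lambda>p. \<sigma>' (frame fL \<sigma> p))"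
    proof (rule smooth_fun_on_cong[OF dom_manifold, rotated])
      show "open (V \<inter> V')"
        unfolding V using bundle_trivs(1)[OF L U(1)] bundle_trivs(1)[OF L U(2)]
            by (intro open_Int open_preimage[OF f])
    qed (auto simp: V frame_pullback[OF U(1)])
  qed
  show "\<forall>p\<in>mcarrier A. \<forall>l\<in>fiber fL p. \<forall>l'\<in>fiber fL p. \<forall>l''\<in>fiber fL p. \<forall>z.
      herm fL (ladd fL l l') l'' = herm fL l l'' + herm fL l' l'' \<and> herm fL (lscale fL z l) l' =
          z * herm fL l l' \<and>
      herm fL l' l = cnj (herm fL l l') \<and> (l \<noteq> lscale fL 0 l \<longrightarrow> 0 < Re (herm fL l l))"
  proof (intro ballI allI)
    fix p x x' x'' z assume p: "p \<in> mcarrier A" and "x \<in> fiber fL p" "x' \<in> fiber fL p" "x'' \<in> fiber fL p"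
    then obtain l l' l'' where "x = (p, l)" "x' = (p, l')" "x'' = (p, l'')"
      and l: "l \<in> fiber L (f p)" "l' \<in> fiber L (f p)" "l'' \<in> fiber L (f p)"
      by (auto simp: fiber_pullback[OF p])
    then show "herm fL (ladd fL x x') x'' = herm fL x x'' + herm fL x' x'' \<and>
        herm fL (lscale fL z x) x' = z * herm fL x x' \<and>
        herm fL x' x = cnj (herm fL x x') \<and> (x \<noteq> lscale fL 0 x \<longrightarrow> 0 < Re (herm fL x x))"
      using bundle_herm[OF L map_carrier[OF p] l(1,2)] l(3) by (simp add: pullback_bundle_simps)
  qed
  show "\<forall>(V, \<sigma>)\<in>trivs fL. smooth_fun_on A V (\<lambda>p. herm fL (frame fL \<sigma> p) (frame fL \<sigma> p))"
  proof clarify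
    fix V \<sigma> assume "(V, \<sigma>) \<in> trivs fL"
    then obtain U \<tau> where U: "(U, \<tau>) \<in> trivs L" and V: "V = mcarrier A \<inter> f -` U" "\<sigma> = \<tau> \<circ> snd"
      by (auto simp: pullback_bundle_simps)
    have "smooth_fun_on A V (\<lambda>p. herm L (frame L \<tau> (f p)) (frame L \<tau> (f p)))"
      by (rule smooth_fun_on_compose[OF f bundle_trivs(1)[OF L U]
          bundle_herm_smooth[OF L U]]) (auto simp: V)
    then show "smooth_fun_on A V (\<lambda>p. herm fL (frame fL \<sigma> p) (frame fL \<sigma> p))"
      by (rule smooth_fun_on_cong[OF dom_manifold, rotated])
         (auto simp: V frame_pullback[OF U] pullback_bundle_simps intro: open_preimage[OF f
             bundle_trivs(1)[OF L U]])
  qed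
qed

lemma pullback_section_component:
  assumes "smooth_section A fL U s" "(V, \<tau>) \<in> trivs L" "U \<subseteq> mcarrier A"
  shows "smooth_fun_on A (U \<inter> f -` V) (\<lambda>q. \<tau> (snd (s q)))"
proof -
  have "U \<inter> (mcarrier A \<inter> f -` V) = U \<inter> f -` V" using assms(3) by auto
  then show ?thesis using smooth_section_component[OF assms(1) pullback_triv[OF assms(2)]] by simp
qed

context
  fixes nab :: "('n, 'b, 'l) conn"
  assumes nab: "connection B L nab"
begin

abbreviation (input) "fnab \<equiv> pullback_conn A B f L nab"

text \<open>The definition of the pulled-back connection uses some local trivialisation. Here it is
  computed in every one: with \<open>e\<^sub>0\<close> the frame that was used and \<open>e\<^sub>0 = h e\<close>, the components of a
  section are related by \<open>g = g\<^sub>0 (h \<circ> f)\<close>, and the two Leibniz rules for this product, upstairs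
  and downstairs, produce the same terms.\<close>

lemma pullback_conn_in_triv:
  assumes U: "open U" "U \<subseteq> mcarrier A" and s: "smooth_section A fL U s" and V: "(V, \<tau>) \<in> trivs L"
    and p: "p \<in> U" "f p \<in> V" and v: "v \<in> tangent_space A p"
  shows "fnab s p v \<in> fiber fL p"
    and "\<tau> (snd (fnab s p v)) = fun_deriv A (\<lambda>q. \<tau> (snd (s q))) p v +
      \<tau> (snd (s p)) * connection_form L nab \<tau> (f p) [tmap A B f p v]"
proof -
  note pA = subsetD[OF U(2) p(1)]
  define z where "z = (SOME z. z \<in> trivs L \<and> f p \<in> fst z)"
  obtain U1 \<tau>1 where "(U1, \<tau>1) \<in> trivs L" "f p \<in> U1" by (rule bundle_triv_exists[OF L map_carrier[OF
      pA]])
  then have "z \<in> trivs L \<and> f p \<in> fst z"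
    unfolding z_def by (intro someI_ex[of "\<lambda>z. z \<in> trivs L \<and> f p \<in> fst z"]) auto
  then obtain U0 \<tau>0 where z: "z = (U0, \<tau>0)" and U0: "(U0, \<tau>0) \<in> trivs L" "f p \<in> U0" by (cases z) auto
  define g0 where "g0 q = \<tau>0 (snd (s q))" for q
  define h where "h q = \<tau> (frame L \<tau>0 q)" for q
  define w where "w = tmap A B f p v"
  have w: "w \<in> tangent_space B (f p)" unfolding w_def by (rule tmap_in_tangent_space[OF f v pA])
  note fr = frame_fiber(1)[OF L U0]
  note sec0 = smooth_section_frame[OF L U0(1)]
  note op0 = bundle_trivs(1,2)[OF L U0(1)]
  have nfib: "nab (frame L \<tau>0) (f p) w \<in> fiber L (f p)"
    by (rule connectionD(1)[OF nab op0 sec0 U0(2) w])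
  note sc = bundle_fiber(2)[OF L map_carrier[OF pA]]
  have eq: "fnab s p v = (p, ladd L (lscale L (fun_deriv A g0 p v) (frame L \<tau>0 (f p)))
      (lscale L (g0 p) (nab (frame L \<tau>0) (f p) w)))"
    unfolding pullback_conn_def Let_def z_def[symmetric] z snd_conv w_def g0_def ..
  show "fnab s p v \<in> fiber fL p"
    unfolding eq fiber_pullback_iff[OF pA] fst_conv snd_conv
    using bundle_fiber(1)[OF L map_carrier[OF pA] sc[OF fr] sc[OF nfib]] by simp
  define N where "N = U \<inter> (f -` V \<inter> f -` U0)"
  have opN: "open N"
  proof -
    have "open (U \<inter> (mcarrier A \<inter> f -` (V \<inter> U0)))"
      using U(1) open_preimage[OF f open_Int[OF bundle_trivs(1)[OF L V] op0(1)]] by (rule open_Int)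
    moreover have "U \<inter> (mcarrier A \<inter> f -` (V \<inter> U0)) = N" using U(2) by (auto simp: N_def)
    ultimately show ?thesis by simp
  qed
  have pN: "p \<in> N" using p U0 by (simp add: N_def)
  have g0: "smooth_fun_on A N g0"
    unfolding g0_def by (rule smooth_fun_on_subset[OF pullback_section_component[OF s U0(1) U(2)]])
        (auto simp: N_def)
  have h: "smooth_fun_on B (U0 \<inter> V) h"
    unfolding h_def by (rule bundle_transition[OF L U0(1) V])
  have hf: "smooth_fun_on A N (\<lambda>q. h (f q))"
    by (rule smooth_fun_on_compose[OF f open_Int[OF op0(1) bundle_trivs(1)[OF L V]]
        h]) (auto simp: N_def)
  have sval: "\<tau> (snd (s q)) = g0 q * h (f q)" if "q \<in> N" for q
  proof -
    have q: "q \<in> mcarrier A" "f q \<in> V" "f q \<in> U0" using that U(2) by (auto simp: N_def)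
    have "snd (s q) \<in> fiber L (f q)"
      using smooth_section_fiber[OF s, of q] that fiber_pullback_iff[OF q(1)] by (simp add: N_def)
    from lscale_frame[OF L U0(1) q(3) this] have "snd (s q) = lscale L (g0 q) (frame L \<tau>0 (f q))"
      by (simp add: g0_def)
    then show ?thesis
      by (simp add: bundle_trivs(5)[OF L V q(2) frame_fiber(1)[OF L U0(1) q(3)]] h_def)
  qed
  have "fun_deriv A (\<lambda>q. \<tau> (snd (s q))) p v = fun_deriv A (\<lambda>q. g0 q * h (f q)) p v"
    by (rule fun_deriv_cong[OF dom_manifold opN pN pA]) (rule sval)
  also have "\<dots> = fun_deriv A g0 p v * h (f p) + g0 p * fun_deriv A (\<lambda>q. h (f q)) p v"
    by (rule fun_deriv_mult[OF dom_manifold g0 hf pN pA])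
  also have "fun_deriv A (\<lambda>q. h (f q)) p v = fun_deriv B h (f p) w"
    unfolding w_def
    using fun_deriv_compose[OF f pA v chart_at[OF map_carrier[OF pA]]]
      smooth_fun_on_differentiable[OF h chart_at[OF map_carrier[OF pA]]] U0 p by simp
  finally have D: "fun_deriv A (\<lambda>q. \<tau> (snd (s q))) p v = fun_deriv A g0 p v * h (f p) +
      g0 p * fun_deriv B h (f p) w" .
  have "\<tau> (nab (frame L \<tau>0) (f p) w) = fun_deriv B h (f p) w +
      h (f p) * connection_form L nab \<tau> (f p) [w]"
    unfolding h_def by (rule connection_in_triv[OF cod_manifold L nab op0 sec0 V U0(2) p(2) w])
  then show "\<tau> (snd (fnab s p v)) = fun_deriv A (\<lambda>q. \<tau> (snd (s q))) p v +
      \<tau> (snd (s p)) * connection_form L nab \<tau> (f p) [tmap A B f p v]"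
    unfolding eq D sval[OF pN] w_def[symmetric]
    by (simp add: bundle_trivs(4)[OF L V p(2) sc[OF fr] sc[OF nfib]] bundle_trivs(5)[OF L V p(2) fr]
        bundle_trivs(5)[OF L V p(2) nfib] h_def[symmetric] algebra_simps)
qed

text \<open>The pulled-back frame has the constant component \<open>1\<close>, so that its covariant derivative has
  no derivative term.\<close>

lemma connection_form_pullback:
  assumes V: "(V, \<tau>) \<in> trivs L" and p: "p \<in> mcarrier A" "f p \<in> V" and v: "v \<in> tangent_space A p"
  shows "connection_form fL fnab (\<tau> \<circ> snd) p [v] = connection_form L nab \<tau> (f p) [tmap A B f p v]"
proof -
  note V' = pullback_triv[OF V] and op = open_preimage[OF f bundle_trivs(1)[OF L V]]
  have pV: "p \<in> mcarrier A \<inter> f -` V" using p by simp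
  have one: "\<tau> (snd (frame fL (\<tau> \<circ> snd) q)) = 1" if "q \<in> mcarrier A \<inter> f -` V" for q
    using frame_fiber(2)[OF pullback_bundle_hermitian V' that] by simp
  have "fun_deriv A (\<lambda>q. \<tau> (snd (frame fL (\<tau> \<circ> snd) q))) p v = 0"
    using fun_deriv_cong[OF dom_manifold op pV p(1), of "\<lambda>q. \<tau> (snd (frame fL (\<tau> \<circ> snd) q))" "\<lambda>q. 1" v]
    by (simp add: one fun_deriv_const)
  then show ?thesis
    using pullback_conn_in_triv(2)[OF op _ smooth_section_frame[OF pullback_bundle_hermitian V']
        V pV p(2) v] one[OF pV]
    by (simp add: connection_form_def)
qed

lemma connection_form_lin:
  assumes "(V, \<tau>) \<in> trivs L" "q \<in> V" "u \<in> tangent_space B q" "w \<in> tangent_space B q"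
  shows "connection_form L nab \<tau> q [tv_lin a u b w] =
    a *\<^sub>R connection_form L nab \<tau> q [u] + b *\<^sub>R connection_form L nab \<tau> q [w]"
proof -
  have "q \<in> mcarrier B" using bundle_trivs(2)[OF L assms(1)] assms(2) by auto
  then have alt: "alt_multilinear (tangent_space B q) 1 (connection_form L nab \<tau> q)"
    using connection_form_smooth[OF cod_manifold L nab assms(1)] assms(2)
        by (simp add: smooth_form_on_def)
  show ?thesis
    using alt_multilinearD(1)[OF alt, of "[u]" 0 u w a b] assms(3,4) by simp
qed

text \<open>Each axiom is an identity in a fibre, and is checked on the components in one
  trivialisation, where the covariant derivative is \<open>dg + g \<theta>\<close>.\<close>

lemma pullback_connection: "connection A fL fnab"
  unfolding connection_def
proof (intro allI impI)
  fix U and s t :: "'m \<Rightarrow> 'm \<times> 'l" and h :: "'m \<Rightarrow> complex"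
  assume "open U \<and> U \<subseteq> mcarrier A \<and> smooth_section A fL U s \<and> smooth_section A fL U t \<and>
      smooth_fun_on A U h"
  then have U: "open U" "U \<subseteq> mcarrier A" and s: "smooth_section A fL U s" and t: "smooth_section A
      fL U t"
    and h: "smooth_fun_on A U h" by auto
  note H = pullback_bundle_hermitian
  show "(\<forall>p\<in>U. \<forall>v\<in>tangent_space A p. \<forall>w\<in>tangent_space A p.
          fnab s p v \<in> fiber fL p \<and>
          (\<forall>a b. fnab s p (tv_lin a v b w) =
             ladd fL (lscale fL (of_real a) (fnab s p v)) (lscale fL (of_real b) (fnab s p w))) \<and>
          fnab (\<lambda>q. ladd fL (s q) (t q)) p v = ladd fL (fnab s p v) (fnab t p v) \<and>
          fnab (\<lambda>q. lscale fL (h q) (s q)) p v =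
            ladd fL (lscale fL (fun_deriv A h p v) (s p)) (lscale fL (h p) (fnab s p v)) \<and>
          ((\<forall>q\<in>U. s q = t q) \<longrightarrow> fnab s p v = fnab t p v)) \<and>
       (\<forall>c\<in>A. \<forall>u. smooth_section A fL (U \<inter> fst c) (\<lambda>q. fnab s q (coord_tvec A c q u)))"
  proof (rule conjI; intro ballI allI)
    fix p v w assume p: "p \<in> U" and v: "v \<in> tangent_space A p" and w: "w \<in> tangent_space A p"
    note pA = subsetD[OF U(2) p]
    obtain V \<tau> where V: "(V, \<tau>) \<in> trivs L" "f p \<in> V" by (rule bundle_triv_exists[OF L map_carrier[OF
        pA]])
    define \<sigma> :: "'m \<times> 'l \<Rightarrow> complex" where "\<sigma> = \<tau> \<circ> snd"
    have \<sigma>: "\<tau> (snd x) = \<sigma> x" for x by (simp add: \<sigma>_def)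
    have V': "(mcarrier A \<inter> f -` V, \<sigma>) \<in> trivs fL" and pV: "p \<in> mcarrier A \<inter> f -` V"
      using pullback_triv[OF V(1)] pA V(2) by (auto simp: \<sigma>_def)
    define N where "N = U \<inter> f -` V"
    have "N = U \<inter> (mcarrier A \<inter> f -` V)" using U(2) by (auto simp: N_def)
    then have opN: "open N" using open_Int[OF U(1) bundle_trivs(1)[OF H V']] by simp
    have pN: "p \<in> N" using p V by (simp add: N_def)
    note sm = pullback_section_component[OF s V(1) U(2), folded N_def, unfolded \<sigma>]
    note tm = pullback_section_component[OF t V(1) U(2), folded N_def, unfolded \<sigma>]
    have hN: "smooth_fun_on A N h" by (rule smooth_fun_on_subset[OF h]) (simp add: N_def)
    note sf = smooth_section_fiber[OF s] and tf = smooth_section_fiber[OF t]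
    note C = pullback_conn_in_triv[OF U _ V(1) p V(2), unfolded \<sigma>]
    define \<theta> where "\<theta> u = connection_form L nab \<tau> (f p) [tmap A B f p u]" for u
    note Cs = C(2)[OF s, folded \<theta>_def] and Ct = C(2)[OF t, folded \<theta>_def]
    note fib = C(1)[OF s] C(1)[OF t] and scaleP = bundle_fiber(2)[OF H pA] and addP =
        bundle_fiber(1)[OF H pA]
    note \<sigma>_add = bundle_trivs(4)[OF H V' pV] and \<sigma>_scale = bundle_trivs(5)[OF H V' pV]
    note eqI = fiber_eqI[OF H V' pV]
    have tl: "tv_lin a v b w \<in> tangent_space A p" for a b
        by (rule tangent_space_lin[OF dom_manifold v w])
    have \<theta>_lin: "\<theta> (tv_lin a v b w) = a *\<^sub>R \<theta> v + b *\<^sub>R \<theta> w" for a b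
      unfolding \<theta>_def tmap_lin[OF f pA]
      by (rule connection_form_lin[OF V tmap_in_tangent_space[OF f v pA]
          tmap_in_tangent_space[OF f w pA]])
    have 1: "fnab s p v \<in> fiber fL p" by (rule C(1)[OF s v])
    have 2: "fnab s p (tv_lin a v b w) =
        ladd fL (lscale fL (of_real a) (fnab s p v)) (lscale fL (of_real b) (fnab s p w))" for a b
    proof (rule eqI)
      show "\<sigma> (fnab s p (tv_lin a v b w)) =
          \<sigma> (ladd fL (lscale fL (of_real a) (fnab s p v)) (lscale fL (of_real b) (fnab s p w)))"
        unfolding \<sigma>_add[OF scaleP[OF C(1)[OF s v]] scaleP[OF C(1)[OF s w]]]
          \<sigma>_scale[OF C(1)[OF s v]] \<sigma>_scale[OF C(1)[OF s w]] Cs[OF tl] Cs[OF v] Cs[OF w]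
          fun_deriv_lin[OF sm pN pA] \<theta>_lin
        by (simp add: scaleR_conv_of_real algebra_simps)
    qed (intro addP scaleP C(1)[OF s] tl v w)+
    have 3: "fnab (\<lambda>q. ladd fL (s q) (t q)) p v = ladd fL (fnab s p v) (fnab t p v)"
    proof (rule eqI)
      note st = smooth_section_ladd[OF dom_manifold H U s t]
      show "fnab (\<lambda>q. ladd fL (s q) (t q)) p v \<in> fiber fL p" by (rule C(1)[OF st v])
      have "fun_deriv A (\<lambda>q. \<sigma> (ladd fL (s q) (t q))) p v = fun_deriv A (\<lambda>q. \<sigma> (s q) + \<sigma> (t q)) p v"
        by (rule fun_deriv_cong[OF dom_manifold opN pN pA], rule bundle_trivs(4)[OF H V'])
           (use sf tf in \<open>auto simp: N_def\<close>)
      then show "\<sigma> (fnab (\<lambda>q. ladd fL (s q) (t q)) p v) = \<sigma> (ladd fL (fnab s p v) (fnab t p v))"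
        unfolding C(2)[OF st v, folded \<theta>_def] \<sigma>_add[OF fib(1)[OF v] fib(2)[OF v]] Cs[OF v] Ct[OF v]
          \<sigma>_add[OF sf[OF p] tf[OF p]]
        by (simp add: fun_deriv_add[OF sm tm pN pA] algebra_simps)
    qed (intro addP fib v)
    have 4: "fnab (\<lambda>q. lscale fL (h q) (s q)) p v =
        ladd fL (lscale fL (fun_deriv A h p v) (s p)) (lscale fL (h p) (fnab s p v))"
    proof (rule eqI)
      note hs = smooth_section_lscale[OF dom_manifold H U s h]
      show "fnab (\<lambda>q. lscale fL (h q) (s q)) p v \<in> fiber fL p" by (rule C(1)[OF hs v])
      have "fun_deriv A (\<lambda>q. \<sigma> (lscale fL (h q) (s q))) p v = fun_deriv A (\<lambda>q. h q * \<sigma> (s q)) p v"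
        by (rule fun_deriv_cong[OF dom_manifold opN pN pA], rule bundle_trivs(5)[OF H V'])
           (use sf in \<open>auto simp: N_def\<close>)
      then show "\<sigma> (fnab (\<lambda>q. lscale fL (h q) (s q)) p v) =
          \<sigma> (ladd fL (lscale fL (fun_deriv A h p v) (s p)) (lscale fL (h p) (fnab s p v)))"
        unfolding C(2)[OF hs v, folded \<theta>_def] \<sigma>_add[OF scaleP[OF sf[OF p]] scaleP[OF fib(1)[OF v]]]
          \<sigma>_scale[OF fib(1)[OF v]] \<sigma>_scale[OF sf[OF p]] Cs[OF v]
        by (simp add: fun_deriv_mult[OF dom_manifold hN sm pN pA] algebra_simps)
    qed (intro addP scaleP fib sf p v)
    have 5: "fnab s p v = fnab t p v" if "\<forall>q\<in>U. s q = t q"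
    proof (rule eqI[OF fib(1)[OF v] fib(2)[OF v]])
      have "fun_deriv A (\<lambda>q. \<sigma> (s q)) p v = fun_deriv A (\<lambda>q. \<sigma> (t q)) p v"
        by (rule fun_deriv_cong[OF dom_manifold opN pN pA]) (use that in \<open>auto simp: N_def\<close>)
      then show "\<sigma> (fnab s p v) = \<sigma> (fnab t p v)"
        using that p unfolding Cs[OF v] Ct[OF v] by simp
    qed
    show "fnab s p v \<in> fiber fL p \<and>
          (\<forall>a b. fnab s p (tv_lin a v b w) =
             ladd fL (lscale fL (of_real a) (fnab s p v)) (lscale fL (of_real b) (fnab s p w))) \<and>
          fnab (\<lambda>q. ladd fL (s q) (t q)) p v = ladd fL (fnab s p v) (fnab t p v) \<and>
          fnab (\<lambda>q. lscale fL (h q) (s q)) p v =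
            ladd fL (lscale fL (fun_deriv A h p v) (s p)) (lscale fL (h p) (fnab s p v)) \<and>
          ((\<forall>q\<in>U. s q = t q) \<longrightarrow> fnab s p v = fnab t p v)"
      using 1 2 3 4 5 by blast
  next
    fix c u assume c: "c \<in> A"
    have T: "coord_tvec A c q u \<in> tangent_space A q" if "q \<in> fst c" for q
      by (rule coord_tvec_in_tangent_space[OF dom_manifold c that])
    have "smooth_fun_on A (U \<inter> fst c \<inter> (mcarrier A \<inter> f -` V)) (\<lambda>q. \<tau> (snd (fnab s q (coord_tvec A c
        q u))))"
      if V: "(V, \<tau>) \<in> trivs L" for V \<tau>
    proof -
      define W where "W = U \<inter> fst c \<inter> (mcarrier A \<inter> f -` V)"
      have opW: "open W"
        unfolding W_def
        by (rule open_Int[OF open_Int[OF U(1) chart_open(1)[OF dom_manifold c]]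
            open_preimage[OF f bundle_trivs(1)[OF L V]]])
      have Wc: "W \<subseteq> fst c" and WV: "W \<subseteq> f -` V" by (auto simp: W_def)
      have sm: "smooth_fun_on A W (\<lambda>q. \<tau> (snd (s q)))"
        by (rule smooth_fun_on_subset[OF pullback_section_component[OF s V U(2)]]) (auto simp: W_def)
      have form: "smooth_form_on A (f -` V) 1 (pullback A B f (connection_form L nab \<tau>))"
        by (rule pullback_smooth_form_on[OF f bundle_trivs(1)[OF L V]
            connection_form_smooth[OF cod_manifold L nab V]])
      have "smooth_fun_on A W (\<lambda>q. fun_deriv A (\<lambda>q. \<tau> (snd (s q))) q (coord_tvec A c q u) +
          \<tau> (snd (s q)) * pullback A B f (connection_form L nab \<tau>) q [coord_tvec A c q u])"
        by (rule smooth_fun_on_add[OF dom_manifold opW smooth_fun_on_fun_deriv[OF dom_manifold opW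
            Wc c sm]
              smooth_fun_on_mult[OF dom_manifold opW sm smooth_form_on_component[OF dom_manifold opW
                  Wc WV c form]]])
      then have "smooth_fun_on A W (\<lambda>q. \<tau> (snd (fnab s q (coord_tvec A c q u))))"
      proof (rule smooth_fun_on_cong[OF dom_manifold opW])
        fix q assume "q \<in> W"
        then have q: "q \<in> U" "q \<in> fst c" "q \<in> mcarrier A" "f q \<in> V" by (auto simp: W_def)
        show "fun_deriv A (\<lambda>q. \<tau> (snd (s q))) q (coord_tvec A c q u) +
            \<tau> (snd (s q)) * pullback A B f (connection_form L nab \<tau>) q [coord_tvec A c q u] =
          \<tau> (snd (fnab s q (coord_tvec A c q u)))"
          using T[OF q(2)] q(3)
          by (simp add: pullback_conn_in_triv(2)[OF U s V q(1,4) T[OF q(2)]] pullback_def)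
      qed
      then show ?thesis by (simp add: W_def)
    qed
    moreover have "fnab s q (coord_tvec A c q u) \<in> fiber fL q" if q: "q \<in> U \<inter> fst c" for q
    proof -
      have qA: "q \<in> mcarrier A" using q U(2) by auto
      obtain V \<tau> where V: "(V, \<tau>) \<in> trivs L" "f q \<in> V" by (rule bundle_triv_exists[OF L
          map_carrier[OF qA]])
      show ?thesis using q by (intro pullback_conn_in_triv(1)[OF U s V(1) _ V(2) T]) auto
    qed
    ultimately show "smooth_section A fL (U \<inter> fst c) (\<lambda>q. fnab s q (coord_tvec A c q u))"
      by (auto simp: smooth_section_def pullback_bundle_simps comp_def)
  qed
qed

text \<open>With \<open>K\<close> the squared norm of the local frame downstairs, the product of sections with
  components \<open>a\<close> and \<open>b\<close> is \<open>a cnj(b) (K \<circ> f)\<close>, and \<open>dK = (\<theta> + cnj \<theta>) K\<close> since the given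
  connection is unitary.\<close>

lemma pullback_unitary_connection:
  assumes "unitary_connection B L nab"
  shows "unitary_connection A fL fnab"
  unfolding unitary_connection_def
proof (intro conjI pullback_connection allI impI ballI)
  fix U s t p v
  assume "open U \<and> U \<subseteq> mcarrier A \<and> smooth_section A fL U s \<and> smooth_section A fL U t"
  then have U: "open U" "U \<subseteq> mcarrier A" and s: "smooth_section A fL U s" and t: "smooth_section A
      fL U t" by auto
  assume p: "p \<in> U" and v: "v \<in> tangent_space A p"
  note pA = subsetD[OF U(2) p]
  obtain V \<tau> where V: "(V, \<tau>) \<in> trivs L" "f p \<in> V" by (rule bundle_triv_exists[OF L map_carrier[OF pA]])
  note opV = bundle_trivs(1,2)[OF L V(1)] and sec = smooth_section_frame[OF L V(1)]
  define N where "N = U \<inter> f -` V"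
  have "N = U \<inter> (mcarrier A \<inter> f -` V)" using U(2) by (auto simp: N_def)
  then have opN: "open N" using open_Int[OF U(1) open_preimage[OF f opV(1)]] by simp
  have pN: "p \<in> N" using p V by (simp add: N_def)
  define a b where "a q = \<tau> (snd (s q))" and "b q = \<tau> (snd (t q))" for q
  define K where "K q = herm L (frame L \<tau> q) (frame L \<tau> q)" for q
  define w where "w = tmap A B f p v"
  have w: "w \<in> tangent_space B (f p)" unfolding w_def by (rule tmap_in_tangent_space[OF f v pA])
  define \<theta> where "\<theta> = connection_form L nab \<tau> (f p) [w]"
  have am: "smooth_fun_on A N a" unfolding a_def N_def by (rule pullback_section_component[OF s V(1)
      U(2)])
  have bm: "smooth_fun_on A N b" unfolding b_def N_def by (rule pullback_section_component[OF t V(1)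
      U(2)])
  have K: "smooth_fun_on B V K" unfolding K_def by (rule bundle_herm_smooth[OF L V(1)])
  have Kf: "smooth_fun_on A N (\<lambda>q. K (f q))"
    by (rule smooth_fun_on_compose[OF f opV(1) K]) (auto simp: N_def)
  have fib: "snd (x q) \<in> fiber L (f q)" if "smooth_section A fL U x" "q \<in> U" for x q
    using smooth_section_fiber[OF that] fiber_pullback_iff[of q "x q"] U(2) that(2) by auto
  have "fun_deriv A (\<lambda>q. herm fL (s q) (t q)) p v = fun_deriv A (\<lambda>q. a q * cnj (b q) * K (f q)) p v"
  proof (rule fun_deriv_cong[OF dom_manifold opN pN pA])
    fix q assume "q \<in> N"
    then have q: "q \<in> U" "f q \<in> V" by (auto simp: N_def)
    show "herm fL (s q) (t q) = a q * cnj (b q) * K (f q)"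
      using herm_in_triv[OF L V(1) q(2) fib[OF s q(1)] fib[OF t q(1)]]
      by (simp add: pullback_bundle_simps a_def b_def K_def)
  qed
  also have "\<dots> = (fun_deriv A a p v * cnj (b p) + a p * cnj (fun_deriv A b p v)) * K (f p)
      + a p * cnj (b p) * fun_deriv A (\<lambda>q. K (f q)) p v"
    by (simp add: fun_deriv_mult[OF dom_manifold smooth_fun_on_mult[OF dom_manifold opN am
        smooth_fun_on_cnj[OF dom_manifold opN bm]] Kf pN pA]
        fun_deriv_mult[OF dom_manifold am smooth_fun_on_cnj[OF dom_manifold opN bm] pN pA]
            fun_deriv_cnj[OF bm pN pA])
  also have "fun_deriv A (\<lambda>q. K (f q)) p v = fun_deriv B K (f p) w"
    unfolding w_def
    by (rule fun_deriv_compose[OF f pA v chart_at[OF map_carrier[OF pA]]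
          smooth_fun_on_differentiable[OF K chart_at[OF map_carrier[OF pA]] V(2)]])
  also have "fun_deriv B K (f p) w =
      herm L (nab (frame L \<tau>) (f p) w) (frame L \<tau> (f p)) +
          herm L (frame L \<tau> (f p)) (nab (frame L \<tau>) (f p) w)"
    unfolding K_def using assms[unfolded unitary_connection_def] opV sec V(2) w by blast
  also have "\<dots> = (\<theta> + cnj \<theta>) * K (f p)"
    using herm_in_triv[OF L V connectionD(1)[OF nab opV sec V(2) w] frame_fiber(1)[OF L V]]
      herm_in_triv[OF L V frame_fiber(1)[OF L V] connectionD(1)[OF nab opV sec V(2) w]]
    by (simp add: frame_fiber(2)[OF L V] K_def \<theta>_def connection_form_def algebra_simps)
  finally have lhs: "fun_deriv A (\<lambda>q. herm fL (s q) (t q)) p v =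
      (fun_deriv A a p v * cnj (b p) + a p * cnj (fun_deriv A b p v)) * K (f p) +
          a p * cnj (b p) * ((\<theta> + cnj \<theta>) * K (f p))" .
  note Cs = pullback_conn_in_triv[OF U s V(1) p V(2) v] and Ct =
      pullback_conn_in_triv[OF U t V(1) p V(2) v]
  have sn: "snd (fnab s p v) \<in> fiber L (f p)" "snd (fnab t p v) \<in> fiber L (f p)"
    using Cs(1) Ct(1) by (auto simp: fiber_pullback_iff[OF pA])
  have "herm fL (fnab s p v) (t p) + herm fL (s p) (fnab t p v) =
      (fun_deriv A a p v + a p * \<theta>) * cnj (b p) * K (f p) + a p * cnj (fun_deriv A b p v +
          b p * \<theta>) * K (f p)"
    using herm_in_triv[OF L V sn(1) fib[OF t p]] herm_in_triv[OF L V fib[OF s p] sn(2)]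
    by (simp add: pullback_bundle_simps Cs(2) Ct(2) a_def[abs_def] b_def[abs_def] K_def \<theta>_def w_def)
  then show "fun_deriv A (\<lambda>q. herm fL (s q) (t q)) p v = herm fL (fnab s p v) (t p) +
      herm fL (s p) (fnab t p v)"
    unfolding lhs by (simp add: algebra_simps)
qed

end

end

section \<open>Curvature of the pulled-back connection\<close>

lemma ext_d_two:
  assumes "p \<in> mcarrier A" "v \<in> tangent_space A p" "w \<in> tangent_space A p" and c: "c = chart_at A p"
  shows "ext_d A \<alpha> p [v, w] =
    frechet_derivative (\<lambda>x. coord_rep A c \<alpha> x [w c]) (at (snd c p)) (v c)
    - frechet_derivative (\<lambda>x. coord_rep A c \<alpha> x [v c]) (at (snd c p)) (w c)"
  using assms by (simp add: ext_d_def Let_def remove_nth_def)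

text \<open>The part \<open>dG / G\<close> of \<open>\<Theta>\<close> contributes nothing, because its derivative is symmetric in \<open>v\<close> and
  \<open>w\<close>: it consists of the second derivative of \<open>G\<close> and of the product of the two first
  derivatives.\<close>

lemma logarithmic_derivative_closed:
  fixes G :: "'a::real_normed_vector \<Rightarrow> complex"
  assumes S: "open S" "x \<in> S" and G: "smooth_on S G" "G x \<noteq> 0"
    and \<Theta>: "\<And>y u. y \<in> S \<Longrightarrow> \<Theta> y u = frechet_derivative G (at y) u / G y + \<alpha> y u"
    and \<alpha>: "\<And>u. (\<lambda>y. \<alpha> y u) differentiable (at x)"
  shows "frechet_derivative (\<lambda>y. \<Theta> y w) (at x) v - frechet_derivative (\<lambda>y. \<Theta> y v) (at x) w =
    frechet_derivative (\<lambda>y. \<alpha> y w) (at x) v - frechet_derivative (\<lambda>y. \<alpha> y v) (at x) w"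
proof -
  define D where "D u y = frechet_derivative G (at y) u" for u y
  have dG: "(G has_derivative (\<lambda>u. D u x)) (at x)"
    using smooth_on_has_derivative[OF G(1) S(2)] by (simp add: D_def)
  have dD: "(D u has_derivative frechet_derivative (D u) (at x)) (at x)" for u
    unfolding D_def[abs_def] by (rule smooth_on_has_derivative[OF smooth_on_derivative[OF G(1)] S(2)])
  have sym: "frechet_derivative (D v) (at x) w = frechet_derivative (D w) (at x) v"
    unfolding D_def[abs_def]
    by (rule second_derivative_symmetric[OF S smooth_on_imp_differentiable[OF G(1)]
          smooth_on_imp_differentiable[OF smooth_on_derivative[OF G(1)] S(2)]
          smooth_on_imp_differentiable[OF smooth_on_derivative[OF G(1)] S(2)]])
  have "frechet_derivative (\<lambda>y. \<Theta> y u) (at x) =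
      (\<lambda>h. (frechet_derivative (D u) (at x) h * G x - D u x * D h x) / (G x * G x)
        + frechet_derivative (\<lambda>y. \<alpha> y u) (at x) h)" for u
  proof -
    have "((\<lambda>y. D u y / G y + \<alpha> y u) has_derivative
        (\<lambda>h. (frechet_derivative (D u) (at x) h * G x - D u x * D h x) / (G x * G x)
          + frechet_derivative (\<lambda>y. \<alpha> y u) (at x) h)) (at x)"
      by (rule has_derivative_add[OF has_derivative_divide'[OF dD dG G(2)] has_derivative_frechet[OF \<alpha>]])
    then have "((\<lambda>y. \<Theta> y u) has_derivative
        (\<lambda>h. (frechet_derivative (D u) (at x) h * G x - D u x * D h x) / (G x * G x)
          + frechet_derivative (\<lambda>y. \<alpha> y u) (at x) h)) (at x)"
      by (rule has_derivative_transform_within_open[OF _ S]) (simp add: \<Theta> D_def)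
    from frechet_derivative_at[OF this] show ?thesis by simp
  qed
  then show ?thesis using sym by (simp add: algebra_simps diff_divide_distrib)
qed

text \<open>If \<open>\<beta>\<close> is the connection form of a trivialisation downstairs, then a frame with component
  \<open>g\<close> upstairs has the connection form \<open>dg / g + f\<^sup>* \<beta>\<close>. The logarithmic derivative is closed, and
  \<open>d\<close> commutes with the pull-back of \<open>\<beta>\<close>, whose derivative is \<open>K\<close> by assumption.\<close>

lemma pullback_curvature:
  fixes A :: "('m::{t2_space, second_countable_topology}, 'a::real_normed_vector) atlas"
    and B :: "('n::{t2_space, second_countable_topology}, 'b::real_normed_vector) atlas"
  assumes f: "smooth_manifold_map A B f" and L: "hermitian_line_bundle B L" and nab: "connection B L nab"
    and K: "has_curvature B L nab K"
    and K': "\<And>p v w. p \<in> mcarrier A \<Longrightarrow> v \<in> tangent_space A p \<Longrightarrow> w \<in> tangent_space A p \<Longrightarrow>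
      K' p [v, w] = K (f p) [tmap A B f p v, tmap A B f p w]"
  shows "has_curvature A (pullback_bundle A f L) (pullback_conn A B f L nab) K'"
  unfolding has_curvature_def
proof (intro allI impI ballI)
  fix U and e :: "'m \<Rightarrow> 'm \<times> 'c" and \<theta> p v w
  let ?P = "pullback_bundle A f L" and ?pnab = "pullback_conn A B f L nab"
  assume "open U \<and> U \<subseteq> mcarrier A \<and> smooth_section A ?P U e \<and> (\<forall>p\<in>U. e p \<noteq> lscale ?P 0 (e p)) \<and>
    (\<forall>p\<in>U. \<forall>v\<in>tangent_space A p. ?pnab e p v = lscale ?P (\<theta> p [v]) (e p))"
  then have U: "open U" "U \<subseteq> mcarrier A" and e: "smooth_section A ?P U e"
    and e0: "\<And>p. p \<in> U \<Longrightarrow> e p \<noteq> lscale ?P 0 (e p)"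
    and \<theta>: "\<And>p v. p \<in> U \<Longrightarrow> v \<in> tangent_space A p \<Longrightarrow> ?pnab e p v = lscale ?P (\<theta> p [v]) (e p)" by blast+
  assume p: "p \<in> U" and v: "v \<in> tangent_space A p" and w: "w \<in> tangent_space A p"
  note A = smooth_manifold_mapD(1)[OF f] and B = smooth_manifold_mapD(2)[OF f]
  note H = pullback_bundle_hermitian[OF f L]
  note pA = subsetD[OF U(2) p]
  note fpB = smooth_manifold_mapD(4)[OF f pA]
  obtain V \<tau> where V: "(V, \<tau>) \<in> trivs L" "f p \<in> V" by (rule bundle_triv_exists[OF L fpB])
  note opV = bundle_trivs(1,2)[OF L V(1)]
  note V' = pullback_triv[OF f L V(1)]
  define N where "N = U \<inter> f -` V"
  have "N = U \<inter> (mcarrier A \<inter> f -` V)" using U(2) by (auto simp: N_def)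
  then have opN: "open N" using open_Int[OF U(1) open_preimage[OF f opV(1)]] by simp
  have pN: "p \<in> N" using p V by (simp add: N_def)
  define g where "g q = \<tau> (snd (e q))" for q
  define \<beta> where "\<beta> = connection_form L nab \<tau>"
  define \<alpha> where "\<alpha> = pullback A B f \<beta>"
  have \<beta>: "smooth_form_on B V 1 \<beta>" unfolding \<beta>_def by (rule connection_form_smooth[OF B L nab V(1)])
  have \<alpha>: "smooth_form_on A (f -` V) 1 \<alpha>" unfolding \<alpha>_def
      by (rule pullback_smooth_form_on[OF f opV(1) \<beta>])
  have g: "smooth_fun_on A N g"
    unfolding g_def N_def by (rule pullback_section_component[OF f L e V(1) U(2)])
  have NU: "q \<in> U" "q \<in> mcarrier A" "f q \<in> V" "q \<in> mcarrier A \<inter> f -` V" if "q \<in> N" for q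
    using that U(2) by (auto simp: N_def)
  have g0: "g q \<noteq> 0" if q: "q \<in> N" for q
  proof
    assume "g q = 0"
    note eq = smooth_section_fiber[OF e NU(1)[OF q]]
    have "e q = lscale ?P 0 (e q)"
    proof (rule fiber_eqI[OF H V' NU(4)[OF q] eq bundle_fiber(2)[OF H NU(2)[OF q] eq]])
      show "(\<tau> \<circ> snd) (e q) = (\<tau> \<circ> snd) (lscale ?P 0 (e q))"
        unfolding bundle_trivs(5)[OF H V' NU(4)[OF q] eq] using \<open>g q = 0\<close> by (simp add: g_def)
    qed
    then show False using e0[OF NU(1)[OF q]] by simp
  qed
  have \<theta>_eq: "\<theta> q [u] = fun_deriv A g q u / g q + \<alpha> q [u]"
      if q: "q \<in> N" and u: "u \<in> tangent_space A q" for q u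
  proof -
    have "(\<tau> \<circ> snd) (lscale ?P (\<theta> q [u]) (e q)) = \<theta> q [u] * (\<tau> \<circ> snd) (e q)"
      by (rule bundle_trivs(5)[OF H V' NU(4)[OF q] smooth_section_fiber[OF e NU(1)[OF q]]])
    then have "\<theta> q [u] * g q = \<tau> (snd (?pnab e q u))"
      by (simp add: \<theta>[OF NU(1)[OF q] u] g_def)
    also have "\<dots> = fun_deriv A g q u + g q * \<beta> (f q) [tmap A B f q u]"
      unfolding g_def \<beta>_def by (rule pullback_conn_in_triv(2)[OF f L nab U e V(1) NU(1,3)[OF q] u])
    also have "\<beta> (f q) [tmap A B f q u] = \<alpha> q [u]"
      using NU(2)[OF q] u by (simp add: \<alpha>_def pullback_def)
    finally show ?thesis using g0[OF q] by (simp add: field_simps)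
  qed
  define c where "c = chart_at A p"
  have c: "c \<in> A" "p \<in> fst c" using chart_at[OF pA] by (auto simp: c_def)
  define S where "S = snd c ` (fst c \<inter> N)"
  define G where "G = g \<circ> chart_inv c"
  have S: "open S" "snd c p \<in> S"
    using open_chart_image[OF A opN c(1)] c(2) pN by (auto simp: S_def)
  have G: "smooth_on S G" using g c(1) by (simp add: smooth_fun_on_def S_def G_def)
  have G0: "G (snd c p) \<noteq> 0" using g0[OF pN] by (simp add: G_def chart_inverse(1)[OF A c])
  have rep: "coord_rep A c \<theta> y [u] = frechet_derivative G (at y) u / G y + coord_rep A c \<alpha> y [u]"
      if "y \<in> S" for y u
  proof -
    obtain q where q: "q \<in> fst c" "q \<in> N" "y = snd c q" using \<open>y \<in> S\<close> by (auto simp: S_def)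
    note T = coord_tvec_in_tangent_space[OF A c(1) q(1), of u]
    have "fun_deriv A g q (coord_tvec A c q u) = frechet_derivative G (at y) u"
      using fun_deriv_in_chart[OF A T c(1) q(1) smooth_fun_on_differentiable[OF g c(1) q(1,2)]]
      by (simp add: G_def q(3) coord_tvec_component[OF A c(1) q(1)])
    then show ?thesis
      using \<theta>_eq[OF q(2) T] by (simp add: coord_rep_def q(3) chart_inverse(1)[OF A c(1) q(1)] G_def)
  qed
  have diff: "(\<lambda>y. coord_rep A c \<alpha> y [u]) differentiable (at (snd c p))" for u
  proof (rule smooth_on_imp_differentiable)
    show "smooth_on (snd c ` (fst c \<inter> f -` V)) (\<lambda>y. coord_rep A c \<alpha> y [u])"
      using \<alpha> c(1) by (simp add: smooth_form_on_def)
    show "snd c p \<in> snd c ` (fst c \<inter> f -` V)" using c(2) V(2) by auto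
  qed
  have "ext_d A \<theta> p [v, w] = ext_d A \<alpha> p [v, w]"
    unfolding ext_d_two[OF pA v w c_def]
    by (rule logarithmic_derivative_closed[where \<Theta> = "\<lambda>y u. coord_rep A c \<theta> y [u]", OF S G G0 rep diff])
  also have "\<dots> = ext_d B \<beta> (f p) (map (tmap A B f p) [v, w])"
    unfolding \<alpha>_def by (rule ext_d_pullback[OF f opV(1) \<beta> pA V(2)]) (use v w in auto)
  also have "\<dots> = K (f p) [tmap A B f p v, tmap A B f p w]"
  proof -
    note fr = frame_fiber[OF L V(1)] and sec = smooth_section_frame[OF L V(1)]
    have nz: "frame L \<tau> q \<noteq> lscale L 0 (frame L \<tau> q)" if "q \<in> V" for q
      using bundle_trivs(5)[OF L V(1) that fr(1)[OF that], of 0] fr(2)[OF that] by auto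
    have "nab (frame L \<tau>) q u = lscale L (\<beta> q [u]) (frame L \<tau> q)" if "q \<in> V" "u \<in> tangent_space B q"
        for q u
      using lscale_frame[OF L V(1) that(1) connectionD(1)[OF nab opV sec that]]
      by (simp add: \<beta>_def connection_form_def)
    with K[unfolded has_curvature_def, rule_format, of V "frame L \<tau>" \<beta>] nz sec opV V(2)
      tmap_in_tangent_space[OF f v pA] tmap_in_tangent_space[OF f w pA]
    show ?thesis by simp
  qed
  finally show "ext_d A \<theta> p [v, w] = K' p [v, w]"
    by (simp add: K'[OF pA v w])
qed

section \<open>Pull-back of relative prequantizations\<close>

text \<open>The pulled-back section has the component \<open>g \<circ> \<phi>\<close>, where \<open>g\<close> is the component of \<open>s\<close> in the
  same trivialisation of \<open>L\<close>. Its covariant derivative is computed from the connection form of \<open>L\<close>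
  at \<open>d\<psi> (dF v)\<close>, that of \<open>s\<close> at \<open>dF' (d\<phi> v)\<close>; the two vectors agree since the square commutes.\<close>

lemma rel_prequantization_pullback:
  fixes F :: "('m::{t2_space, second_countable_topology}, 'a::real_normed_vector,
               'n::{t2_space, second_countable_topology}, 'b::real_normed_vector) arrow"
    and F' :: "('m'::{t2_space, second_countable_topology}, 'a'::real_normed_vector,
                'n'::{t2_space, second_countable_topology}, 'b'::real_normed_vector) arrow"
    and L :: "('n', 'l) line_bundle"
  assumes F: "smooth_arrow F" and F': "smooth_arrow F'" and \<Phi>: "arrow_morphism F F' \<phi> \<psi>"
    and preq: "rel_prequantization F' \<Psi> L nab s"
  shows "rel_prequantization F (rel_pullback F F' \<phi> \<psi> \<Psi>) (pullback_bundle (tgt F) \<psi> L)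
    (pullback_conn (tgt F) (tgt F') \<psi> L nab) (pullback_ident F \<circ> pullback_section \<phi> s)"
proof -
  note \<phi> = arrow_morphismD(1)[OF F F' \<Phi>] and \<psi> = arrow_morphismD(2)[OF F F' \<Phi>] and square =
      arrow_morphismD(3)[OF F F' \<Phi>]
  note mF = smooth_arrowD(3)[OF F] and mF' = smooth_arrowD(3)[OF F']
  note M = smooth_arrowD(1)[OF F]
  define P where "P = pullback_bundle (tgt F) \<psi> L"
  define pnab where "pnab = pullback_conn (tgt F) (tgt F') \<psi> L nab"
  define FL where "FL = pullback_bundle (src F) (amap F) P"
  define FL' where "FL' = pullback_bundle (src F') (amap F') L"
  define t where "t = pullback_ident F \<circ> pullback_section \<phi> s"
  have \<Psi>: "\<Psi> \<in> rel_closed F' 2" and L: "hermitian_line_bundle (tgt F') L"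
    and un: "unitary_connection (tgt F') L nab"
    and curv: "has_curvature (tgt F') L nab (\<lambda>p vs. - 2 * pi * \<i> * of_real (fst \<Psi> p vs))"
    and s: "smooth_section (src F') FL' (mcarrier (src F')) s"
    and norm: "\<And>p. p \<in> mcarrier (src F') \<Longrightarrow> herm FL' (s p) (s p) = 1"
    and flat: "\<And>p v. p \<in> mcarrier (src F') \<Longrightarrow> v \<in> tangent_space (src F') p \<Longrightarrow>
      pullback_conn (src F') (tgt F') (amap F') L nab s p v =
          lscale FL' (- 2 * pi * \<i> * of_real (snd \<Psi> p [v])) (s p)"
    using preq unfolding rel_prequantization_def Let_def FL'_def by blast+
  have nab: "connection (tgt F') L nab" using un by (simp add: unitary_connection_def)
  have P: "hermitian_line_bundle (tgt F) P" unfolding P_def by (rule pullback_bundle_hermitian[OF \<psi> L])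
  have pnab: "connection (tgt F) P pnab" unfolding P_def pnab_def
      by (rule pullback_connection[OF \<psi> L nab])
  have FL: "hermitian_line_bundle (src F) FL" unfolding FL_def
      by (rule pullback_bundle_hermitian[OF mF P])
  have t_eq: "t p = (p, amap F p, snd (s (\<phi> p)))" for p
    by (simp add: t_def pullback_ident_def pullback_section_def case_prod_beta)
  have \<phi>M: "\<phi> p \<in> mcarrier (src F')" and FM: "amap F p \<in> mcarrier (tgt F)" if "p \<in> mcarrier (src F)"
      for p
    using that smooth_manifold_mapD(4)[OF \<phi>] smooth_manifold_mapD(4)[OF mF] by auto
  have s_fiber: "snd (s (\<phi> p)) \<in> fiber L (\<psi> (amap F p))" if p: "p \<in> mcarrier (src F)" for p
    using smooth_section_fiber[OF s \<phi>M[OF p]] square[OF p]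
    by (simp add: FL'_def fiber_pullback_iff[OF mF' L \<phi>M[OF p]])
  have t_fiber: "t p \<in> fiber FL p" if p: "p \<in> mcarrier (src F)" for p
  proof -
    have "(amap F p, snd (s (\<phi> p))) \<in> fiber P (amap F p)"
      unfolding P_def fiber_pullback_iff[OF \<psi> L FM[OF p]] using s_fiber[OF p] by simp
    then show ?thesis unfolding FL_def fiber_pullback_iff[OF mF P p] t_eq by simp
  qed
  have s_comp: "smooth_fun_on (src F) (mcarrier (src F) \<inter> \<phi> -` (mcarrier (src F') \<inter> amap F' -` V))
      (\<lambda>p. \<tau> (snd (s (\<phi> p))))"
    "smooth_fun_on (src F') (mcarrier (src F') \<inter> amap F' -` V) (\<lambda>p. \<tau> (snd (s p)))"
    if V: "(V, \<tau>) \<in> trivs L" for V \<tau>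
  proof -
    note op = open_preimage[OF mF' bundle_trivs(1)[OF L V]]
    show sm: "smooth_fun_on (src F') (mcarrier (src F') \<inter> amap F' -` V) (\<lambda>p. \<tau> (snd (s p)))"
      by (rule pullback_section_component[OF mF' L s[unfolded FL'_def] V order_refl])
    show "smooth_fun_on (src F) (mcarrier (src F) \<inter> \<phi> -` (mcarrier (src F') \<inter> amap F' -` V)) (\<lambda>p. \<tau>
        (snd (s (\<phi> p))))"
      by (rule smooth_fun_on_compose[OF \<phi> op sm]) auto
  qed
  have t_smooth: "smooth_section (src F) FL (mcarrier (src F)) t"
    unfolding smooth_section_def
  proof (intro conjI)
    show "\<forall>p\<in>mcarrier (src F). t p \<in> fiber FL p" using t_fiber by blast
    show "\<forall>(W, \<sigma>)\<in>trivs FL. smooth_fun_on (src F) (mcarrier (src F) \<inter> W) (\<sigma> \<circ> t)"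
    proof clarify
      fix W \<sigma> assume "(W, \<sigma>) \<in> trivs FL"
      then obtain V \<tau> where V: "(V, \<tau>) \<in> trivs L"
        and W: "W = mcarrier (src F) \<inter> amap F -` (mcarrier (tgt F) \<inter> \<psi> -` V)" "\<sigma> = \<tau> \<circ> snd \<circ> snd"
        by (auto simp: FL_def P_def pullback_bundle_def)
      have "smooth_fun_on (src F) (mcarrier (src F) \<inter> W) (\<lambda>p. \<tau> (snd (s (\<phi> p))))"
        by (rule smooth_fun_on_subset[OF s_comp(1)[OF V]]) (auto simp: W \<phi>M square)
      then show "smooth_fun_on (src F) (mcarrier (src F) \<inter> W) (\<sigma> \<circ> t)"
        by (simp add: W comp_def t_eq)
    qed
  qed
  have t_norm: "herm FL (t p) (t p) = 1" if p: "p \<in> mcarrier (src F)" for p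
    using norm[OF \<phi>M[OF p]] by (simp add: FL_def P_def FL'_def pullback_bundle_def t_eq)
  have t_flat: "pullback_conn (src F) (tgt F) (amap F) P pnab t p v =
      lscale FL (- 2 * pi * \<i> * of_real (snd (rel_pullback F F' \<phi> \<psi> \<Psi>) p [v])) (t p)"
    if p: "p \<in> mcarrier (src F)" and v: "v \<in> tangent_space (src F) p" for p v
  proof -
    define v' where "v' = tmap (src F) (src F') \<phi> p v"
    define q where "q = amap F p"
    have v': "v' \<in> tangent_space (src F') (\<phi> p)" unfolding v'_def
        by (rule tmap_in_tangent_space[OF \<phi> v p])
    note Fp = FM[OF p, folded q_def]
    note \<psi>q = smooth_manifold_mapD(4)[OF \<psi> Fp]
    obtain V \<tau> where V: "(V, \<tau>) \<in> trivs L" "\<psi> q \<in> V" by (rule bundle_triv_exists[OF L \<psi>q])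
    have VP: "(mcarrier (tgt F) \<inter> \<psi> -` V, \<tau> \<circ> snd) \<in> trivs P" unfolding P_def
        by (rule pullback_triv[OF \<psi> L V(1)])
    have qV: "amap F p \<in> mcarrier (tgt F) \<inter> \<psi> -` V" using Fp V(2) by (simp add: q_def)
    have VFL: "(mcarrier (src F) \<inter> amap F -` (mcarrier (tgt F) \<inter> \<psi> -` V), \<tau> \<circ> snd \<circ> snd) \<in> trivs FL"
      unfolding FL_def by (rule pullback_triv[OF mF P VP])
    have pV: "p \<in> mcarrier (src F) \<inter> amap F -` (mcarrier (tgt F) \<inter> \<psi> -` V)" using p qV by simp
    have F'V: "amap F' (\<phi> p) \<in> V" using square[OF p] V(2) by (simp add: q_def)
    have dF: "tmap (src F) (tgt F) (amap F) p v \<in> tangent_space (tgt F) q"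
      unfolding q_def by (rule tmap_in_tangent_space[OF mF v p])
    note C = pullback_conn_in_triv[OF mF P pnab open_mcarrier[OF M]
        order_refl t_smooth[unfolded FL_def] VP p qV v]
    have tangents: "tmap (tgt F) (tgt F') \<psi> q (tmap (src F) (tgt F) (amap F) p v) =
        tmap (src F') (tgt F') (amap F') (\<phi> p) v'"
      unfolding q_def v'_def tmap_compose[OF mF \<psi> p v] tmap_compose[OF \<phi> mF' p v]
      using tmap_cong[OF M p, of "\<lambda>r. \<psi> (amap F r)" "\<lambda>r. amap F' (\<phi> r)" "tgt F'"] square by simp
    have form: "connection_form P pnab (\<tau> \<circ> snd) q [tmap (src F) (tgt F) (amap F) p v] =
        connection_form L nab \<tau> (amap F' (\<phi> p)) [tmap (src F') (tgt F') (amap F') (\<phi> p) v']"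
      unfolding P_def pnab_def connection_form_pullback[OF \<psi> L nab V(1) Fp V(2) dF] tangents
      using square[OF p] by (simp add: q_def)
    have fd: "fun_deriv (src F) (\<lambda>r. \<tau> (snd (s (\<phi> r)))) p v =
        fun_deriv (src F') (\<lambda>r. \<tau> (snd (s r))) (\<phi> p) v'"
      unfolding v'_def
    proof (rule fun_deriv_compose[OF \<phi> p v chart_at[OF \<phi>M[OF p]]])
      show "(\<lambda>r. \<tau> (snd (s r))) \<circ> chart_inv (chart_at (src F') (\<phi> p))
          differentiable (at (snd (chart_at (src F') (\<phi> p)) (\<phi> p)))"
        using \<phi>M[OF p] F'V by (intro smooth_fun_on_differentiable[OF s_comp(2)[OF V(1)]
            chart_at[OF \<phi>M[OF p]]]) auto
    qed
    have lscale_t: "lscale FL z (t p) = (p, amap F p, lscale L z (snd (s (\<phi> p))))" for z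
      by (simp add: FL_def P_def pullback_bundle_def t_eq)
    have "(\<tau> \<circ> snd) (snd (pullback_conn (src F) (tgt F) (amap F) P pnab t p v)) =
        fun_deriv (src F) (\<lambda>r. \<tau> (snd (s (\<phi> r)))) p v + \<tau> (snd (s (\<phi> p))) *
          connection_form L nab \<tau> (amap F' (\<phi> p)) [tmap (src F') (tgt F') (amap F') (\<phi> p) v']"
      unfolding C(2) form[unfolded q_def] by (simp add: t_eq)
    also have "\<dots> = \<tau> (snd (pullback_conn (src F') (tgt F') (amap F') L nab s (\<phi> p) v'))"
      unfolding fd
      by (rule pullback_conn_in_triv(2)[OF mF' L nab open_mcarrier[OF smooth_arrowD(1)[OF F']] order_refl
            s[unfolded FL'_def] V(1) \<phi>M[OF p] F'V v', symmetric])
    also have "\<dots> = \<tau> (lscale L (- 2 * pi * \<i> * of_real (snd \<Psi> (\<phi> p) [v'])) (snd (s (\<phi> p))))"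
      unfolding flat[OF \<phi>M[OF p] v'] by (simp add: FL'_def pullback_bundle_def)
    also have "snd \<Psi> (\<phi> p) [v'] = snd (rel_pullback F F' \<phi> \<psi> \<Psi>) p [v]"
      using p v by (simp add: rel_pullback_def pullback_def v'_def)
    finally have comp: "(\<tau> \<circ> snd \<circ> snd) (pullback_conn (src F) (tgt F) (amap F) P pnab t p v) =
        (\<tau> \<circ> snd \<circ> snd) (lscale FL (- 2 * pi * \<i> * of_real (snd (rel_pullback F F' \<phi> \<psi> \<Psi>) p [v])) (t p))"
      by (simp add: lscale_t)
    show ?thesis
      by (rule fiber_eqI[OF FL VFL pV _ bundle_fiber(2)[OF FL p t_fiber[OF p]]
          comp]) (use C(1) in \<open>simp add: FL_def\<close>)
  qed
  have closed: "rel_pullback F F' \<phi> \<psi> \<Psi> \<in> rel_closed F 2"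
    by (rule rel_pullback_closed[OF F F' \<Phi> \<Psi>])
  have curvP: "has_curvature (tgt F) P pnab (\<lambda>p vs. - 2 * pi * \<i> * of_real (fst (rel_pullback F F' \<phi>
      \<psi> \<Psi>) p vs))"
    unfolding P_def pnab_def
    by (rule pullback_curvature[OF \<psi> L nab curv]) (simp add: rel_pullback_def pullback_def)
  have "unitary_connection (tgt F) P pnab"
    unfolding P_def pnab_def by (rule pullback_unitary_connection[OF \<psi> L nab un])
  then show ?thesis
    unfolding rel_prequantization_def Let_def P_def[symmetric] pnab_def[symmetric] FL_def[symmetric]
        t_def[symmetric]
    using closed P curvP t_smooth t_norm t_flat by blast
qed

section \<open>Fundamental vector fields\<close>

lemma mcarrier_prod_atlas: "mcarrier (prod_atlas A B) = mcarrier A \<times> mcarrier B"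
proof (intro subset_antisym subsetI)
  fix z assume "z \<in> mcarrier (prod_atlas A B)"
  then obtain e where e: "e \<in> prod_atlas A B" "z \<in> fst e" unfolding mcarrier_def by blast
  then obtain a b where "a \<in> A" "b \<in> B" "e = (fst a \<times> fst b, map_prod (snd a) (snd b))"
    unfolding prod_atlas_def by blast
  with e(2) show "z \<in> mcarrier A \<times> mcarrier B"
    by (cases z) (auto intro: chart_subset_mcarrier)
next
  fix z assume "z \<in> mcarrier A \<times> mcarrier B"
  then obtain a b where ab: "a \<in> A" "b \<in> B" "z \<in> fst a \<times> fst b"
    unfolding mcarrier_def by blast
  then have "(fst a \<times> fst b, map_prod (snd a) (snd b)) \<in> prod_atlas A B"
    unfolding prod_atlas_def by blast
  with ab(3) show "z \<in> mcarrier (prod_atlas A B)"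
    by (auto intro: chart_subset_mcarrier)
qed

text \<open>In product charts, fixing \<open>g\<close> fixes the first coordinate.\<close>

lemma smooth_map_slice:
  fixes AG :: "('g::{t2_space, second_countable_topology}, 'h::real_normed_vector) atlas"
    and A :: "('m::{t2_space, second_countable_topology}, 'a::real_normed_vector) atlas"
    and C :: "('n::{t2_space, second_countable_topology}, 'b::real_normed_vector) atlas"
  assumes AG: "smooth_manifold AG" and A: "smooth_manifold A" and C: "smooth_manifold C"
    and \<mu>: "smooth_map (prod_atlas AG A) C (\<lambda>(g, p). \<mu> g p)" and g: "g \<in> mcarrier AG"
  shows "smooth_manifold_map A C (\<mu> g)"
proof -
  note prod = mcarrier_prod_atlas[of AG A]
  have "continuous_on (mcarrier A) (\<lambda>p. (\<lambda>(g, p). \<mu> g p) (g, p))"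
    by (rule continuous_on_compose2[of "mcarrier AG \<times> mcarrier A" "\<lambda>(g, p). \<mu> g p"])
       (use \<mu> g prod in \<open>auto simp: smooth_map_def intro!: continuous_intros\<close>)
  then have cont: "continuous_on (mcarrier A) (\<mu> g)" by simp
  have img: "\<mu> g ` mcarrier A \<subseteq> mcarrier C"
    using \<mu> g prod by (fastforce simp: smooth_map_def)
  note a = chart_at[OF g]
  define a where "a = chart_at AG g"
  have a: "a \<in> AG" "g \<in> fst a" using a by (auto simp: a_def)
  have "smooth_on (snd c ` (fst c \<inter> \<mu> g -` fst d)) (snd d \<circ> \<mu> g \<circ> chart_inv c)"
      if c: "c \<in> A" and d: "d \<in> C" for c d
  proof -
    define e where "e = (fst a \<times> fst c, map_prod (snd a) (snd c))"
    have e: "e \<in> prod_atlas AG A" using a c unfolding prod_atlas_def e_def by blast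
    define S where "S = snd e ` (fst e \<inter> (\<lambda>(g, p). \<mu> g p) -` fst d)"
    have sm: "smooth_on S (snd d \<circ> (\<lambda>(g, p). \<mu> g p) \<circ> chart_inv e)"
      using \<mu> e d unfolding smooth_map_def S_def by blast
    have inj: "inj_on (snd e) (fst e)"
      using chart_inverse(1)[OF AG a(1)] chart_inverse(1)[OF A c] unfolding e_def inj_on_def
      by (auto; metis)
    define T where "T = snd c ` (fst c \<inter> \<mu> g -` fst d)"
    have "open (fst c \<inter> \<mu> g -` fst d)"
      using cont chart_subset_mcarrier[OF c]
      by (intro continuous_open_preimage chart_open(1)[OF A c] chart_open(1)[OF C d])
         (auto intro: continuous_on_subset)
    then have T: "open T" unfolding T_def by (rule chart_image_open[OF A c])
    have "Pair (snd a g) ` T \<subseteq> S"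
      using a(2) by (force simp: T_def S_def e_def)
    from smooth_on_slice[OF T this sm] have "smooth_on T (snd d \<circ> \<mu> g \<circ> chart_inv c)"
    proof (rule smooth_on_cong[OF _ T])
      fix x assume "x \<in> T"
      then obtain p where p: "p \<in> fst c" "x = snd c p" by (auto simp: T_def)
      have "chart_inv e (snd a g, x) = (g, p)"
        unfolding chart_inv_def by (rule inv_into_f_eq[OF inj]) (use a p in \<open>auto simp: e_def\<close>)
      then show "(snd d \<circ> (\<lambda>(g, p). \<mu> g p) \<circ> chart_inv e) (snd a g, x) = (snd d \<circ> \<mu> g \<circ> chart_inv c) x"
        using p by (simp add: chart_inverse(1)[OF A c])
    qed
    then show ?thesis by (simp add: T_def)
  qed
  then show ?thesis
    using AG A C cont img by (simp add: smooth_manifold_map_def smooth_map_def)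
qed

text \<open>A one-parameter subgroup with velocity \<open>0\<close> at the unit has velocity \<open>0\<close> everywhere, since
  \<open>\<gamma> (t + s) = \<gamma> t \<gamma> s\<close> and left translation by \<open>\<gamma> t\<close> is smooth; so it is locally constant.\<close>

lemma one_parameter_subgroup_trivial:
  fixes AG :: "('g::{t2_space, second_countable_topology}, 'h::real_normed_vector) atlas"
  assumes G: "lie_group AG G" and \<gamma>: "smooth_map real_atlas AG \<gamma>"
    and hom: "\<And>s t. \<gamma> (s + t) = \<gamma> s \<otimes>\<^bsub>G\<^esub> \<gamma> t" and vel: "velocity AG \<gamma> 0 = (\<lambda>c. 0)"
  shows "\<gamma> t = \<one>\<^bsub>G\<^esub>"
proof -
  have AG: "smooth_manifold AG" and group: "group G" and carrier: "carrier G = mcarrier AG"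
    and mult: "smooth_map (prod_atlas AG AG) AG (\<lambda>(g, h). g \<otimes>\<^bsub>G\<^esub> h)"
    using G by (auto simp: lie_group_def)
  interpret group G by (fact group)
  have real: "mcarrier real_atlas = UNIV" "chart_inv (UNIV, id) = (id :: real \<Rightarrow> real)"
    by (auto simp: mcarrier_def real_atlas_def chart_inv_def)
  have in_carrier: "\<gamma> t \<in> mcarrier AG" for t
    using \<gamma> by (auto simp: smooth_map_def real)
  have cont: "continuous_on UNIV \<gamma>" using \<gamma> by (simp add: smooth_map_def real)
  then have isCont: "isCont \<gamma> t" for t by (simp add: continuous_on_eq_continuous_at)
  have smooth: "smooth_on (\<gamma> -` fst d) (snd d \<circ> \<gamma>)" if "d \<in> AG" for d
    using \<gamma> that by (simp add: smooth_map_def real_atlas_def real)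
  have one: "\<gamma> 0 = \<one>\<^bsub>G\<^esub>"
  proof -
    have "\<gamma> 0 \<otimes>\<^bsub>G\<^esub> \<gamma> 0 = \<gamma> 0 \<otimes>\<^bsub>G\<^esub> \<one>\<^bsub>G\<^esub>"
      using hom[of 0 0] in_carrier[of 0] by (simp add: carrier)
    then show ?thesis using in_carrier[of 0] by (simp add: carrier)
  qed
  have zero: "((snd d \<circ> \<gamma>) has_derivative (\<lambda>h. 0)) (at t)" if d: "d \<in> AG" and t: "\<gamma> t \<in> fst d" for d t
  proof -
    define l where "l h = \<gamma> t \<otimes>\<^bsub>G\<^esub> h" for h
    have l: "smooth_manifold_map AG AG l"
      unfolding l_def by (rule smooth_map_slice[OF AG AG AG mult in_carrier])
    define c where "c = chart_at AG (\<gamma> 0)"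
    have c: "c \<in> AG" "\<gamma> 0 \<in> fst c" using chart_at[OF in_carrier[of 0]] by (auto simp: c_def)
    have diff: "(snd c \<circ> \<gamma>) differentiable (at 0)"
      by (rule smooth_on_imp_differentiable[OF smooth[OF c(1)]]) (use c(2) in auto)
    have v0: "vector_derivative (snd c \<circ> \<gamma>) (at 0) = 0"
      using fun_cong[OF vel, of c] c isCont[of 0] diff by (simp add: velocity_def)
    have l0: "l (\<gamma> 0) = \<gamma> t" using in_carrier[of t] by (simp add: l_def one carrier)
    have "(snd d \<circ> (l \<circ> \<gamma>) has_vector_derivative
        frechet_derivative (snd d \<circ> l \<circ> chart_inv c) (at (snd c (\<gamma> 0))) (vector_derivative (snd c \<circ>
            \<gamma>) (at 0))) (at 0)"
      by (rule has_vector_derivative_in_charts[OF l c(1) d c(2) _ isCont diff]) (use t l0 in simp)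
    also have "frechet_derivative (snd d \<circ> l \<circ> chart_inv c) (at (snd c (\<gamma> 0))) (vector_derivative
        (snd c \<circ> \<gamma>) (at 0)) = 0"
      unfolding v0 by (rule linear_0[OF has_derivative_linear[OF local_rep_has_derivative[OF l c(1)
          d c(2)]]]) (use t l0 in simp)
    finally have "((snd d \<circ> (l \<circ> \<gamma>)) has_derivative (\<lambda>h. 0)) (at ((\<lambda>s. s - t) t))"
      by (simp add: has_vector_derivative_def comp_def)
    moreover have "((\<lambda>s. s - t) has_derivative (\<lambda>h. h)) (at t)"
      by (auto intro!: derivative_eq_intros)
    ultimately have "((\<lambda>s. (snd d \<circ> (l \<circ> \<gamma>)) (s - t)) has_derivative (\<lambda>h. 0)) (at t)"
      using has_derivative_compose[of "\<lambda>s. s - t" "\<lambda>h. h" t UNIV "snd d \<circ> (l \<circ> \<gamma>)" "\<lambda>h. 0"] by simp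
    moreover have "(\<lambda>s. (snd d \<circ> (l \<circ> \<gamma>)) (s - t)) = snd d \<circ> \<gamma>"
      using hom[of t] by (simp add: l_def fun_eq_iff flip: hom)
    ultimately show ?thesis by simp
  qed
  define E where "E = {t. \<gamma> t = \<one>\<^bsub>G\<^esub>}"
  have "closed (\<gamma> -` {\<one>\<^bsub>G\<^esub>})" by (rule closed_vimage[OF closed_singleton cont])
  then have "closed E" by (simp add: E_def vimage_def)
  moreover have "open E"
    unfolding open_contains_ball
  proof
    fix t0 assume t0: "t0 \<in> E"
    define c where "c = chart_at AG (\<gamma> t0)"
    have c: "c \<in> AG" "\<gamma> t0 \<in> fst c" using chart_at[OF in_carrier[of t0]] by (auto simp: c_def)
    have "open (\<gamma> -` fst c)" by (rule open_vimage[OF chart_open(1)[OF AG c(1)] cont])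
    then obtain e where e: "0 < e" "ball t0 e \<subseteq> \<gamma> -` fst c"
      using c(2) open_contains_ball by blast
    have "(snd c \<circ> \<gamma> has_derivative (\<lambda>h. 0)) (at s within ball t0 e)" if "s \<in> ball t0 e" for s
      by (rule has_derivative_at_withinI, rule zero[OF c(1)]) (use e(2) that in blast)
    from has_derivative_zero_constant[OF convex_ball this]
    have "\<exists>k. \<forall>s\<in>ball t0 e. (snd c \<circ> \<gamma>) s = k" by blast
    then have const: "snd c (\<gamma> s) = snd c (\<gamma> t0)" if "s \<in> ball t0 e" for s
      using that e(1) by (metis centre_in_ball comp_apply)
    have eq: "\<gamma> s = \<gamma> t0" if s: "s \<in> ball t0 e" for s
      using const[OF s] e(2) s c(2) chart_inverse(1)[OF AG c(1)] by (metis subsetD vimageD)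
    have "ball t0 e \<subseteq> E"
    proof
      fix s assume "s \<in> ball t0 e"
      from eq[OF this] t0 show "s \<in> E" by (simp add: E_def)
    qed
    with e(1) show "\<exists>e>0. ball t0 e \<subseteq> E" by blast
  qed
  moreover have "0 \<in> E" by (simp add: E_def one)
  ultimately have "E = UNIV" using clopen[of E] by auto
  then show ?thesis by (auto simp: E_def)
qed

lemma lie_exp_zero:
  fixes AG :: "('g::{t2_space, second_countable_topology}, 'h::real_normed_vector) atlas"
  assumes G: "lie_group AG G"
  shows "lie_exp AG G (\<lambda>c. 0) = \<one>\<^bsub>G\<^esub>"
proof -
  interpret group G using G by (simp add: lie_group_def)
  have "\<one>\<^bsub>G\<^esub> \<in> mcarrier AG" using G by (auto simp: lie_group_def)
  then have "smooth_map real_atlas AG (\<lambda>t. \<one>\<^bsub>G\<^esub>)"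
    by (auto simp: smooth_map_def comp_def)
  moreover have "velocity AG (\<lambda>t. \<one>\<^bsub>G\<^esub>) 0 = (\<lambda>c. 0)"
    by (auto simp: velocity_def comp_def)
  ultimately have "(THE \<gamma>. smooth_map real_atlas AG \<gamma> \<and> (\<forall>s t. \<gamma> (s + t) = \<gamma> s \<otimes>\<^bsub>G\<^esub> \<gamma> t) \<and>
      velocity AG \<gamma> 0 = (\<lambda>c. 0)) = (\<lambda>t. \<one>\<^bsub>G\<^esub>)"
    by (intro the_equality) (auto intro!: ext one_parameter_subgroup_trivial[OF G])
  then show ?thesis by (simp add: lie_exp_def)
qed

text \<open>The curve \<open>t \<mapsto> exp (- t x) p\<close> has to start at \<open>p\<close> for its velocity to be tangent at \<open>p\<close>.\<close>

lemma fundamental_field_tangent: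
  fixes AG :: "('g::{t2_space, second_countable_topology}, 'h::real_normed_vector) atlas"
    and A :: "('m::{t2_space, second_countable_topology}, 'a::real_normed_vector) atlas"
  assumes "lie_group AG G" "smooth_manifold A" "lie_action AG G A \<rho>" "p \<in> mcarrier A"
  shows "fundamental_field AG G A \<rho> x p \<in> tangent_space A p"
  using velocity_in_tangent_space[OF assms(2), of "\<lambda>t. \<rho> (lie_exp AG G (\<lambda>c. (- t) *\<^sub>R x c)) p" 0]
    lie_exp_zero[OF assms(1)] assms(3,4)
  by (simp add: fundamental_field_def lie_action_def)

lemma lie_action_smooth:
  assumes "lie_group AG G" "smooth_manifold A" "lie_action AG G A \<rho>" "g \<in> carrier G"
  shows "smooth_manifold_map A A (\<rho> g)"
  using assms by (intro smooth_map_slice[of AG A A \<rho> g]) (auto simp: lie_group_def lie_action_def)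

section \<open>Pull-back of relative homotopy moment maps\<close>

text \<open>If \<open>X p\<close> were not tangent at \<open>p\<close>, the left-hand side would be \<open>0\<close> there by convention, and
  the equation could fail.\<close>

lemma contraction_pullback:
  assumes f: "smooth_manifold_map A B f" and X: "\<And>p. p \<in> mcarrier A \<Longrightarrow> X p \<in> tangent_space A p"
    and rel: "field_related A B f X Y"
  shows "contraction A X (pullback A B f \<alpha>) = pullback A B f (contraction B Y \<alpha>)"
proof (intro ext)
  fix p vs
  show "contraction A X (pullback A B f \<alpha>) p vs = pullback A B f (contraction B Y \<alpha>) p vs"
  proof (cases "p \<in> mcarrier A \<and> set vs \<subseteq> tangent_space A p")
    case True
    have "set (map (tmap A B f p) vs) \<subseteq> tangent_space B (f p)"
      using True tmap_in_tangent_space[OF f] by auto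
    then show ?thesis
      using True X[of p] rel smooth_manifold_mapD(4)[OF f, of p]
      by (simp add: contraction_def pullback_def field_related_def)
  qed (auto simp: contraction_def pullback_def)
qed

lemma rel_pullback_add:
  "rel_pullback F F' \<phi> \<psi> (\<Psi> + \<Theta>) = rel_pullback F F' \<phi> \<psi> \<Psi> + rel_pullback F F' \<phi> \<psi> \<Theta>"
  by (auto simp: rel_pullback_def pullback_def fun_eq_iff)

lemma rel_pullback_sum:
  "rel_pullback F F' \<phi> \<psi> (\<Sum>i\<in>I. X i) = (\<Sum>i\<in>I. rel_pullback F F' \<phi> \<psi> (X i))"
  by (induction I rule: infinite_finite_induct) (simp_all add: rel_pullback_add)

lemma rel_pullback_scale:
  "rel_pullback F F' \<phi> \<psi> (rel_scale r \<Psi>) = rel_scale r (rel_pullback F F' \<phi> \<psi> \<Psi>)"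
  by (simp add: rel_pullback_lin)

lemma alt_multilinear_if:
  "alt_multilinear V k g \<Longrightarrow> alt_multilinear V k (\<lambda>xs. if b then g xs else 0)"
  by (cases b) (simp_all add: alt_multilinear_def)

text \<open>Every operation in the defining equation commutes with the pull-back, so that the equation
  for \<open>F\<close> is the pull-back of the equation for \<open>F'\<close>.\<close>

lemma rel_moment_map_pullback:
  fixes F :: "('m::{t2_space, second_countable_topology}, 'a::real_normed_vector,
               'n::{t2_space, second_countable_topology}, 'b::real_normed_vector) arrow"
    and F' :: "('m'::{t2_space, second_countable_topology}, 'a'::real_normed_vector,
                'n'::{t2_space, second_countable_topology}, 'b'::real_normed_vector) arrow"
    and AG :: "('g::{t2_space, second_countable_topology}, 'h::real_normed_vector) atlas"
  assumes F: "smooth_arrow F" and F': "smooth_arrow F'" and \<Phi>: "arrow_morphism F F' \<phi> \<psi>"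
    and G: "lie_group AG G" and act: "arrow_action AG G F \<rho>M \<rho>N" and act': "arrow_action AG G F' \<rho>M' \<rho>N'"
    and eqM: "\<And>g p. g \<in> carrier G \<Longrightarrow> p \<in> mcarrier (src F) \<Longrightarrow> \<phi> (\<rho>M g p) = \<rho>M' g (\<phi> p)"
    and eqN: "\<And>g q. g \<in> carrier G \<Longrightarrow> q \<in> mcarrier (tgt F) \<Longrightarrow> \<psi> (\<rho>N g q) = \<rho>N' g (\<psi> q)"
    and mm: "rel_moment_map AG G F' \<rho>M' \<rho>N' n \<Psi> f"
    and relM: "\<And>x. x \<in> lie_algebra AG G \<Longrightarrow> field_related (src F) (src F') \<phi>
      (fundamental_field AG G (src F) \<rho>M x) (fundamental_field AG G (src F') \<rho>M' x)"
    and relN: "\<And>x. x \<in> lie_algebra AG G \<Longrightarrow> field_related (tgt F) (tgt F') \<psi>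
      (fundamental_field AG G (tgt F) \<rho>N x) (fundamental_field AG G (tgt F') \<rho>N' x)"
  shows "rel_moment_map AG G F \<rho>M \<rho>N n (rel_pullback F F' \<phi> \<psi> \<Psi>) (\<lambda>k xs. rel_pullback F F' \<phi> \<psi> (f k xs))"
proof -
  let ?p = "rel_pullback F F' \<phi> \<psi>"
  note \<phi> = arrow_morphismD(1)[OF F F' \<Phi>] and \<psi> = arrow_morphismD(2)[OF F F' \<Phi>]
  have actM: "lie_action AG G (src F) \<rho>M" "lie_action AG G (src F') \<rho>M'"
    and actN: "lie_action AG G (tgt F) \<rho>N" "lie_action AG G (tgt F') \<rho>N'"
    using act act' by (auto simp: arrow_action_def)
  define f0 where "f0 k xs = (if k \<in> {1..n} then f k xs else 0)" for k xs
  have \<Psi>: "\<Psi> \<in> rel_closed F' (n + 1)" and pres: "rel_preserved G F' \<rho>M' \<rho>N' \<Psi>"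
    and forms: "\<And>k xs. k \<in> {1..n} \<Longrightarrow> length xs = k \<Longrightarrow> set xs \<subseteq> lie_algebra AG G \<Longrightarrow>
        f k xs \<in> rel_forms F' (n - k)"
    and alt: "\<And>k q vs. k \<in> {1..n} \<Longrightarrow> alt_multilinear (lie_algebra AG G) k (\<lambda>xs. fst (f k xs) q vs)"
      "\<And>k q vs. k \<in> {1..n} \<Longrightarrow> alt_multilinear (lie_algebra AG G) k (\<lambda>xs. snd (f k xs) q vs)"
    and eq: "\<And>k xs. k \<in> {1..n + 1} \<Longrightarrow> length xs = k \<Longrightarrow> set xs \<subseteq> lie_algebra AG G \<Longrightarrow>
      (\<Sum>(i, j)\<in>{(i, j). i < j \<and> j < k}. rel_scale ((-1) ^ (i + j + 1))
         (f0 (k - 1) (lie_algebra_bracket AG G (xs ! i) (xs ! j) # remove_nth i (remove_nth j xs))))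
      = rel_d F' (f0 k xs) + rel_scale (varsigma k)
          (fold (\<lambda>x. rel_contraction F' (fundamental_pair AG G F' \<rho>M' \<rho>N' x)) xs \<Psi>)"
    using mm unfolding rel_moment_map_def Let_def f0_def by blast+
  have preserved: "rel_preserved G F \<rho>M \<rho>N (?p \<Psi>)"
    unfolding rel_preserved_def
  proof
    fix g assume g: "g \<in> carrier G"
    have inv: "pullback (tgt F') (tgt F') (\<rho>N' g) (fst \<Psi>) =
        fst \<Psi>" "pullback (src F') (src F') (\<rho>M' g) (snd \<Psi>) = snd \<Psi>"
      using pres g by (auto simp: rel_preserved_def rel_pullback_def prod_eq_iff)
    have "pullback (tgt F) (tgt F) (\<rho>N g) (pullback (tgt F) (tgt F') \<psi> (fst \<Psi>)) =
        pullback (tgt F) (tgt F') \<psi> (pullback (tgt F') (tgt F') (\<rho>N' g) (fst \<Psi>))"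
      using pullback_pullback[OF lie_action_smooth[OF G smooth_arrowD(2)[OF F] actN(1) g]
          \<psi> eqN[OF g], of "fst \<Psi>"]
        pullback_pullback[OF \<psi> lie_action_smooth[OF G smooth_arrowD(2)[OF F'] actN(2) g] refl,
            of "fst \<Psi>"] by simp
    moreover have "pullback (src F) (src F) (\<rho>M g) (pullback (src F) (src F') \<phi> (snd \<Psi>)) =
        pullback (src F) (src F') \<phi> (pullback (src F') (src F') (\<rho>M' g) (snd \<Psi>))"
      using pullback_pullback[OF lie_action_smooth[OF G smooth_arrowD(1)[OF F] actM(1) g]
          \<phi> eqM[OF g], of "snd \<Psi>"]
        pullback_pullback[OF \<phi> lie_action_smooth[OF G smooth_arrowD(1)[OF F'] actM(2) g] refl,
            of "snd \<Psi>"] by simp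
    ultimately show "rel_pullback F F (\<rho>M g) (\<rho>N g) (?p \<Psi>) = ?p \<Psi>"
      by (simp add: rel_pullback_def inv)
  qed
  have contr: "rel_contraction F (fundamental_pair AG G F \<rho>M \<rho>N x) (?p \<Theta>) =
      ?p (rel_contraction F' (fundamental_pair AG G F' \<rho>M' \<rho>N' x) \<Theta>)" if x: "x \<in> lie_algebra AG G"
          for x \<Theta>
  proof -
    have "contraction (tgt F) (fundamental_field AG G (tgt F) \<rho>N x) (pullback (tgt F) (tgt F') \<psi>
        (fst \<Theta>)) =
        pullback (tgt F) (tgt F') \<psi> (contraction (tgt F') (fundamental_field AG G (tgt F') \<rho>N' x)
            (fst \<Theta>))"
      by (rule contraction_pullback[OF \<psi> fundamental_field_tangent[OF G smooth_arrowD(2)[OF F]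
          actN(1)] relN[OF x]])
    moreover have "contraction (src F) (fundamental_field AG G (src F) \<rho>M x) (pullback (src F) (src
        F') \<phi> (snd \<Theta>)) =
        pullback (src F) (src F') \<phi> (contraction (src F') (fundamental_field AG G (src F') \<rho>M' x)
            (snd \<Theta>))"
      by (rule contraction_pullback[OF \<phi> fundamental_field_tangent[OF G smooth_arrowD(1)[OF F]
          actM(1)] relM[OF x]])
    moreover have "pullback (src F) (src F') \<phi> (- \<beta>) = - pullback (src F) (src F') \<phi> \<beta>"
        for \<beta> :: "('m', 'a', real) form"
      by (auto simp: pullback_def fun_eq_iff)
    ultimately show ?thesis
      by (simp add: rel_contraction_def fundamental_pair_def rel_pullback_def)
  qed
  have fold: "fold (\<lambda>x. rel_contraction F (fundamental_pair AG G F \<rho>M \<rho>N x)) xs (?p \<Theta>) =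
      ?p (fold (\<lambda>x. rel_contraction F' (fundamental_pair AG G F' \<rho>M' \<rho>N' x)) xs \<Theta>)"
    if "set xs \<subseteq> lie_algebra AG G" for xs \<Theta>
    using that by (induction xs arbitrary: \<Theta>) (simp_all add: contr)
  have p0: "(if k \<in> {1..n} then ?p (f k xs) else 0) = ?p (f0 k xs)" for k xs
    by (simp add: f0_def)
  have d: "?p (rel_d F' (f0 k xs)) = rel_d F (?p (f0 k xs))"
    if "length xs = k" "set xs \<subseteq> lie_algebra AG G" for k xs
    using rel_pullback_d[OF F F' \<Phi> forms[OF _ that]] by (simp add: f0_def rel_zero)
  have "(\<Sum>(i, j)\<in>{(i, j). i < j \<and> j < k}. rel_scale ((-1) ^ (i + j + 1))
        (?p (f0 (k - 1) (lie_algebra_bracket AG G (xs ! i) (xs ! j) # remove_nth i (remove_nth j xs)))))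
      = rel_d F (?p (f0 k xs)) + rel_scale (varsigma k)
          (fold (\<lambda>x. rel_contraction F (fundamental_pair AG G F \<rho>M \<rho>N x)) xs (?p \<Psi>))"
    if "k \<in> {1..n + 1}" "length xs = k" "set xs \<subseteq> lie_algebra AG G" for k xs
    using arg_cong[OF eq[OF that], of ?p] that
    by (simp only: rel_pullback_sum rel_pullback_add rel_pullback_scale fold d case_prod_beta
        case_prod_unfold)
  moreover have "alt_multilinear (lie_algebra AG G) k (\<lambda>xs. fst (?p (f k xs)) q vs)"
    "alt_multilinear (lie_algebra AG G) k (\<lambda>xs. snd (?p (f k xs)) q' vs')" if "k \<in> {1..n}"
        for k q vs q' vs'
    unfolding rel_pullback_def pullback_def fst_conv snd_conv
        by (rule alt_multilinear_if[OF alt(1)[OF that]], rule alt_multilinear_if[OF alt(2)[OF that]])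
  ultimately show ?thesis
    using rel_pullback_closed[OF F F' \<Phi> \<Psi>] preserved forms rel_pullback_forms[OF F F' \<Phi>]
    unfolding rel_moment_map_def Let_def p0 by auto
qed

section \<open>Naturality of the relative constructions\<close>

theorem theorem3p22:
  fixes F :: "('m::{t2_space, second_countable_topology}, 'a::real_normed_vector,
               'n::{t2_space, second_countable_topology}, 'b::real_normed_vector) arrow"
    and F' :: "('m'::{t2_space, second_countable_topology}, 'a'::real_normed_vector,
                'n'::{t2_space, second_countable_topology}, 'b'::real_normed_vector) arrow"
    and \<phi> :: "'m \<Rightarrow> 'm'" and \<psi> :: "'n \<Rightarrow> 'n'"
  assumes F: "smooth_arrow F" and F': "smooth_arrow F'"
    and \<Phi>: "arrow_morphism F F' \<phi> \<psi>"
  shows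
    "\<comment> \<open>(i)\<close>
     (\<forall>k. (\<forall>\<Psi>\<in>rel_forms F' k.
              rel_pullback F F' \<phi> \<psi> \<Psi> \<in> rel_forms F k \<and>
              rel_pullback F F' \<phi> \<psi> (rel_d F' \<Psi>) = rel_d F (rel_pullback F F' \<phi> \<psi> \<Psi>)) \<and>
          (\<forall>\<Psi>\<in>rel_forms F' k. \<forall>\<Theta>\<in>rel_forms F' k. \<forall>r s.
              rel_pullback F F' \<phi> \<psi> (rel_lin r \<Psi> s \<Theta>) =
              rel_lin r (rel_pullback F F' \<phi> \<psi> \<Psi>) s (rel_pullback F F' \<phi> \<psi> \<Theta>)) \<and>
          (\<exists>h. h \<in> rel_cohomology F' k \<rightarrow> rel_cohomology F k \<and>
              (\<forall>\<Psi>\<in>rel_closed F' k. h (rel_class F' k \<Psi>) = rel_class F k (rel_pullback F F' \<phi> \<psi> \<Psi>)) \<and>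
              (\<forall>X\<in>rel_cohomology F' k. \<forall>Y\<in>rel_cohomology F' k. \<forall>r s.
                 h (class_lin F' k r X s Y) = class_lin F k r (h X) s (h Y)))) \<and>
     \<comment> \<open>(ii)\<close>
     (\<forall>k. (\<forall>c\<in>rel_chains F k.
              rel_push k \<phi> \<psi> c \<in> rel_chains F' k \<and>
              rel_push (k - 1) \<phi> \<psi> (rel_boundary F k c) = rel_boundary F' k (rel_push k \<phi> \<psi> c)) \<and>
          (\<forall>c\<in>rel_chains F k. \<forall>c'\<in>rel_chains F k.
              rel_push k \<phi> \<psi> (c + c') = rel_push k \<phi> \<psi> c + rel_push k \<phi> \<psi> c')) \<and>
     \<comment> \<open>(iii)\<close>
     (\<forall>k. \<forall>\<Psi>\<in>rel_forms F' k. \<forall>c\<in>rel_chains F k.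
        rel_pairing F k (rel_pullback F F' \<phi> \<psi> \<Psi>) c = rel_pairing F' k \<Psi> (rel_push k \<phi> \<psi> c)) \<and>
     \<comment> \<open>(iv)\<close>
     (\<forall>k. \<forall>\<Psi>\<in>rel_closed F' k.
        rel_periods F k (rel_pullback F F' \<phi> \<psi> \<Psi>) \<subseteq> rel_periods F' k \<Psi> \<and>
        (relatively_integral F' k \<Psi> \<longrightarrow> relatively_integral F k (rel_pullback F F' \<phi> \<psi> \<Psi>))) \<and>
     \<comment> \<open>(v)\<close>
     (\<forall>\<Psi>\<in>rel_closed F' 2. \<forall>(L :: ('n', 'l) line_bundle) nab s.
        rel_prequantization F' \<Psi> L nab s \<longrightarrow>
        rel_prequantization F (rel_pullback F F' \<phi> \<psi> \<Psi>)
          (pullback_bundle (tgt F) \<psi> L)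
          (pullback_conn (tgt F) (tgt F') \<psi> L nab)
          (pullback_ident F \<circ> pullback_section \<phi> s)) \<and>
     \<comment> \<open>(vi)\<close>
     (\<forall>(AG :: ('g::{t2_space, second_countable_topology}, 'h::real_normed_vector) atlas) G
        \<rho>M \<rho>N \<rho>M' \<rho>N' n \<Psi> f.
        lie_group AG G \<and> arrow_action AG G F \<rho>M \<rho>N \<and> arrow_action AG G F' \<rho>M' \<rho>N' \<and>
        (\<forall>g\<in>carrier G. \<forall>p\<in>mcarrier (src F). \<phi> (\<rho>M g p) = \<rho>M' g (\<phi> p)) \<and>
        (\<forall>g\<in>carrier G. \<forall>q\<in>mcarrier (tgt F). \<psi> (\<rho>N g q) = \<rho>N' g (\<psi> q)) \<and>
        \<Psi> \<in> rel_closed F' (n + 1) \<and> rel_preserved G F' \<rho>M' \<rho>N' \<Psi> \<and>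
        rel_moment_map AG G F' \<rho>M' \<rho>N' n \<Psi> f \<and>
        (\<forall>x\<in>lie_algebra AG G.
           field_related (src F) (src F') \<phi>
             (fundamental_field AG G (src F) \<rho>M x) (fundamental_field AG G (src F') \<rho>M' x) \<and>
           field_related (tgt F) (tgt F') \<psi>
             (fundamental_field AG G (tgt F) \<rho>N x) (fundamental_field AG G (tgt F') \<rho>N' x)) \<longrightarrow>
        rel_moment_map AG G F \<rho>M \<rho>N n (rel_pullback F F' \<phi> \<psi> \<Psi>)
          (\<lambda>k xs. rel_pullback F F' \<phi> \<psi> (f k xs)))"
proof (intro conjI allI ballI impI)
  fix k and \<Psi> :: "('m', 'a', 'n', 'b') rel_form" assume \<Psi>: "\<Psi> \<in> rel_forms F' k"
  show "rel_pullback F F' \<phi> \<psi> \<Psi> \<in> rel_forms F k"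
    by (rule rel_pullback_forms[OF F F' \<Phi> \<Psi>])
  show "rel_pullback F F' \<phi> \<psi> (rel_d F' \<Psi>) = rel_d F (rel_pullback F F' \<phi> \<psi> \<Psi>)"
    by (rule rel_pullback_d[OF F F' \<Phi> \<Psi>])
next
  fix \<Psi> \<Theta> :: "('m', 'a', 'n', 'b') rel_form" and r s
  show "rel_pullback F F' \<phi> \<psi> (rel_lin r \<Psi> s \<Theta>) =
      rel_lin r (rel_pullback F F' \<phi> \<psi> \<Psi>) s (rel_pullback F F' \<phi> \<psi> \<Theta>)"
    by (rule rel_pullback_lin)
next
  fix k
  show "\<exists>h. h \<in> rel_cohomology F' k \<rightarrow> rel_cohomology F k \<and>
      (\<forall>\<Psi>\<in>rel_closed F' k. h (rel_class F' k \<Psi>) = rel_class F k (rel_pullback F F' \<phi> \<psi> \<Psi>)) \<and>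
      (\<forall>X\<in>rel_cohomology F' k. \<forall>Y\<in>rel_cohomology F' k. \<forall>r s.
         h (class_lin F' k r X s Y) = class_lin F k r (h X) s (h Y))"
    by (rule rel_pullback_cohomology[OF F F' \<Phi>])
next
  fix k and c c' :: "('m, 'n) rel_chain" assume c: "c \<in> rel_chains F k"
  show "rel_push k \<phi> \<psi> c \<in> rel_chains F' k"
    by (rule rel_push_chains[OF F F' \<Phi> c])
  show "rel_push (k - 1) \<phi> \<psi> (rel_boundary F k c) = rel_boundary F' k (rel_push k \<phi> \<psi> c)"
    by (rule rel_push_boundary[OF F F' \<Phi> c])
  show "rel_push k \<phi> \<psi> (c + c') = rel_push k \<phi> \<psi> c + rel_push k \<phi> \<psi> c'"
    by (rule rel_push_add)
  show "rel_pairing F k (rel_pullback F F' \<phi> \<psi> \<Psi>) c = rel_pairing F' k \<Psi> (rel_push k \<phi> \<psi> c)" for \<Psi>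
    by (rule rel_pairing_pullback[OF F F' \<Phi> c])
next
  fix k and \<Psi> :: "('m', 'a', 'n', 'b') rel_form"
  show periods: "rel_periods F k (rel_pullback F F' \<phi> \<psi> \<Psi>) \<subseteq> rel_periods F' k \<Psi>"
    by (rule rel_periods_pullback[OF F F' \<Phi>])
  assume "relatively_integral F' k \<Psi>"
  with periods show "relatively_integral F k (rel_pullback F F' \<phi> \<psi> \<Psi>)"
    by (auto simp: relatively_integral_def)
next
  fix \<Psi> and L :: "('n', 'l) line_bundle" and nab s
  assume "rel_prequantization F' \<Psi> L nab s"
  then show "rel_prequantization F (rel_pullback F F' \<phi> \<psi> \<Psi>) (pullback_bundle (tgt F) \<psi> L)
      (pullback_conn (tgt F) (tgt F') \<psi> L nab) (pullback_ident F \<circ> pullback_section \<phi> s)"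
    by (rule rel_prequantization_pullback[OF F F' \<Phi>])
next
  fix AG :: "('g::{t2_space, second_countable_topology}, 'h::real_normed_vector) atlas"
    and G \<rho>M \<rho>N \<rho>M' \<rho>N' n \<Psi> f
  assume "lie_group AG G \<and> arrow_action AG G F \<rho>M \<rho>N \<and> arrow_action AG G F' \<rho>M' \<rho>N' \<and>
    (\<forall>g\<in>carrier G. \<forall>p\<in>mcarrier (src F). \<phi> (\<rho>M g p) = \<rho>M' g (\<phi> p)) \<and>
    (\<forall>g\<in>carrier G. \<forall>q\<in>mcarrier (tgt F). \<psi> (\<rho>N g q) = \<rho>N' g (\<psi> q)) \<and>
    \<Psi> \<in> rel_closed F' (n + 1) \<and> rel_preserved G F' \<rho>M' \<rho>N' \<Psi> \<and>
    rel_moment_map AG G F' \<rho>M' \<rho>N' n \<Psi> f \<and>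
    (\<forall>x\<in>lie_algebra AG G.
       field_related (src F) (src F') \<phi>
         (fundamental_field AG G (src F) \<rho>M x) (fundamental_field AG G (src F') \<rho>M' x) \<and>
       field_related (tgt F) (tgt F') \<psi>
         (fundamental_field AG G (tgt F) \<rho>N x) (fundamental_field AG G (tgt F') \<rho>N' x))"
  then show "rel_moment_map AG G F \<rho>M \<rho>N n (rel_pullback F F' \<phi> \<psi> \<Psi>) (\<lambda>k xs. rel_pullback F F' \<phi> \<psi> (f k xs))"
    by (intro rel_moment_map_pullback[OF F F' \<Phi>, of AG G \<rho>M \<rho>N \<rho>M' \<rho>N']) blast+
qed

end
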